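(* Let $\Delta$ be an infinite irreducible locally finite thick building of type $W$, where the Coxeter group $W$ is virtually free. Let $H_n\to H$ be a converging sequence in $\mathbf{Sub}(\mathrm{Aut}(\Delta))$ whose limit $H$ is Weyl-transitive. Then $$[H:\mathrm{Mon}(H)]\leq\limsup_{n\to\infty}\,[H_n:H_n^{(\infty)}].$$ In particular, if $H_n$ has no proper open subgroup of finite index for each $n\geq 1$, then $H$ is topologically simple.
   Context: $\Delta$ is viewed as a set of chambers $\mathrm{Ch}(\Delta)$ with Weyl distance $\delta\colon\mathrm{Ch}(\Delta)\times\mathrm{Ch}(\Delta)\to W$, where $(W,S)$ is the Coxeter system of its type (finite rank); irreducible refers to $(W,S)$. Locally finite means that the graph with vertex set $\mathrm{Ch}(\Delta)$ and edges the pairs of adjacent chambers is locally finite; thick means every panel is contained in at least $3$ chambers. $\mathrm{Aut}(\Delta)$ is the group of (type-preserving, i.e. Weyl-distance-preserving) automorphisms, with the topology of pointwise convergence on chambers; it is totally disconnected locally compact. $H\leq\mathrm{Aut}(\Delta)$ is Weyl-transitive if for each $w\in W$ it is transitive on the ordered pairs $(c_1,c_2)$ of chambers with $\delta(c_1,c_2)=w$. $\mathbf{Sub}(\mathrm{Aut}(\Delta))$ is the space of closed subgroups with the Chabauty topology. For a topological group $H$, $\mathrm{Mon}(H)$ is the (possibly trivial) intersection of all non-trivial closed normal subgroups of $H$, and $H^{(\infty)}$ is the intersection of all open subgroups of finite index of $H$. $H$ is topologically simple if it is non-trivial and its only closed normal subgroups are the trivial group and $H$. Indices take values in $\{1,2,\dots\}\cup\{\infty\}$.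 *)

theory Defs
  imports
    "HOL-Algebra.Bij"
    "HOL-Algebra.Multiplicative_Group"
    "HOL-Analysis.Function_Topology"
    "HOL-Library.Extended_Nat"
    "HOL-Library.Liminf_Limsup"
begin

text \<open>Cardinals and indices take values in \<^typ>\<open>enat\<close>; all infinite values are
  identified with \<open>\<infinity>\<close>.\<close>

definition ecard :: "'a set \<Rightarrow> enat" where
  "ecard A = (if finite A then enat (card A) else \<infinity>)"

definition group_index :: "('a, 'b) monoid_scheme \<Rightarrow> 'a set \<Rightarrow> enat" where
  "group_index G H = ecard (rcosets\<^bsub>G\<^esub> H)"

definition subgroup_of :: "('a, 'b) monoid_scheme \<Rightarrow> 'a set \<Rightarrow> ('a, 'b) monoid_scheme" where
  "subgroup_of G H = G\<lparr>carrier := H\<rparr>"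

definition word_eval :: "('a, 'b) monoid_scheme \<Rightarrow> 'a list \<Rightarrow> 'a" where
  "word_eval G xs = foldr (\<lambda>x y. x \<otimes>\<^bsub>G\<^esub> y) xs \<one>\<^bsub>G\<^esub>"

text \<open>Insertion of a relator \<open>(st)\<^bsup>m\<^esup>\<close>, where \<open>m\<close> is the order of \<open>st\<close>, into a word over \<open>S\<close>.
  For \<open>s = t\<close> the relator is \<open>ss\<close>. If \<open>st\<close> has infinite order then \<^const>\<open>group.ord\<close> is \<open>0\<close>
  and the relator is the empty word, i.e. no relation is imposed.\<close>

inductive coxeter_step :: "('w, 'b) monoid_scheme \<Rightarrow> 'w set \<Rightarrow> 'w list \<Rightarrow> 'w list \<Rightarrow> bool"
  for W S where
  "\<lbrakk>xs \<in> lists S; ys \<in> lists S; s \<in> S; t \<in> S\<rbrakk>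
   \<Longrightarrow> coxeter_step W S (xs @ ys)
         (xs @ concat (replicate (group.ord W (s \<otimes>\<^bsub>W\<^esub> t)) [s, t]) @ ys)"

text \<open>The axiom \<open>presentation\<close> says that \<open>W\<close> is presented by the generators \<open>S\<close> and the relations
  \<open>(st)\<^bsup>m(s,t)\<^esup> = 1\<close>. As the relations contain \<open>s\<^sup>2 = 1\<close>, words over \<open>S\<close> without formal inverses
  suffice.\<close>

locale coxeter_system = group W for W (structure) +
  fixes S :: "'a set"
  assumes generators_closed: "S \<subseteq> carrier W"
    and involution: "s \<in> S \<Longrightarrow> ord s = 2"
    and generates: "generate W S = carrier W"
    and presentation: "\<lbrakk>xs \<in> lists S; ys \<in> lists S\<rbrakk>
      \<Longrightarrow> word_eval W xs = word_eval W ys \<longleftrightarrow> equivclp (coxeter_step W S) xs ys"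

definition coxeter_length :: "('w, 'b) monoid_scheme \<Rightarrow> 'w set \<Rightarrow> 'w \<Rightarrow> nat" where
  "coxeter_length W S w = (LEAST n. \<exists>xs\<in>lists S. length xs = n \<and> word_eval W xs = w)"

text \<open>Connectedness of the Coxeter diagram, whose edges are the pairs of non-commuting
  generators.\<close>

definition coxeter_irreducible :: "('w, 'b) monoid_scheme \<Rightarrow> 'w set \<Rightarrow> bool" where
  "coxeter_irreducible W S \<longleftrightarrow> S \<noteq> {} \<and>
     \<not> (\<exists>I J. I \<noteq> {} \<and> J \<noteq> {} \<and> I \<inter> J = {} \<and> I \<union> J = S \<and>
          (\<forall>s\<in>I. \<forall>t\<in>J. s \<otimes>\<^bsub>W\<^esub> t = t \<otimes>\<^bsub>W\<^esub> s))"

text \<open>The letter \<open>(b, True)\<close> stands for \<open>b\<close> and \<open>(b, False)\<close> for its inverse.\<close>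

definition signed_word_eval :: "('a, 'b) monoid_scheme \<Rightarrow> ('a \<times> bool) list \<Rightarrow> 'a" where
  "signed_word_eval G xs = word_eval G (map (\<lambda>(b, e). if e then b else inv\<^bsub>G\<^esub> b) xs)"

definition reduced_words :: "'a set \<Rightarrow> ('a \<times> bool) list set" where
  "reduced_words B = {xs \<in> lists (B \<times> UNIV).
     successively (\<lambda>x y. \<not> (fst x = fst y \<and> snd x \<noteq> snd y)) xs}"

definition free_basis :: "('a, 'b) monoid_scheme \<Rightarrow> 'a set \<Rightarrow> bool" where
  "free_basis G B \<longleftrightarrow> B \<subseteq> carrier G \<and> bij_betw (signed_word_eval G) (reduced_words B) (carrier G)"

definition free_group :: "('a, 'b) monoid_scheme \<Rightarrow> bool" where
  "free_group G \<longleftrightarrow> group G \<and> (\<exists>B. free_basis G B)"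

definition virtually_free :: "('a, 'b) monoid_scheme \<Rightarrow> bool" where
  "virtually_free G \<longleftrightarrow>
     (\<exists>F. subgroup F G \<and> group_index G F < \<infinity> \<and> free_group (subgroup_of G F))"

locale building = coxeter_system W S for W (structure) and S +
  fixes Ch :: "'c set" and \<delta> :: "'c \<Rightarrow> 'c \<Rightarrow> 'a"
  assumes chambers_nonempty: "Ch \<noteq> {}"
    and dist_closed: "\<lbrakk>x \<in> Ch; y \<in> Ch\<rbrakk> \<Longrightarrow> \<delta> x y \<in> carrier W"
    and WD1: "\<lbrakk>x \<in> Ch; y \<in> Ch\<rbrakk> \<Longrightarrow> \<delta> x y = \<one> \<longleftrightarrow> x = y"
    and WD2: "\<lbrakk>x \<in> Ch; x' \<in> Ch; y \<in> Ch; s \<in> S; \<delta> x' x = s\<rbrakk>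
      \<Longrightarrow> \<delta> x' y \<in> {s \<otimes> \<delta> x y, \<delta> x y}"
    and WD2_longer: "\<lbrakk>x \<in> Ch; x' \<in> Ch; y \<in> Ch; s \<in> S; \<delta> x' x = s;
        coxeter_length W S (s \<otimes> \<delta> x y) = coxeter_length W S (\<delta> x y) + 1\<rbrakk>
      \<Longrightarrow> \<delta> x' y = s \<otimes> \<delta> x y"
    and WD3: "\<lbrakk>x \<in> Ch; y \<in> Ch; s \<in> S\<rbrakk>
      \<Longrightarrow> \<exists>x'\<in>Ch. \<delta> x' x = s \<and> \<delta> x' y = s \<otimes> \<delta> x y"

definition adjacent_chambers :: "'w set \<Rightarrow> ('c \<Rightarrow> 'c \<Rightarrow> 'w) \<Rightarrow> 'c \<Rightarrow> 'c \<Rightarrow> bool" where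
  "adjacent_chambers S \<delta> c d \<longleftrightarrow> \<delta> c d \<in> S"

definition locally_finite_building :: "'w set \<Rightarrow> 'c set \<Rightarrow> ('c \<Rightarrow> 'c \<Rightarrow> 'w) \<Rightarrow> bool" where
  "locally_finite_building S Ch \<delta> \<longleftrightarrow> (\<forall>c\<in>Ch. finite {d \<in> Ch. adjacent_chambers S \<delta> c d})"

text \<open>The chambers containing the panel of type \<open>s\<close> of the chamber \<open>c\<close>.\<close>

definition panel ::
    "('w, 'b) monoid_scheme \<Rightarrow> 'c set \<Rightarrow> ('c \<Rightarrow> 'c \<Rightarrow> 'w) \<Rightarrow> 'w \<Rightarrow> 'c \<Rightarrow> 'c set" where
  "panel W Ch \<delta> s c = {d \<in> Ch. \<delta> c d \<in> {\<one>\<^bsub>W\<^esub>, s}}"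

definition thick_building ::
    "('w, 'b) monoid_scheme \<Rightarrow> 'w set \<Rightarrow> 'c set \<Rightarrow> ('c \<Rightarrow> 'c \<Rightarrow> 'w) \<Rightarrow> bool" where
  "thick_building W S Ch \<delta> \<longleftrightarrow> (\<forall>s\<in>S. \<forall>c\<in>Ch. 3 \<le> ecard (panel W Ch \<delta> s c))"

text \<open>As in \<^const>\<open>BijGroup\<close>, automorphisms are extensional functions (\<open>undefined\<close> outside \<open>Ch\<close>),
  so that equality of automorphisms is equality on chambers.\<close>

definition building_aut :: "'c set \<Rightarrow> ('c \<Rightarrow> 'c \<Rightarrow> 'w) \<Rightarrow> ('c \<Rightarrow> 'c) monoid" where
  "building_aut Ch \<delta> =
     subgroup_of (BijGroup Ch) {f \<in> Bij Ch. \<forall>c\<in>Ch. \<forall>d\<in>Ch. \<delta> (f c) (f d) = \<delta> c d}"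

definition building_aut_topology :: "'c set \<Rightarrow> ('c \<Rightarrow> 'c \<Rightarrow> 'w) \<Rightarrow> ('c \<Rightarrow> 'c) topology" where
  "building_aut_topology Ch \<delta> =
     subtopology (product_topology (\<lambda>_. discrete_topology Ch) Ch) (carrier (building_aut Ch \<delta>))"

lemma group_building_aut: "group (building_aut Ch \<delta>)"
proof -
  interpret B: group "BijGroup Ch" by (rule group_BijGroup)
  let ?A = "{f \<in> Bij Ch. \<forall>c\<in>Ch. \<forall>d\<in>Ch. \<delta> (f c) (f d) = \<delta> c d}"
  have mem: "f c \<in> Ch" if "f \<in> Bij Ch" "c \<in> Ch" for f c
    using that Bij_imp_funcset by fastforce
  have "subgroup ?A (BijGroup Ch)"
  proof (rule B.subgroupI)
    show "?A \<subseteq> carrier (BijGroup Ch)"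
      by (auto simp: BijGroup_def)
    have "(\<lambda>x\<in>Ch. x) \<in> ?A"
      using id_Bij[of Ch] by auto
    then show "?A \<noteq> {}" by blast
  next
    fix f assume f: "f \<in> ?A"
    then have fB: "f \<in> Bij Ch" by simp
    have invB: "restrict (inv_into Ch f) Ch \<in> Bij Ch"
      using restrict_inv_into_Bij[OF fB] .
    have "\<delta> (inv_into Ch f c) (inv_into Ch f d) = \<delta> c d" if "c \<in> Ch" "d \<in> Ch" for c d
    proof -
      have im: "f ` Ch = Ch" using fB by (auto simp: Bij_def bij_betw_def)
      have "inv_into Ch f c \<in> Ch" "inv_into Ch f d \<in> Ch"
        "f (inv_into Ch f c) = c" "f (inv_into Ch f d) = d"
        using that im by (auto simp: inv_into_into f_inv_into_f)
      then show ?thesis using f by (metis (mono_tags, lifting) mem_Collect_eq)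
    qed
    then show "inv\<^bsub>BijGroup Ch\<^esub> f \<in> ?A"
      using invB fB by (simp add: inv_BijGroup)
  next
    fix f g assume f: "f \<in> ?A" and g: "g \<in> ?A"
    then show "f \<otimes>\<^bsub>BijGroup Ch\<^esub> g \<in> ?A"
      by (auto simp: BijGroup_def compose_Bij compose_eq mem)
  qed
  then show ?thesis
    unfolding building_aut_def subgroup_of_def by (rule B.subgroup_imp_group)
qed

lemma topspace_building_aut_topology [simp]:
  "topspace (building_aut_topology Ch \<delta>) = carrier (building_aut Ch \<delta>)"
proof -
  have "carrier (building_aut Ch \<delta>) \<subseteq> (\<Pi>\<^sub>E c\<in>Ch. Ch)"
    by (auto simp: building_aut_def subgroup_of_def Bij_def PiE_def bij_betw_def)
  then show ?thesis
    by (auto simp: building_aut_topology_def)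
qed

definition weyl_transitive ::
    "('w, 'b) monoid_scheme \<Rightarrow> 'c set \<Rightarrow> ('c \<Rightarrow> 'c \<Rightarrow> 'w) \<Rightarrow> ('c \<Rightarrow> 'c) set \<Rightarrow> bool" where
  "weyl_transitive W Ch \<delta> H \<longleftrightarrow>
     (\<forall>w\<in>carrier W. \<forall>c1\<in>Ch. \<forall>c2\<in>Ch. \<forall>d1\<in>Ch. \<forall>d2\<in>Ch.
        \<delta> c1 c2 = w \<and> \<delta> d1 d2 = w \<longrightarrow> (\<exists>h\<in>H. h c1 = d1 \<and> h c2 = d2))"

text \<open>A topological group is given by a group \<open>G\<close> together with a topology \<open>T\<close> on its carrier.\<close>

definition closed_subgroups :: "('a, 'b) monoid_scheme \<Rightarrow> 'a topology \<Rightarrow> 'a set set" where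
  "closed_subgroups G T = {H. subgroup H G \<and> closedin T H}"

definition chabauty :: "('a, 'b) monoid_scheme \<Rightarrow> 'a topology \<Rightarrow> 'a set topology" where
  "chabauty G T = topology_generated_by
     ({{H \<in> closed_subgroups G T. H \<inter> K = {}} |K. compactin T K} \<union>
      {{H \<in> closed_subgroups G T. H \<inter> U \<noteq> {}} |U. openin T U})"

lemma topspace_chabauty [simp]: "topspace (chabauty G T) = closed_subgroups G T"
proof
  show "topspace (chabauty G T) \<subseteq> closed_subgroups G T"
    unfolding chabauty_def topology_generated_by_topspace by blast
  have "{H \<in> closed_subgroups G T. H \<inter> {} = {}}
      \<in> {{H \<in> closed_subgroups G T. H \<inter> K = {}} |K. compactin T K}"
    using compactin_empty by blast
  then show "closed_subgroups G T \<subseteq> topspace (chabauty G T)"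
    unfolding chabauty_def topology_generated_by_topspace by auto
qed

definition closed_normal_subgroups :: "('a, 'b) monoid_scheme \<Rightarrow> 'a topology \<Rightarrow> 'a set set" where
  "closed_normal_subgroups G T = {N. N \<lhd> G \<and> closedin T N}"

definition Mon :: "('a, 'b) monoid_scheme \<Rightarrow> 'a topology \<Rightarrow> 'a set" where
  "Mon G T = carrier G \<inter> \<Inter>{N \<in> closed_normal_subgroups G T. N \<noteq> {\<one>\<^bsub>G\<^esub>}}"

definition open_fin_index_subgroups :: "('a, 'b) monoid_scheme \<Rightarrow> 'a topology \<Rightarrow> 'a set set" where
  "open_fin_index_subgroups G T = {U. subgroup U G \<and> openin T U \<and> group_index G U < \<infinity>}"

definition fin_residual :: "('a, 'b) monoid_scheme \<Rightarrow> 'a topology \<Rightarrow> 'a set" where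
  "fin_residual G T = carrier G \<inter> \<Inter>(open_fin_index_subgroups G T)"

definition topologically_simple :: "('a, 'b) monoid_scheme \<Rightarrow> 'a topology \<Rightarrow> bool" where
  "topologically_simple G T \<longleftrightarrow> carrier G \<noteq> {\<one>\<^bsub>G\<^esub>} \<and>
     (\<forall>N \<in> closed_normal_subgroups G T. N = {\<one>\<^bsub>G\<^esub>} \<or> N = carrier G)"

end

(*
  Write B for the stabiliser in H of a chamber c. By an argument of Tits, a non-trivial normal
  subgroup N of H is transitive on chambers, so H = N B; if N is closed, it is therefore the
  intersection of the open normal subgroups N V of finite index, where V runs through the
  fixators of balls around c. Hence it suffices to compare the finite quotients H/U, where U is
  normal and contains such a fixator, with finite quotients of the groups H_n.

  For large n the groups H and H_n induce the same maps on a large ball around c. Sending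
  an element of H_n of small displacement to the U-coset of an element of H agreeing with it on the
  ball is multiplicative where it is defined. It extends to a surjective homomorphism from H_n to
  H/U with open kernel because the building, with its spherical rank 2 residues filled in, is
  simply connected. This holds for every Coxeter group of finite rank: two minimal galleries that
  leave a chamber along s and t can both be rerouted through the projection to its {s,t}-residue.
*)

theory Submission
  imports Defs "HOL-Algebra.Zassenhaus"
begin

section \<open>Coxeter groups\<close>

text \<open>The obstacle is that Chabauty convergence controls compact sets only and says nothing
  uniform about elements of H_n that move c far. By local finiteness the automorphisms of
  displacement at most k form a compact set, so for large n each such element of H_n agrees on a
  given ball with an element of H. This yields a local homomorphism phi to H/U, and the work lies in
  extending it.

  The constant k bounds the lengths of the longest elements of the finite subgroups generated by two
  elements of S. With this displacement phi is multiplicative across every spherical residue of rank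
  2.

  Choose for each chamber x an element sigma_x taking c to x. Then q(x,y) = phi(sigma_x^-1 sigma_y)
  is a cocycle on pairs of chambers at distance at most k, and extending phi amounts to writing q as
  a coboundary. The potential at x is the product of q along a geodesic from x to c; that it does
  not depend on the geodesic is the combinatorial form of simple connectivity.\<close>

lemma append_eq_Cons_cases:
  assumes "xs @ ys = as @ r # bs"
  shows "(\<exists>us. xs = as @ r # us \<and> bs = us @ ys) \<or> (\<exists>us. as = xs @ us \<and> ys = us @ r # bs)"
proof -
  from assms obtain us where "xs = as @ us \<and> us @ ys = r # bs \<or> xs @ us = as \<and> ys = us @ r # bs"
    unfolding append_eq_append_conv2 by blast
  then show ?thesis by (cases us) auto
qed

lemma distinct_count_list_1: "distinct xs \<Longrightarrow> x \<in> set xs \<Longrightarrow> count_list xs x = 1"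
  by (induction xs) (auto simp: count_list_0_iff)

section \<open>Words, length and reduced words\<close>

context coxeter_system
begin

abbreviation ev :: "'a list \<Rightarrow> 'a" where
  "ev \<equiv> word_eval W"

abbreviation len :: "'a \<Rightarrow> nat" where
  "len \<equiv> coxeter_length W S"

definition reduced :: "'a list \<Rightarrow> bool" where
  "reduced xs \<longleftrightarrow> xs \<in> lists S \<and> length xs = len (ev xs)"

lemma S_closed [simp]: "s \<in> S \<Longrightarrow> s \<in> carrier W"
  using generators_closed by blast

lemma ev_Nil [simp]: "ev [] = \<one>"
  by (simp add: word_eval_def)

lemma ev_Cons [simp]: "ev (x # xs) = x \<otimes> ev xs"
  by (simp add: word_eval_def)

lemma ev_closed [simp]: "xs \<in> lists S \<Longrightarrow> ev xs \<in> carrier W"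
  by (induction xs) auto

lemma ev_closed_set [simp]: "\<forall>x\<in>set xs. x \<in> S \<Longrightarrow> ev xs \<in> carrier W"
  by (rule ev_closed) blast

lemma ev_append: "xs \<in> lists S \<Longrightarrow> ys \<in> lists S \<Longrightarrow> ev (xs @ ys) = ev xs \<otimes> ev ys"
  by (induction xs) (auto simp: m_assoc)

lemma S_square [simp]: "s \<in> S \<Longrightarrow> s \<otimes> s = \<one>"
  using involution[of s] pow_ord_eq_1[of s] by (simp add: numeral_2_eq_2)

lemma S_ne_one: "s \<in> S \<Longrightarrow> s \<noteq> \<one>"
  using involution[of s] by auto

lemma S_inv [simp]: "s \<in> S \<Longrightarrow> inv s = s"
  by (simp add: inv_equality)

lemma S_cancel [simp]: "s \<in> S \<Longrightarrow> w \<in> carrier W \<Longrightarrow> s \<otimes> (s \<otimes> w) = w"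
  by (simp add: m_assoc[symmetric])

lemma ev_rev:
  assumes "xs \<in> lists S"
  shows "ev (rev xs) = inv (ev xs)"
  using assms
proof (induction xs rule: list.induct)
  case (Cons a xs)
  then have "rev xs \<in> lists S" "[a] \<in> lists S" "a \<in> S" "xs \<in> lists S" by auto
  then show ?case using ev_append[of "rev xs" "[a]"] Cons by (simp add: inv_mult_group)
qed simp

lemma ex_word:
  assumes "w \<in> carrier W"
  shows "\<exists>xs\<in>lists S. ev xs = w"
proof -
  have "w \<in> generate W S" using assms generates by simp
  then show ?thesis
  proof induction
    case one then show ?case by (intro bexI[of _ "[]"]) auto
  next
    case (incl h) then show ?case by (intro bexI[of _ "[h]"]) auto
  next
    case (inv h) then show ?case by (intro bexI[of _ "[h]"]) auto
  next
    case (eng h1 h2)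
    then obtain xs ys where "xs \<in> lists S" "ev xs = h1" "ys \<in> lists S" "ev ys = h2" by blast
    then show ?case by (intro bexI[of _ "xs @ ys"]) (auto simp: ev_append)
  qed
qed

lemma len_le: "xs \<in> lists S \<Longrightarrow> len (ev xs) \<le> length xs"
  unfolding coxeter_length_def by (rule Least_le) auto

lemma ex_reduced:
  assumes "w \<in> carrier W"
  obtains xs where "reduced xs" "ev xs = w"
proof -
  have "\<exists>n. \<exists>xs\<in>lists S. length xs = n \<and> ev xs = w"
    using ex_word[OF assms] by blast
  from LeastI_ex[OF this] obtain xs where "xs \<in> lists S" "length xs = len w" "ev xs = w"
    unfolding coxeter_length_def by blast
  then show ?thesis using that by (simp add: reduced_def)
qed

lemma reducedD: "reduced xs \<Longrightarrow> xs \<in> lists S" "reduced xs \<Longrightarrow> length xs = len (ev xs)"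
  by (auto simp: reduced_def)

lemma len_mult_le:
  assumes "u \<in> carrier W" "v \<in> carrier W"
  shows "len (u \<otimes> v) \<le> len u + len v"
proof -
  obtain xs ys where *: "reduced xs" "ev xs = u" "reduced ys" "ev ys = v"
    using ex_reduced assms by metis
  then have "len (ev (xs @ ys)) \<le> length (xs @ ys)"
    by (intro len_le) (auto dest: reducedD)
  with * show ?thesis by (auto simp: reduced_def ev_append)
qed

lemma len_one [simp]: "len \<one> = 0"
  using len_le[of "[]"] by simp

lemma len_eq_0_iff [simp]: "w \<in> carrier W \<Longrightarrow> len w = 0 \<longleftrightarrow> w = \<one>"
  by (metis ex_reduced ev_Nil reducedD(2) length_0_conv len_one)

lemma reduced_Nil [simp]: "reduced []"
  by (simp add: reduced_def)

lemma len_S [simp]: "s \<in> S \<Longrightarrow> len s = 1"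
  using len_le[of "[s]"] S_ne_one[of s] by (metis S_closed One_nat_def le_0_eq le_Suc_eq
      len_eq_0_iff ev_Cons ev_Nil length_Cons list.size(3) lists.simps r_one)

lemma reduced_append:
  assumes "reduced (xs @ ys)"
  shows "reduced xs" "reduced ys"
proof -
  have l: "xs \<in> lists S" "ys \<in> lists S" using assms by (auto simp: reduced_def)
  have "length xs + length ys \<le> len (ev xs) + len (ev ys)"
    using assms l len_mult_le[of "ev xs" "ev ys"] by (simp add: reduced_def ev_append)
  then show "reduced xs" "reduced ys"
    using l len_le[of xs] len_le[of ys] by (auto simp: reduced_def)
qed

lemma reduced_Cons: "reduced (s # xs) \<Longrightarrow> reduced xs"
  using reduced_append(2)[of "[s]" xs] by simp

section \<open>Reflections of a word, and the exchange and deletion conditions\<close>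

text \<open>The \<open>i\<close>-th entry is \<open>s\<^sub>1\<dots>s\<^sub>i\<dots>s\<^sub>1\<close>; these are the reflections whose walls are crossed by the
  gallery \<open>1, s\<^sub>1, s\<^sub>1s\<^sub>2, \<dots>\<close>.\<close>

primrec refls :: "'a list \<Rightarrow> 'a list" where
  "refls [] = []"
| "refls (s # xs) = s # map (\<lambda>t. s \<otimes> t \<otimes> s) (refls xs)"

lemma length_refls [simp]: "length (refls xs) = length xs"
  by (induction xs) auto

lemma refls_closed: "xs \<in> lists S \<Longrightarrow> set (refls xs) \<subseteq> carrier W"
  by (induction xs) auto

lemma refls_append:
  assumes "xs \<in> lists S" "ys \<in> lists S"
  shows "refls (xs @ ys) = refls xs @ map (\<lambda>t. ev xs \<otimes> t \<otimes> inv (ev xs)) (refls ys)"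
  using assms
proof (induction xs rule: list.induct)
  case Nil
  have "map (\<lambda>t. \<one> \<otimes> t \<otimes> \<one>) (refls ys) = refls ys"
    using refls_closed[OF assms(2)] by (intro map_idI) auto
  then show ?case by simp
next
  case (Cons s xs)
  then show ?case using refls_closed[OF Cons.prems(2)]
    by (auto simp: m_assoc inv_mult_group)
qed

text \<open>Putting \<open>s, t\<close> in front conjugates every entry by st, which raises its
  exponent by two, and contributes the new exponents 0 and 1.\<close>

lemma refls_dihedral:
  assumes "s \<in> S" "t \<in> S"
  shows "refls (concat (replicate n [s, t])) = map (\<lambda>j. (s \<otimes> t) [^] j \<otimes> s) [0..<2 * n]"
proof (induction n)
  case (Suc n)
  have *: "s \<otimes> (t \<otimes> ((s \<otimes> t) [^] j \<otimes> s) \<otimes> t) \<otimes> s = (s \<otimes> t) [^] Suc (Suc j) \<otimes> s" for j :: nat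
  proof -
    have "(s \<otimes> t) [^] Suc (Suc j) = (s \<otimes> t) \<otimes> (s \<otimes> t) [^] j \<otimes> (s \<otimes> t)"
      using assms nat_pow_Suc2[of "s \<otimes> t" j] by simp
    then show ?thesis using assms by (simp add: m_assoc)
  qed
  have "[0..<2 * Suc n] = 0 # Suc 0 # map (\<lambda>j. Suc (Suc j)) [0..<2 * n]"
    by (intro nth_equalityI) (auto simp: nth_Cons simp del: upt_Suc split: nat.split)
  then show ?case using Suc assms by (simp add: o_def *)
qed simp

lemma ev_dihedral:
  assumes "s \<in> S" "t \<in> S"
  shows "ev (concat (replicate n [s, t])) = (s \<otimes> t) [^] n"
proof (induction n)
  case (Suc n)
  then show ?case using assms nat_pow_Suc2[of "s \<otimes> t" n] by (simp add: m_assoc)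
qed simp

text \<open>As (st)^m = 1, the second half of the 2m reflections of the relator repeats the first.
  The map \<open>f\<close> will be conjugation by the preceding word. For infinite order m is 0 and
  the list is empty.\<close>

lemma even_count_refls_relator:
  assumes "s \<in> S" "t \<in> S"
  shows "even (count_list (map f (refls (concat (replicate (ord (s \<otimes> t)) [s, t])))) r)"
proof -
  let ?m = "ord (s \<otimes> t)"
  let ?g = "\<lambda>j. f ((s \<otimes> t) [^] (j::nat) \<otimes> s)"
  have "(s \<otimes> t) [^] (j + ?m) = (s \<otimes> t) [^] j" for j
    using assms by (simp add: nat_pow_mult[symmetric])
  then have "map ?g [?m..<?m + ?m] = map ?g [0..<?m]"
    by (intro nth_equalityI) (auto simp: add.commute)
  moreover have "[0..<2 * ?m] = [0..<?m] @ [?m..<?m + ?m]"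
    by (metis mult_2 upt_add_eq_append zero_le)
  ultimately show ?thesis
    by (simp add: refls_dihedral[OF assms] o_def)
qed

text \<open>The relator evaluates to 1, so the reflections of the words around it do not change, and
  it contributes each reflection an even number of times.\<close>

lemma coxeter_step_invariants:
  assumes "coxeter_step W S xs ys"
  shows "even (count_list (refls xs) r) = even (count_list (refls ys) r)"
    and "even (length xs) = even (length ys)"
proof -
  obtain as bs s t where *: "xs = as @ bs" "as \<in> lists S" "bs \<in> lists S" "s \<in> S" "t \<in> S"
    "ys = as @ concat (replicate (ord (s \<otimes> t)) [s, t]) @ bs" (is "_ = _ @ ?r @ _")
    using assms by (auto elim!: coxeter_step.cases)
  have "concat (replicate n [s, t]) \<in> lists S" for n
    using * by (induction n) auto
  then have r: "?r \<in> lists S" by blast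
  have one: "ev ?r = \<one>" using * by (simp add: ev_dihedral)
  have "map (\<lambda>t. \<one> \<otimes> t \<otimes> inv \<one>) (refls bs) = refls bs"
    using refls_closed[OF *(3)] by (intro map_idI) auto
  then have "refls (?r @ bs) = refls ?r @ refls bs"
    using refls_append[OF r *(3)] by (simp only: one)
  then have "refls ys = refls as @ map (\<lambda>t. ev as \<otimes> t \<otimes> inv (ev as)) (refls ?r)
      @ map (\<lambda>t. ev as \<otimes> t \<otimes> inv (ev as)) (refls bs)"
    using * r refls_append[of as "?r @ bs"] by simp
  then show "even (count_list (refls xs) r) = even (count_list (refls ys) r)"
    using * even_count_refls_relator[OF *(4,5), of "\<lambda>t. ev as \<otimes> t \<otimes> inv (ev as)" r]
    by (simp add: refls_append)
  show "even (length xs) = even (length ys)"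
    using * by (simp add: length_concat sum_list_replicate)
qed

text \<open>By the presentation, two words for one element are joined by insertions and removals of
  relators. Geometrically: whether a wall separates two chambers does not depend on the gallery
  joining them.\<close>

lemma ev_eq_invariants:
  assumes "xs \<in> lists S" "ys \<in> lists S" "ev xs = ev ys"
  shows "even (count_list (refls xs) r) = even (count_list (refls ys) r)"
    and "even (length xs) = even (length ys)"
proof -
  have "equivclp (coxeter_step W S) xs ys" using assms presentation by blast
  then have "even (count_list (refls xs) r) = even (count_list (refls ys) r) \<and>
      even (length xs) = even (length ys)"
    by (induction rule: equivclp_induct) (metis coxeter_step_invariants)+
  then show "even (count_list (refls xs) r) = even (count_list (refls ys) r)"
    "even (length xs) = even (length ys)" by auto
qed

text \<open>A reflection occurring once occurs an odd number of times, hence appears in every word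
  for the same element; so no such word is shorter.\<close>

lemma distinct_refls_imp_reduced:
  assumes "xs \<in> lists S" "distinct (refls xs)"
  shows "reduced xs"
proof -
  obtain ys where ys: "reduced ys" "ev ys = ev xs" using ex_reduced assms(1) ev_closed by metis
  have "set (refls xs) \<subseteq> set (refls ys)"
  proof
    fix r assume "r \<in> set (refls xs)"
    then have "count_list (refls xs) r = 1"
      using assms(2) by (simp add: distinct_count_list_1)
    then have "odd (count_list (refls xs) r)" by simp
    then have "odd (count_list (refls ys) r)"
      using ev_eq_invariants(1)[OF assms(1) reducedD(1)[OF ys(1)]] ys(2) by simp
    then show "r \<in> set (refls ys)" by (metis count_notin even_zero)
  qed
  then have "card (set (refls xs)) \<le> card (set (refls ys))" by (intro card_mono) auto
  then have "length xs \<le> length ys"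
    using distinct_card[OF assms(2)] card_length[of "refls ys"] by simp
  then show ?thesis using ys assms(1) len_le[OF assms(1)] by (auto simp: reduced_def)
qed

text \<open>Multiplication by an entry s1...si...s1 turns the prefix s1...si into s1...s(i-1), which
  drops the letter si.\<close>

lemma strong_exchange:
  assumes "xs \<in> lists S" "t \<in> set (refls xs)"
  shows "\<exists>as r bs. xs = as @ r # bs \<and> t \<otimes> ev xs = ev (as @ bs)"
  using assms
proof (induction xs arbitrary: t rule: list.induct)
  case (Cons s xs)
  then consider "t = s" | t' where "t' \<in> set (refls xs)" "t = s \<otimes> t' \<otimes> s" by auto
  then show ?case
  proof cases
    case 1
    then show ?thesis using Cons.prems by (intro exI[of _ "[]"]) auto
  next
    case 2
    then obtain as r bs where *: "xs = as @ r # bs" "t' \<otimes> ev xs = ev (as @ bs)"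
      using Cons.IH[of t'] Cons.prems by auto
    have "t' \<in> carrier W" using 2 Cons.prems refls_closed[of xs] by auto
    moreover have "ev xs \<in> carrier W" "s \<in> S" using Cons.prems by auto
    ultimately have "t \<otimes> ev (s # xs) = s \<otimes> (t' \<otimes> ev xs)"
      using 2(2) by (simp add: m_assoc)
    then show ?thesis using * by (intro exI[of _ "s # as"] exI[of _ r] exI[of _ bs]) simp
  qed
qed simp

text \<open>Conjugation by \<open>s\<close> is an involution fixing \<open>s\<close>. Hence
  \<open>s\<close> is a repeated entry of \<open>refls (s # xs)\<close> as soon as it occurs in
  \<open>refls xs\<close>.\<close>

lemma conj_refls_self:
  assumes "s \<in> S" "xs \<in> lists S"
  shows "s \<in> (\<lambda>t. s \<otimes> t \<otimes> s) ` set (refls xs) \<longleftrightarrow> s \<in> set (refls xs)"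
proof
  assume "s \<in> (\<lambda>t. s \<otimes> t \<otimes> s) ` set (refls xs)"
  then obtain t where t: "t \<in> set (refls xs)" "s = s \<otimes> t \<otimes> s" by auto
  have "t \<in> carrier W" using t refls_closed[OF assms(2)] by auto
  then have "s \<otimes> (s \<otimes> t \<otimes> s) \<otimes> s = t" using assms by (simp add: m_assoc)
  moreover have "s \<otimes> (s \<otimes> t \<otimes> s) \<otimes> s = s" using t(2) assms(1) by simp
  ultimately show "s \<in> set (refls xs)" using t(1) by simp
next
  assume "s \<in> set (refls xs)"
  then show "s \<in> (\<lambda>t. s \<otimes> t \<otimes> s) ` set (refls xs)"
    using assms(1) by (intro image_eqI[of _ _ s]) auto
qed

text \<open>If the tail has no repeated reflection, the repetition involves the first letter
  \<open>s\<close>; strong exchange in the tail then removes \<open>s\<close> together with one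
  further letter.\<close>

lemma deletion_refls:
  assumes "xs \<in> lists S" "\<not> distinct (refls xs)"
  shows "\<exists>as s bs t cs. xs = as @ s # bs @ t # cs \<and> ev xs = ev (as @ bs @ cs)"
  using assms
proof (induction xs rule: list.induct)
  case (Cons s xs)
  have s: "s \<in> S" and xs: "xs \<in> lists S" using Cons.prems(1) by auto
  have "inj_on (\<lambda>t. s \<otimes> t \<otimes> s) (set (refls xs))"
    using refls_closed[OF xs] s by (intro inj_onI) (auto simp: subset_iff)
  with Cons.prems consider "\<not> distinct (refls xs)" | "s \<in> set (refls xs)"
    using conj_refls_self[OF s xs] by (auto simp: distinct_map)
  then show ?case
  proof cases
    case 1
    then obtain as a bs b cs where "xs = as @ a # bs @ b # cs" "ev xs = ev (as @ bs @ cs)"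
      using Cons.IH xs by blast
    then show ?thesis by (intro exI[of _ "s # as"]) force
  next
    case 2
    then obtain bs t cs where "xs = bs @ t # cs" "s \<otimes> ev xs = ev (bs @ cs)"
      using strong_exchange[OF xs] by blast
    then show ?thesis by (intro exI[of _ "[]"]) force
  qed
qed simp

lemma deletion:
  assumes "xs \<in> lists S" "\<not> reduced xs"
  obtains as s bs t cs where "xs = as @ s # bs @ t # cs" "ev xs = ev (as @ bs @ cs)"
  using deletion_refls[OF assms(1)] distinct_refls_imp_reduced[OF assms(1)] assms(2) by blast

lemma reduced_imp_distinct_refls:
  assumes "reduced xs"
  shows "distinct (refls xs)"
proof (rule ccontr)
  assume "\<not> distinct (refls xs)"
  then obtain as s bs t cs where *: "xs = as @ s # bs @ t # cs" "ev xs = ev (as @ bs @ cs)"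
    using deletion_refls[OF reducedD(1)[OF assms]] by blast
  then have "as @ bs @ cs \<in> lists S" using reducedD(1)[OF assms] by auto
  then show False using len_le[of "as @ bs @ cs"] * assms by (simp add: reduced_def)
qed

text \<open>Here \<open>s # xs\<close> is not reduced, so one of its reflections is repeated; those
  of \<open>xs\<close> are distinct, so it is \<open>s\<close> itself.\<close>

lemma exchange:
  assumes "reduced xs" "s \<in> S" "len (s \<otimes> ev xs) \<le> len (ev xs)"
  obtains as r bs where "xs = as @ r # bs" "s \<otimes> ev xs = ev (as @ bs)"
proof -
  have xs: "xs \<in> lists S" using assms reducedD by blast
  have "\<not> reduced (s # xs)" using assms by (auto simp: reduced_def)
  then have "\<not> distinct (refls (s # xs))"
    using distinct_refls_imp_reduced[of "s # xs"] xs assms(2) by auto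
  moreover have "inj_on (\<lambda>t. s \<otimes> t \<otimes> s) (set (refls xs))"
    using refls_closed[OF xs] assms(2) by (intro inj_onI) (auto simp: subset_iff)
  ultimately have "s \<in> set (refls xs)"
    using reduced_imp_distinct_refls[OF assms(1)] conj_refls_self[OF assms(2) xs]
    by (auto simp: distinct_map)
  then show ?thesis using strong_exchange[OF xs] that by blast
qed

lemma even_len_iff:
  assumes "s \<in> S" "w \<in> carrier W"
  shows "even (len (s \<otimes> w)) \<longleftrightarrow> odd (len w)"
proof -
  obtain xs where xs: "reduced xs" "ev xs = w" using ex_reduced assms by blast
  obtain ys where ys: "reduced ys" "ev ys = s \<otimes> w" using ex_reduced assms S_closed m_closed by metis
  have "even (length (s # xs)) = even (length ys)"
    using ev_eq_invariants(2)[of "s # xs" ys] xs ys assms reducedD by auto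
  then show ?thesis using reducedD(2)[OF xs(1)] reducedD(2)[OF ys(1)] xs(2) ys(2) by simp
qed

lemma len_S_mult:
  assumes "s \<in> S" "w \<in> carrier W"
  shows "len (s \<otimes> w) = len w + 1 \<or> len w = len (s \<otimes> w) + 1"
proof -
  have "len (s \<otimes> w) \<le> len w + 1" using len_mult_le[of s w] assms by simp
  moreover have "len w \<le> len (s \<otimes> w) + 1"
    using len_mult_le[of s "s \<otimes> w"] assms by simp
  moreover have "len (s \<otimes> w) \<noteq> len w" using even_len_iff[OF assms] by metis
  ultimately show ?thesis by linarith
qed

lemma ex_descent:
  assumes "w \<in> carrier W" "w \<noteq> \<one>"
  obtains s where "s \<in> S" "len w = len (s \<otimes> w) + 1"
proof -
  obtain xs where xs: "reduced xs" "ev xs = w" using ex_reduced assms by blast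
  then obtain s ys where sy: "xs = s # ys" using assms(2) by (cases xs) auto
  then have s: "s \<in> S" "ys \<in> lists S" "s \<otimes> w = ev ys"
    using xs reducedD(1)[OF xs(1)] by auto
  have "len (ev ys) \<le> length ys" using len_le s by blast
  then have "len (s \<otimes> w) < len w" using xs sy s reducedD(2)[OF xs(1)] by simp
  then show ?thesis using that[OF s(1)] len_S_mult[OF s(1) assms(1)] by auto
qed

section \<open>Minimal coset representatives and finite dihedral subgroups\<close>

lemma ex_reduced_sub:
  assumes "J \<subseteq> S" "xs \<in> lists J"
  shows "\<exists>ys\<in>lists J. reduced ys \<and> ev ys = ev xs"
  using assms(2)
proof (induction xs rule: length_induct)
  case (1 xs)
  show ?case
  proof (cases "reduced xs")
    case False
    have "xs \<in> lists S" using 1 assms(1) by auto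
    then obtain as s bs t cs where *: "xs = as @ s # bs @ t # cs" "ev xs = ev (as @ bs @ cs)"
      using deletion False by metis
    then have "as @ bs @ cs \<in> lists J" using 1 by auto
    then show ?thesis using 1(1) * by simp
  qed (use 1 in auto)
qed

text \<open>\<open>ys\<close> spells a shortest element of its coset of the subgroup generated by
  \<open>J\<close>. Two letters deleted from \<open>xs @ ys\<close> cannot both lie in one of the
  two reduced words, and one from each would give a shorter element of that coset.\<close>

lemma reduced_append_minimal:
  assumes "J \<subseteq> S" "xs \<in> lists J" "reduced xs" "reduced ys"
    and min: "\<And>zs. zs \<in> lists J \<Longrightarrow> len (ev ys) \<le> len (ev zs \<otimes> ev ys)"
  shows "reduced (xs @ ys)"
proof (rule ccontr)
  assume "\<not> reduced (xs @ ys)"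
  have l: "xs \<in> lists S" "ys \<in> lists S" using assms reducedD by auto
  then obtain as s bs t cs where *: "xs @ ys = as @ s # bs @ t # cs"
      "ev (xs @ ys) = ev (as @ bs @ cs)"
    using deletion[of "xs @ ys"] \<open>\<not> reduced (xs @ ys)\<close> by (metis append_in_lists_conv)
  consider (left) us where "xs = as @ s # bs @ t # us" "cs = us @ ys"
    | (right) us where "as = xs @ us" "ys = us @ s # bs @ t # cs"
    | (mid) us vs where "bs = us @ vs" "xs = as @ s # us" "ys = vs @ t # cs"
    using append_eq_Cons_cases[OF *(1)] append_eq_Cons_cases by metis
  then show False
  proof cases
    case left
    then have "ev xs \<otimes> ev ys = ev (as @ bs @ us) \<otimes> ev ys"
      using * l ev_append[of "as @ bs @ us" ys] ev_append[of xs ys] by simp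
    then have "ev xs = ev (as @ bs @ us)" using l left by (simp add: ev_append)
    then show False using len_le[of "as @ bs @ us"] assms(3) left l by (simp add: reduced_def)
  next
    case right
    then have "ev xs \<otimes> ev ys = ev xs \<otimes> ev (us @ bs @ cs)"
      using * l ev_append[of xs "us @ bs @ cs"] ev_append[of xs ys] by simp
    then have "ev ys = ev (us @ bs @ cs)" using l right by (simp add: ev_append)
    then show False using len_le[of "us @ bs @ cs"] assms(4) right l by (simp add: reduced_def)
  next
    case mid
    then have eq: "ev xs \<otimes> ev ys = ev (as @ us) \<otimes> ev (vs @ cs)"
      using * l ev_append[of "as @ us" "vs @ cs"] ev_append[of xs ys] by simp
    have l': "as @ us \<in> lists S" "vs @ cs \<in> lists S" using l mid by auto
    have z: "rev (as @ us) @ xs \<in> lists J" using mid assms(2) by auto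
    \<comment> \<open>Cancelling \<open>as @ us\<close> exhibits \<open>ev (vs @ cs)\<close>, whose
      word is one letter shorter than \<open>ys\<close>, as an element of the coset of
      \<open>ev ys\<close>.\<close>
    have "ev (rev (as @ us) @ xs) \<otimes> ev ys = inv (ev (as @ us)) \<otimes> (ev xs \<otimes> ev ys)"
    proof -
      have "rev (as @ us) \<in> lists S" using l'(1) by auto
      then have "ev (rev (as @ us) @ xs) = inv (ev (as @ us)) \<otimes> ev xs"
        using l(1) ev_append ev_rev[OF l'(1)] by metis
      then show ?thesis using l l' by (simp add: m_assoc del: append_in_lists_conv)
    qed
    also have "\<dots> = ev (vs @ cs)" using l' eq by (simp add: m_assoc[symmetric] del: append_in_lists_conv)
    finally have "len (ev ys) \<le> length (vs @ cs)"
      using min[OF z] len_le[OF l'(2)] by simp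
    then show False using assms(4) mid by (simp add: reduced_def)
  qed
qed

text \<open>The factor \<open>ev xs\<close> is the longest element of a finite dihedral parabolic subgroup.\<close>

lemma dihedral_factor:
  assumes "w \<in> carrier W" "s \<in> S" "t \<in> S"
    and "len (s \<otimes> w) < len w" "len (t \<otimes> w) < len w"
  obtains xs v where "xs \<in> lists {s, t}" "v \<in> carrier W" "w = ev xs \<otimes> v"
    "len w = len (ev xs) + len v"
    "len (s \<otimes> ev xs) < len (ev xs)" "len (t \<otimes> ev xs) < len (ev xs)"
proof -
  let ?J = "{s, t}"
  have J: "?J \<subseteq> S" using assms by auto
  define P where "P = (\<lambda>zs. zs \<in> lists ?J)"
  obtain zs where zs: "P zs" "\<And>y. P y \<Longrightarrow> len (ev zs \<otimes> w) \<le> len (ev y \<otimes> w)"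
    using ex_has_least_nat[of P "[]" "\<lambda>zs. len (ev zs \<otimes> w)"] by (auto simp: P_def)
  \<comment> \<open>\<open>v\<close> is a shortest element of the coset of \<open>w\<close>; the
    dihedral factor of \<open>w\<close> is then the inverse of \<open>ev zs\<close>.\<close>
  define v where "v = ev zs \<otimes> w"
  have lzs: "zs \<in> lists ?J" "zs \<in> lists S" using zs(1) J by (auto simp: P_def)
  have v: "v \<in> carrier W" using lzs assms(1) by (simp add: v_def)
  obtain ys where ys: "reduced ys" "ev ys = v" using ex_reduced v by blast
  have min: "len (ev ys) \<le> len (ev us \<otimes> ev ys)" if "us \<in> lists ?J" for us
  proof -
    have us: "us \<in> lists S" using that J by auto
    then have "ev us \<otimes> v = ev (us @ zs) \<otimes> w"
      unfolding v_def using lzs assms(1) by (simp add: ev_append m_assoc)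
    moreover have "P (us @ zs)" using that lzs by (simp add: P_def)
    ultimately show ?thesis using zs(2)[of "us @ zs"] ys(2) v_def by simp
  qed
  have add: "len (ev us \<otimes> v) = len (ev us) + len v" if us: "us \<in> lists ?J" for us
  proof -
    obtain us' where us': "us' \<in> lists ?J" "reduced us'" "ev us' = ev us"
      using ex_reduced_sub[OF J us] by blast
    have "reduced (us' @ ys)" using reduced_append_minimal[OF J us'(1,2) ys(1) min] .
    moreover have "ev (us' @ ys) = ev us \<otimes> v"
      using us' ys reducedD(1) by (simp add: ev_append)
    ultimately show ?thesis
      using reducedD(2) us'(2,3) ys by (metis length_append)
  qed
  define xs where "xs = rev zs"
  have xs: "xs \<in> lists ?J" "xs \<in> lists S" using lzs by (auto simp: xs_def)
  have w: "w = ev xs \<otimes> v"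
    using lzs assms(1) by (simp add: xs_def ev_rev v_def m_assoc[symmetric])
  \<comment> \<open>Lengths add on this coset, so a descent of \<open>w\<close> is already a descent
    of its dihedral factor.\<close>
  have red: "len (r \<otimes> ev xs) < len (ev xs)" if r: "r \<in> ?J" "len (r \<otimes> w) < len w" for r
  proof -
    have "len (ev (r # xs) \<otimes> v) = len (ev (r # xs)) + len v" using add[of "r # xs"] xs r by auto
    moreover have "r \<in> S" using r J by blast
    ultimately have "len (r \<otimes> w) = len (r \<otimes> ev xs) + len v"
      using w xs v by (simp add: m_assoc)
    then show ?thesis using add[OF xs(1)] w r by simp
  qed
  show ?thesis
    using that[OF xs(1) v w _ red red] add[OF xs(1)] w assms by auto
qed

text \<open>Given a reduced word \<open>xs @ ys\<close> for \<open>w\<close>, multiplication by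
  \<open>s\<close> deletes one letter by exchange. It is not in \<open>xs\<close>, because
  \<open>s # xs\<close> is reduced; so it is in \<open>ys\<close>, and moving \<open>s\<close> back
  makes \<open>s # xs\<close> a prefix of a word for \<open>w\<close>.\<close>

lemma full_descent_prefix:
  assumes "w \<in> carrier W" "J \<subseteq> S" "\<And>s. s \<in> J \<Longrightarrow> len (s \<otimes> w) < len w"
    and "xs \<in> lists J" "reduced xs"
  shows "\<exists>ys\<in>lists S. reduced (xs @ ys) \<and> ev (xs @ ys) = w"
  using assms(4,5)
proof (induction xs rule: list.induct)
  case Nil
  then show ?case using ex_reduced[OF assms(1)] reducedD(1) by (metis append_Nil)
next
  case (Cons s xs)
  have s: "s \<in> S" "s \<in> J" using Cons.prems(1) assms(2) by auto
  then obtain ys where ys: "ys \<in> lists S" "reduced (xs @ ys)" "ev (xs @ ys) = w"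
    using Cons.IH Cons.prems reduced_Cons by auto
  obtain as r bs where *: "xs @ ys = as @ r # bs" "s \<otimes> ev (xs @ ys) = ev (as @ bs)"
    using exchange[OF ys(2) s(1)] ys(3) assms(3)[OF s(2)] by (metis less_imp_le)
  have l: "xs \<in> lists S" "as @ bs \<in> lists S" "s # xs \<in> lists S"
    using Cons.prems(2) reducedD(1)[OF ys(2)] * by (auto simp: reduced_def)
  consider (left) us where "xs = as @ r # us" "bs = us @ ys"
    | (right) us where "as = xs @ us" "ys = us @ r # bs"
    using append_eq_Cons_cases[OF *(1)] by metis
  then show ?case
  proof cases
    case left
    then have lu: "as @ us \<in> lists S" using l by auto
    have "ev (s # xs) \<otimes> ev ys = ev (as @ us) \<otimes> ev ys"
      using *(2) left l s ys(1) lu ev_append[OF lu ys(1)] ev_append[OF l(1) ys(1)]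
      by (simp add: m_assoc)
    then have "ev (s # xs) = ev (as @ us)"
      using l lu ys(1) ev_closed right_cancel by metis
    then have "len (ev (s # xs)) \<le> length (as @ us)" using len_le[OF lu] by simp
    then show ?thesis using Cons.prems(2) left by (simp add: reduced_def)
  next
    case right
    have "s \<otimes> ev (xs @ us @ bs) = s \<otimes> (s \<otimes> w)"
      using *(2) right ys by simp
    then have w: "ev (s # xs @ us @ bs) = w"
      using s assms(1) by simp
    moreover have "reduced (s # xs @ us @ bs)"
      using w ys(2,3) right l s reducedD(2)[OF ys(2)] by (auto simp: reduced_def)
    ultimately show ?thesis
      using right ys(1) by (intro bexI[of _ "us @ bs"]) auto
  qed
qed

text \<open>The elements tested are the longest elements of the finite subgroups generated by
  \<open>s\<close> and \<open>t\<close>; for \<open>s = t\<close> this is \<open>s\<close> itself.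
  Infinite dihedral subgroups impose nothing.\<close>

definition dihedral_bound :: "nat \<Rightarrow> bool" where
  "dihedral_bound k \<longleftrightarrow> 1 \<le> k \<and> (\<forall>s\<in>S. \<forall>t\<in>S. \<forall>xs\<in>lists {s, t}.
     len (s \<otimes> ev xs) < len (ev xs) \<longrightarrow> len (t \<otimes> ev xs) < len (ev xs) \<longrightarrow> len (ev xs) \<le> k)"

text \<open>Any reduced word over \<open>s\<close> and \<open>t\<close> is a prefix of a reduced
  word for an element with both descents. One such element therefore bounds all others for this
  pair, and there are finitely many pairs.\<close>

lemma ex_dihedral_bound:
  assumes "finite S"
  shows "\<exists>k. dihedral_bound k"
proof -
  define Q where "Q = (\<lambda>s t xs. xs \<in> lists {s, t} \<and> len (s \<otimes> ev xs) < len (ev xs)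
      \<and> len (t \<otimes> ev xs) < len (ev xs))"
  have "\<exists>k. \<forall>xs. Q s t xs \<longrightarrow> len (ev xs) \<le> k" if st: "s \<in> S" "t \<in> S" for s t
  proof (cases "\<exists>xs. Q s t xs")
    case True
    then obtain xs where xs: "Q s t xs" by blast
    have J: "{s, t} \<subseteq> S" using st by auto
    have "len (ev ys) \<le> len (ev xs)" if ys: "Q s t ys" for ys
    proof -
      obtain zs where zs: "zs \<in> lists {s, t}" "reduced zs" "ev zs = ev ys"
        using ex_reduced_sub[OF J, of ys] ys by (auto simp: Q_def)
      have "ev xs \<in> carrier W" using xs J by (auto simp: Q_def intro!: ev_closed)
      then obtain us where "reduced (zs @ us)" "ev (zs @ us) = ev xs"
        using full_descent_prefix[OF _ J _ zs(1,2), of "ev xs"] xs by (auto simp: Q_def)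
      then show ?thesis using reducedD(2) zs by (metis le_add1 length_append)
    qed
    then show ?thesis by blast
  qed blast
  then obtain k where k: "\<And>s t xs. s \<in> S \<Longrightarrow> t \<in> S \<Longrightarrow> Q s t xs \<Longrightarrow> len (ev xs) \<le> k s t"
    by metis
  define m where "m = Max (insert 1 ((\<lambda>(s, t). k s t) ` (S \<times> S)))"
  have "1 \<le> m" "\<And>s t. s \<in> S \<Longrightarrow> t \<in> S \<Longrightarrow> k s t \<le> m"
    unfolding m_def using assms by (auto intro!: Max_ge)
  then have "dihedral_bound m"
    unfolding dihedral_bound_def using k by (meson Q_def order_trans)
  then show ?thesis by blast
qed

end

section \<open>Buildings\<close>

context building
begin

abbreviation gdist :: "'c \<Rightarrow> 'c \<Rightarrow> nat" where
  "gdist x y \<equiv> len (\<delta> x y)"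

lemma delta_refl [simp]: "x \<in> Ch \<Longrightarrow> \<delta> x x = \<one>"
  using WD1 by blast

lemma adj_sym:
  assumes "x \<in> Ch" "y \<in> Ch" "\<delta> x y \<in> S"
  shows "\<delta> y x = \<delta> x y"
proof -
  have "\<one> \<in> {\<delta> x y \<otimes> \<delta> y x, \<delta> y x}"
    using WD2[of y x x "\<delta> x y"] assms by simp
  moreover have "\<delta> y x \<noteq> \<one>" using assms WD1 S_ne_one by metis
  ultimately have "\<delta> x y \<otimes> \<delta> y x = \<one>" by auto
  then have "inv \<delta> y x = \<delta> x y" using assms dist_closed by (intro inv_equality) auto
  then show ?thesis using assms dist_closed S_inv by (metis inv_inv)
qed

lemma delta_first_step:
  assumes "x \<in> Ch" "y \<in> Ch" "x \<noteq> y"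
  obtains z where "z \<in> Ch" "\<delta> x z \<in> S" "\<delta> z y = \<delta> x z \<otimes> \<delta> x y" "gdist x y = gdist z y + 1"
proof -
  have "\<delta> x y \<noteq> \<one>" using assms WD1 by blast
  then obtain s where s: "s \<in> S" "gdist x y = len (s \<otimes> \<delta> x y) + 1"
    using ex_descent[of "\<delta> x y"] dist_closed assms by metis
  obtain z where "z \<in> Ch" "\<delta> z x = s" "\<delta> z y = s \<otimes> \<delta> x y"
    using WD3[OF assms(1,2) s(1)] by blast
  then show ?thesis using that[of z] s adj_sym assms by metis
qed

lemma delta_step:
  assumes "x \<in> Ch" "y \<in> Ch" "z \<in> Ch" "\<delta> x y \<in> S"
  shows "\<delta> x z = \<delta> x y \<otimes> \<delta> y z \<or> \<delta> x z = \<delta> y z"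
    and "len (\<delta> x y \<otimes> \<delta> y z) = gdist y z + 1 \<Longrightarrow> \<delta> x z = \<delta> x y \<otimes> \<delta> y z"
  using WD2[of y x z "\<delta> x y"] WD2_longer[of y x z "\<delta> x y"] assms by auto

lemma gdist_triangle:
  assumes "x \<in> Ch" "y \<in> Ch" "z \<in> Ch"
  shows "gdist x z \<le> gdist x y + gdist y z"
  using assms(1)
proof (induction "gdist x y" arbitrary: x)
  case 0
  then have "x = y" using assms WD1 dist_closed len_eq_0_iff by metis
  then show ?case by simp
next
  case (Suc n)
  then have "x \<noteq> y" by auto
  then obtain u where u: "u \<in> Ch" "\<delta> x u \<in> S" "gdist x y = gdist u y + 1"
    using delta_first_step[OF Suc.prems assms(2)] by metis
  have "gdist u z \<le> gdist u y + gdist y z" using Suc u by simp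
  moreover have "gdist x z \<le> gdist u z + 1"
    using delta_step(1)[OF Suc.prems u(1) assms(3) u(2)] len_mult_le[of "\<delta> x u" "\<delta> u z"]
      u dist_closed[OF u(1) assms(3)] by auto
  ultimately show ?case using u by simp
qed

text \<open>The axioms change the first argument only. Walking from \<open>x\<close> to
  \<open>y\<close> and reading the adjacencies backwards bounds the opposite distance.\<close>

lemma gdist_sym:
  assumes "x \<in> Ch" "y \<in> Ch"
  shows "gdist x y = gdist y x"
proof -
  have "gdist y x \<le> gdist x y" if "x \<in> Ch" "y \<in> Ch" for x y
    using that
  proof (induction "gdist x y" arbitrary: x)
    case 0
    then have "x = y" using WD1 dist_closed len_eq_0_iff by metis
    then show ?case by simp
  next
    case (Suc n)
    then have "x \<noteq> y" by auto
    then obtain u where u: "u \<in> Ch" "\<delta> x u \<in> S" "gdist x y = gdist u y + 1"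
      using delta_first_step[OF Suc.prems] by metis
    have "gdist y u \<le> gdist u y" using Suc u by simp
    moreover have "\<delta> u x \<in> S" using u adj_sym[OF Suc.prems(1) u(1,2)] by simp
    then have "gdist u x = 1" by simp
    ultimately show ?case using gdist_triangle[of y u x] u Suc.prems by simp
  qed
  then show ?thesis using assms by (meson le_antisym)
qed

lemma gdist_eq_0_iff: "x \<in> Ch \<Longrightarrow> y \<in> Ch \<Longrightarrow> gdist x y = 0 \<longleftrightarrow> x = y"
  using WD1 dist_closed len_eq_0_iff by metis

lemma gdist_eq_1_iff: "x \<in> Ch \<Longrightarrow> y \<in> Ch \<Longrightarrow> gdist x y = 1 \<longleftrightarrow> \<delta> x y \<in> S"
proof
  assume *: "x \<in> Ch" "y \<in> Ch" "gdist x y = 1"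
  then obtain xs where xs: "reduced xs" "ev xs = \<delta> x y" using ex_reduced dist_closed by metis
  then obtain s where "xs = [s]" using * reducedD(2)[OF xs(1)] by (metis length_0_conv
      length_Suc_conv One_nat_def)
  then show "\<delta> x y \<in> S" using xs reducedD(1)[OF xs(1)] by auto
qed simp

text \<open>The length condition passes on to the next chamber \<open>u\<close> on the way to
  \<open>y\<close>, and it makes the remaining step between \<open>u\<close> and \<open>x\<close> a
  lengthening one, for which \<open>WD2_longer\<close> leaves no choice.\<close>

lemma delta_mult:
  assumes "x \<in> Ch" "y \<in> Ch" "z \<in> Ch" "len (\<delta> x y \<otimes> \<delta> y z) = gdist x y + gdist y z"
  shows "\<delta> x z = \<delta> x y \<otimes> \<delta> y z"
  using assms(1,4)
proof (induction "gdist x y" arbitrary: x)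
  case 0
  then have "x = y" using assms gdist_eq_0_iff by metis
  then show ?case using assms dist_closed by simp
next
  case (Suc n)
  then have "x \<noteq> y" by auto
  then obtain u where u: "u \<in> Ch" "\<delta> x u \<in> S" "gdist x y = gdist u y + 1"
      "\<delta> u y = \<delta> x u \<otimes> \<delta> x y"
    using delta_first_step[OF Suc.prems(1) assms(2)] by metis
  note cl = dist_closed[OF Suc.prems(1) assms(2)] dist_closed[OF assms(2,3)]
    dist_closed[OF u(1) assms(2)] S_closed[OF u(2)]
  have eq: "\<delta> x u \<otimes> (\<delta> u y \<otimes> \<delta> y z) = \<delta> x y \<otimes> \<delta> y z"
    using u cl by (simp add: m_assoc)
  have "len (\<delta> x y \<otimes> \<delta> y z) \<le> 1 + len (\<delta> u y \<otimes> \<delta> y z)"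
    using len_mult_le[of "\<delta> x u" "\<delta> u y \<otimes> \<delta> y z"] eq cl u(2) by simp
  then have l: "len (\<delta> u y \<otimes> \<delta> y z) = gdist u y + gdist y z"
    using len_mult_le[of "\<delta> u y" "\<delta> y z"] cl Suc.prems(2) u(3) by simp
  then have uz: "\<delta> u z = \<delta> u y \<otimes> \<delta> y z" using Suc u by simp
  have "\<delta> x z = \<delta> x u \<otimes> \<delta> u z"
    using delta_step(2)[OF Suc.prems(1) u(1) assms(3) u(2)] eq uz l Suc.prems(2) u(3) by simp
  then show ?case using eq uz by simp
qed

lemma panel_trans:
  assumes "x \<in> Ch" "y \<in> Ch" "z \<in> Ch" "\<delta> y x = s" "\<delta> z x = s" "s \<in> S"
  shows "y = z \<or> \<delta> y z = s"
proof -
  have "\<delta> x z = s" using adj_sym[of z x] assms by simp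
  then have "\<delta> y z = \<one> \<or> \<delta> y z = s"
    using delta_step(1)[of y x z] assms by auto
  then show ?thesis using WD1 assms by blast
qed

text \<open>Two distinct such chambers would be \<open>s\<close>-adjacent with a lengthening step
  between them, so their distances to \<open>c\<close> would differ. Thus the panel has a single
  chamber nearest to \<open>c\<close>.\<close>

lemma panel_gate_unique:
  assumes "x \<in> Ch" "y \<in> Ch" "z \<in> Ch" "c \<in> Ch" "s \<in> S" "\<delta> y x = s" "\<delta> z x = s"
    and "\<delta> y c = s \<otimes> \<delta> x c" "\<delta> z c = s \<otimes> \<delta> x c" "len (s \<otimes> \<delta> x c) < gdist x c"
  shows "y = z"
proof (rule ccontr)
  assume "y \<noteq> z"
  then have yz: "\<delta> y z = s" using panel_trans[of x y z s] assms by blast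
  have cl: "\<delta> x c \<in> carrier W" using dist_closed assms by blast
  have "len (s \<otimes> \<delta> z c) = gdist z c + 1"
    using assms cl len_S_mult[of s "\<delta> x c"] by auto
  then have "\<delta> y c = s \<otimes> \<delta> z c" using delta_step(2)[of y z c] yz assms by simp
  then have "s \<otimes> \<delta> x c = \<delta> x c" using assms cl by simp
  then show False using assms(10) by simp
qed

lemma finite_ball:
  assumes "locally_finite_building S Ch \<delta>" "c \<in> Ch"
  shows "finite {x \<in> Ch. gdist x c \<le> n}"
proof (induction n)
  case 0
  have "{x \<in> Ch. gdist x c \<le> 0} = {c}" using assms gdist_eq_0_iff by auto
  then show ?case by simp
next
  case (Suc n)
  let ?N = "\<lambda>y. insert y {d \<in> Ch. adjacent_chambers S \<delta> y d}"
  have "{x \<in> Ch. gdist x c \<le> Suc n} \<subseteq> (\<Union>y\<in>insert c {x \<in> Ch. gdist x c \<le> n}. ?N y)"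
  proof
    fix x assume x: "x \<in> {x \<in> Ch. gdist x c \<le> Suc n}"
    show "x \<in> (\<Union>y\<in>insert c {x \<in> Ch. gdist x c \<le> n}. ?N y)"
    proof (cases "x = c")
      case False
      then obtain z where "z \<in> Ch" "\<delta> x z \<in> S" "gdist x c = gdist z c + 1"
        using delta_first_step[of x c] x assms by blast
      then have "\<delta> z x \<in> S" "z \<in> Ch" "gdist z c \<le> n" using adj_sym x by auto
      then show ?thesis using x by (auto simp: adjacent_chambers_def)
    qed auto
  qed
  moreover have "finite (\<Union>y\<in>insert c {x \<in> Ch. gdist x c \<le> n}. ?N y)"
    using Suc assms unfolding locally_finite_building_def by auto
  ultimately show ?case using finite_subset by blast
qed

lemma gdist_less_imp_gate:
  assumes "x \<in> Ch" "y \<in> Ch" "c \<in> Ch" "\<delta> x y \<in> S" "gdist x c = gdist y c + 1"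
  shows "\<delta> y c = \<delta> x y \<otimes> \<delta> x c"
proof -
  have "\<delta> y x = \<delta> x y" using adj_sym assms by blast
  then show ?thesis using delta_step(1)[of y x c] assms by auto
qed

text \<open>A minimal gallery can be made to follow any chosen initial factor of the distance. This
  will produce the projection of \<open>c\<close> to a residue of rank 2.\<close>

lemma ex_intermediate:
  assumes "x \<in> Ch" "c \<in> Ch" "u \<in> carrier W" "v \<in> carrier W" "\<delta> x c = u \<otimes> v"
    and "gdist x c = len u + len v"
  obtains z where "z \<in> Ch" "\<delta> x z = u" "\<delta> z c = v"
proof -
  have "\<exists>z\<in>Ch. \<delta> x z = u \<and> \<delta> z c = v"
    using assms(1,3,5,6)
  proof (induction "len u" arbitrary: x u)
    case 0
    then show ?case using assms by (intro bexI[of _ x]) auto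
  next
    case (Suc n)
    then have "u \<noteq> \<one>" by auto
    then obtain s where s: "s \<in> S" "len u = len (s \<otimes> u) + 1"
      using ex_descent Suc.prems by metis
    obtain y where y: "y \<in> Ch" "\<delta> y x = s" "\<delta> y c = s \<otimes> \<delta> x c"
      using WD3[of x c s] Suc.prems assms s by blast
    have yc: "\<delta> y c = s \<otimes> u \<otimes> v" using y Suc.prems assms s by (simp add: m_assoc)
    have "gdist x c \<le> gdist y c + 1"
      using len_mult_le[of s "\<delta> y c"] y(3) s(1) dist_closed[OF Suc.prems(1) assms(2)] by simp
    then have "gdist y c = len (s \<otimes> u) + len v"
      using Suc.prems s len_mult_le[of "s \<otimes> u" v] assms yc by simp
    then obtain z where z: "z \<in> Ch" "\<delta> y z = s \<otimes> u" "\<delta> z c = v"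
      using Suc.hyps(1)[of "s \<otimes> u" y] Suc.hyps(2) s y yc Suc.prems by auto
    have "\<delta> x y = s" using adj_sym[of y x] y s Suc.prems by simp
    then have "\<delta> x z = u"
      using delta_step(2)[of x y z] z s y Suc.prems by simp
    then show ?case using z by blast
  qed
  then show ?thesis using that by blast
qed

text \<open>A relation rather than a function, because independence of the chosen geodesic from
  \<open>x\<close> to \<open>c\<close> is what has to be proved.\<close>

inductive geodesic_prod :: "('g, 'h) monoid_scheme \<Rightarrow> ('c \<Rightarrow> 'c \<Rightarrow> 'g) \<Rightarrow> 'c \<Rightarrow> 'c \<Rightarrow> 'g \<Rightarrow> bool"
  for Q q c where
  Nil: "geodesic_prod Q q c c \<one>\<^bsub>Q\<^esub>"
| Cons: "\<lbrakk>x \<in> Ch; y \<in> Ch; \<delta> x y \<in> S; gdist x c = gdist y c + 1; geodesic_prod Q q c y p\<rbrakk>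
    \<Longrightarrow> geodesic_prod Q q c x (q x y \<otimes>\<^bsub>Q\<^esub> p)"

end

section \<open>Triviality of local cocycles\<close>

text \<open>The bound \<open>k\<close> makes every spherical residue of rank 2 small enough for the cocycle identity
  to hold on it.\<close>

locale local_cocycle = building + Q: group Q for Q (structure) +
  fixes q :: "'c \<Rightarrow> 'c \<Rightarrow> 'd" and k :: nat and c :: 'c
  assumes k: "dihedral_bound k"
    and c: "c \<in> Ch"
    and q_closed: "\<lbrakk>x \<in> Ch; y \<in> Ch; gdist x y \<le> k\<rbrakk> \<Longrightarrow> q x y \<in> carrier Q"
    and cocycle: "\<lbrakk>x \<in> Ch; y \<in> Ch; z \<in> Ch; gdist x y \<le> k; gdist y z \<le> k; gdist x z \<le> k\<rbrakk>
      \<Longrightarrow> q x y \<otimes>\<^bsub>Q\<^esub> q y z = q x z"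
begin

abbreviation gprod :: "'c \<Rightarrow> 'd \<Rightarrow> bool" where
  "gprod \<equiv> geodesic_prod Q q c"

lemma k_pos: "1 \<le> k"
  using k by (simp add: dihedral_bound_def)

lemma gdist_adj_le: "\<delta> x y \<in> S \<Longrightarrow> gdist x y \<le> k"
  using k_pos by simp

lemma q_refl: "x \<in> Ch \<Longrightarrow> q x x = \<one>\<^bsub>Q\<^esub>"
  using cocycle[of x x x] q_closed[of x x] Q.r_cancel_one by simp

lemma gprod_closed: "gprod x p \<Longrightarrow> x \<in> Ch \<and> p \<in> carrier Q"
  by (induction rule: geodesic_prod.induct) (use c q_closed gdist_adj_le in auto)

lemma ex_gprod: "x \<in> Ch \<Longrightarrow> \<exists>p. gprod x p"
proof (induction "gdist x c" arbitrary: x)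
  case 0
  then have "x = c" using gdist_eq_0_iff c by metis
  then show ?case using geodesic_prod.Nil by metis
next
  case (Suc n)
  then have "x \<noteq> c" using c by auto
  then obtain z where z: "z \<in> Ch" "\<delta> x z \<in> S" "gdist x c = gdist z c + 1"
    using delta_first_step[OF Suc.prems c] by metis
  then obtain p where "gprod z p" using Suc by fastforce
  then have "gprod x (q x z \<otimes>\<^bsub>Q\<^esub> p)" by (rule geodesic_prod.Cons[OF Suc.prems z])
  then show ?case by blast
qed

text \<open>The cocycle identity collapses the part of a geodesic between \<open>x\<close> and
  \<open>z\<close> to the single value \<open>q x z\<close>, since distances to \<open>z\<close>
  stay at most \<open>k\<close> along it.\<close>

lemma gprod_extend:
  assumes "gprod z p" "x \<in> Ch" "gdist x z \<le> k" "gdist x c = gdist x z + gdist z c"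
  shows "gprod x (q x z \<otimes>\<^bsub>Q\<^esub> p)"
  using assms(2-)
proof (induction "gdist x z" arbitrary: x)
  note z = gprod_closed[OF assms(1)]
  {
    case 0
    then have "x = z" using gdist_eq_0_iff z by metis
    then show ?case using assms(1) q_refl z by simp
  next
    case (Suc n)
    then have "x \<noteq> z" using z by auto
    then obtain u where u: "u \<in> Ch" "\<delta> x u \<in> S" "gdist x z = gdist u z + 1"
      using delta_first_step[of x z] Suc.prems z by metis
    have "gdist u c \<le> gdist u z + gdist z c" "gdist x c \<le> gdist x u + gdist u c"
      using gdist_triangle z u c Suc.prems by blast+
    then have uc: "gdist u c = gdist u z + gdist z c" "gdist x c = gdist u c + 1"
      using u Suc.prems by auto
    have uz: "n = gdist u z" "gdist u z \<le> k" using Suc.hyps(2) Suc.prems(2) u(3) by auto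
    have "gprod u (q u z \<otimes>\<^bsub>Q\<^esub> p)" by (rule Suc.hyps(1)[OF uz(1) u(1) uz(2) uc(1)])
    then have "gprod x (q x u \<otimes>\<^bsub>Q\<^esub> (q u z \<otimes>\<^bsub>Q\<^esub> p))"
      by (rule geodesic_prod.Cons[OF Suc.prems(1) u(1,2) uc(2)])
    moreover have "q x u \<otimes>\<^bsub>Q\<^esub> q u z = q x z" "q x u \<in> carrier Q" "q u z \<in> carrier Q"
      using cocycle[of x u z] q_closed u z Suc.prems gdist_adj_le by auto
    ultimately show ?case using z Q.m_assoc by metis
  }
qed

text \<open>Induction on the distance to \<open>c\<close>. The types of the two first steps are both
  descents of \<open>\<delta> x c\<close>, so they generate a finite subgroup whose longest element
  has length at most \<open>k\<close>; the cocycle identity thus reaches across the whole residue.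
  Equal types are no special case: the residue is then a panel.\<close>

lemma gprod_unique: "gprod x p \<Longrightarrow> gprod x p' \<Longrightarrow> p = p'"
proof (induction "gdist x c" arbitrary: x p p' rule: less_induct)
  case less
  show ?case
  proof (cases "x = c")
    case True
    have "p = \<one>\<^bsub>Q\<^esub>" if "gprod c p" for p
      using that c by (cases rule: geodesic_prod.cases) auto
    then show ?thesis using less.prems True by metis
  next
    case False
    obtain y r where y: "x \<in> Ch" "y \<in> Ch" "\<delta> x y \<in> S" "gdist x c = gdist y c + 1" "gprod y r"
        "p = q x y \<otimes>\<^bsub>Q\<^esub> r"
      using less.prems(1) False by (cases rule: geodesic_prod.cases) auto
    obtain z r' where z: "z \<in> Ch" "\<delta> x z \<in> S" "gdist x c = gdist z c + 1" "gprod z r'"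
        "p' = q x z \<otimes>\<^bsub>Q\<^esub> r'"
      using less.prems(2) False by (cases rule: geodesic_prod.cases) auto
    have w: "\<delta> x c \<in> carrier W" using dist_closed y c by blast
    have yc: "\<delta> y c = \<delta> x y \<otimes> \<delta> x c" and zc: "\<delta> z c = \<delta> x z \<otimes> \<delta> x c"
      using gdist_less_imp_gate[OF y(1) y(2) c y(3,4)] gdist_less_imp_gate[OF y(1) z(1) c z(2,3)]
      by auto
    obtain xs v where xs: "xs \<in> lists {\<delta> x y, \<delta> x z}" "v \<in> carrier W" "\<delta> x c = ev xs \<otimes> v"
      "gdist x c = len (ev xs) + len v"
      "len (\<delta> x y \<otimes> ev xs) < len (ev xs)" "len (\<delta> x z \<otimes> ev xs) < len (ev xs)"
      using dihedral_factor[OF w y(3) z(2)] yc zc y(4) z(3) by auto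
    have u: "ev xs \<in> carrier W" using xs(1) y(3) z(2) by (intro ev_closed) auto
    have uk: "len (ev xs) \<le> k" using k xs y z by (auto simp: dihedral_bound_def)
    obtain z0 where z0: "z0 \<in> Ch" "\<delta> x z0 = ev xs" "\<delta> z0 c = v"
      using ex_intermediate[OF y(1) c u xs(2-4)] by blast
    \<comment> \<open>\<open>z0\<close> is the projection of \<open>c\<close> to the residue of \<open>x\<close>; both geodesics are compared with one
      through \<open>z0\<close>.\<close>
    obtain p0 where p0: "gprod z0 p0" using ex_gprod z0 by blast
    \<comment> \<open>\<open>a\<close> lies on a geodesic from \<open>x\<close> to
      \<open>z0\<close>. The induction hypothesis at \<open>a\<close> replaces the given geodesic by
      one through \<open>z0\<close>.\<close>
    have eq: "q x a \<otimes>\<^bsub>Q\<^esub> b = q x z0 \<otimes>\<^bsub>Q\<^esub> p0"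
      if a: "a \<in> Ch" "\<delta> x a \<in> S" "gdist x c = gdist a c + 1" "gprod a b"
        "len (\<delta> x a \<otimes> ev xs) < len (ev xs)" for a b
    proof -
      have xa: "\<delta> a x = \<delta> x a" by (rule adj_sym[OF y(1) a(1,2)])
      have ax: "\<delta> a c = \<delta> x a \<otimes> \<delta> x c" by (rule gdist_less_imp_gate[OF y(1) a(1) c a(2,3)])
      \<comment> \<open>Otherwise the distances would multiply and \<open>a\<close> would be as far
        from \<open>c\<close> as \<open>x\<close>.\<close>
      have "\<delta> a z0 \<noteq> ev xs"
      proof
        assume "\<delta> a z0 = ev xs"
        then have *: "\<delta> a z0 \<otimes> \<delta> z0 c = \<delta> x c" "gdist a z0 + gdist z0 c = gdist x c"
          by (simp_all only: z0(3) xs(3)[symmetric] xs(4))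
        then have "\<delta> a c = \<delta> x c"
          using delta_mult[OF a(1) z0(1) c] by metis
        then show False using a(3) by simp
      qed
      then have az: "\<delta> a z0 = \<delta> x a \<otimes> ev xs"
        using delta_step(1)[OF a(1) y(1) z0(1)] a(2) xa z0(2) by metis
      have "len (ev xs) = gdist a z0 + 1"
        using len_S_mult[OF a(2) u] a(5) az by auto
      then have az0: "gdist a c = gdist a z0 + gdist z0 c" "gdist a z0 \<le> k"
        using a(3) xs(4) z0 uk by auto
      have "gdist a c < gdist x c" using a(3) by simp
      then have "b = q a z0 \<otimes>\<^bsub>Q\<^esub> p0"
        using a(4) by (rule less.hyps) (rule gprod_extend[OF p0 a(1) az0(2,1)])
      moreover have "q x a \<otimes>\<^bsub>Q\<^esub> q a z0 = q x z0" "q x a \<in> carrier Q" "q a z0 \<in> carrier Q"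
        using cocycle[OF y(1) a(1) z0(1)] q_closed[OF y(1) a(1)] q_closed[OF a(1) z0(1)]
          gdist_adj_le[OF a(2)] uk az0(2) z0(2) by auto
      ultimately show ?thesis using gprod_closed[OF p0] Q.m_assoc by metis
    qed
    from this[OF y(2-5) xs(5)] this[OF z(1-4) xs(6)] show ?thesis using y(6) z(5) by simp
  qed
qed

text \<open>\<open>\<psi> x\<close> is the product along a geodesic from \<open>x\<close> to
  \<open>c\<close>. Adjacent chambers equally far from \<open>c\<close> are both adjacent to the
  nearest chamber of their panel, and the cocycle identity in this panel relates them.\<close>

lemma coboundary:
  obtains \<psi> where "\<And>x. x \<in> Ch \<Longrightarrow> \<psi> x \<in> carrier Q"
    and "\<And>x y. x \<in> Ch \<Longrightarrow> y \<in> Ch \<Longrightarrow> \<delta> x y \<in> S \<Longrightarrow> \<psi> x = q x y \<otimes>\<^bsub>Q\<^esub> \<psi> y"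
proof -
  obtain \<psi> where \<psi>: "\<And>x. x \<in> Ch \<Longrightarrow> gprod x (\<psi> x)" using ex_gprod by metis
  have cl: "\<psi> x \<in> carrier Q" if "x \<in> Ch" for x using \<psi> gprod_closed that by blast
  have down: "\<psi> x = q x y \<otimes>\<^bsub>Q\<^esub> \<psi> y"
    if "x \<in> Ch" "y \<in> Ch" "\<delta> x y \<in> S" "gdist x c = gdist y c + 1" for x y
    using geodesic_prod.Cons[OF that \<psi>[OF that(2)]] \<psi>[OF that(1)] gprod_unique by blast
  have "\<psi> x = q x y \<otimes>\<^bsub>Q\<^esub> \<psi> y" if xy: "x \<in> Ch" "y \<in> Ch" "\<delta> x y \<in> S" for x y
  proof -
    have yx: "\<delta> y x = \<delta> x y" using adj_sym xy by blast
    have wc: "\<delta> x c \<in> carrier W" "\<delta> y c \<in> carrier W" using dist_closed xy c by auto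
    have qcl: "q x y \<in> carrier Q" "q y x \<in> carrier Q" using q_closed gdist_adj_le xy yx by auto
    consider "\<delta> x c = \<delta> x y \<otimes> \<delta> y c" | "\<delta> x c = \<delta> y c"
      using delta_step(1)[of x y c] xy c by blast
    then show ?thesis
    proof cases
      case 1
      then consider "gdist x c = gdist y c + 1" | "gdist y c = gdist x c + 1"
        using len_S_mult[OF xy(3) wc(2)] by auto
      then show ?thesis
      proof cases
        case 2
        have "\<psi> y = q y x \<otimes>\<^bsub>Q\<^esub> \<psi> x" using down 2 xy yx by simp
        moreover have "q x y \<otimes>\<^bsub>Q\<^esub> q y x = \<one>\<^bsub>Q\<^esub>"
          using cocycle[of x y x] q_refl xy yx gdist_adj_le by simp
        ultimately show ?thesis using qcl cl[OF xy(1)] Q.m_assoc Q.l_one by metis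
      qed (use down xy in blast)
    next
      case 2
      obtain z where z: "z \<in> Ch" "\<delta> z x = \<delta> x y" "\<delta> z c = \<delta> x y \<otimes> \<delta> x c"
        using WD3[OF xy(1) c xy(3)] by blast
      \<comment> \<open>A lengthening step would make the distances of \<open>x\<close> and
        \<open>y\<close> to \<open>c\<close> differ.\<close>
      have "len (\<delta> x y \<otimes> \<delta> x c) \<noteq> gdist x c + 1"
        using delta_step(2)[OF xy(1,2) c xy(3)] 2 by force
      then have xz: "gdist x c = gdist z c + 1"
        using len_S_mult[OF xy(3) wc(1)] z by auto
      have "z \<noteq> y" using xz 2 by auto
      then have "\<delta> z y = \<delta> x y" using panel_trans[of x z y] xy yx z by blast
      then have adj: "\<delta> x z \<in> S" "\<delta> y z \<in> S"
        using adj_sym[of z x] adj_sym[of z y] z xy by auto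
      have "\<psi> x = q x z \<otimes>\<^bsub>Q\<^esub> \<psi> z" "\<psi> y = q y z \<otimes>\<^bsub>Q\<^esub> \<psi> z"
        using down xz z xy adj 2 by simp_all
      moreover have "q x y \<otimes>\<^bsub>Q\<^esub> q y z = q x z" "q y z \<in> carrier Q"
        using cocycle[of x y z] q_closed xy z adj gdist_adj_le by auto
      ultimately show ?thesis using qcl cl[OF z(1)] Q.m_assoc by metis
    qed
  qed
  then show ?thesis using that cl by blast
qed

end

section \<open>Automorphism groups\<close>

lemma carrier_subgroup_of [simp]: "carrier (subgroup_of G H) = H"
  and mult_subgroup_of [simp]: "mult (subgroup_of G H) = mult G"
  and one_subgroup_of [simp]: "one (subgroup_of G H) = one G"
  by (simp_all add: subgroup_of_def)

context building
begin

abbreviation A :: "('c \<Rightarrow> 'c) monoid" where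
  "A \<equiv> building_aut Ch \<delta>"

sublocale A: group "building_aut Ch \<delta>"
  by (rule group_building_aut)

lemma aut_carrier: "f \<in> carrier A \<longleftrightarrow> f \<in> Bij Ch \<and> (\<forall>c\<in>Ch. \<forall>d\<in>Ch. \<delta> (f c) (f d) = \<delta> c d)"
  by (simp add: building_aut_def)

lemma aut_mem [simp]: "f \<in> carrier A \<Longrightarrow> x \<in> Ch \<Longrightarrow> f x \<in> Ch"
  by (auto simp: aut_carrier Bij_def bij_betw_def)

lemma aut_delta [simp]: "f \<in> carrier A \<Longrightarrow> x \<in> Ch \<Longrightarrow> y \<in> Ch \<Longrightarrow> \<delta> (f x) (f y) = \<delta> x y"
  by (auto simp: aut_carrier)

lemma aut_mult [simp]:
  "f \<in> carrier A \<Longrightarrow> g \<in> carrier A \<Longrightarrow> x \<in> Ch \<Longrightarrow> (f \<otimes>\<^bsub>A\<^esub> g) x = f (g x)"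
  by (simp add: building_aut_def BijGroup_def compose_eq)

lemma aut_one [simp]: "x \<in> Ch \<Longrightarrow> \<one>\<^bsub>A\<^esub> x = x"
  by (simp add: building_aut_def BijGroup_def)

lemma aut_inv [simp]:
  assumes "f \<in> carrier A" "x \<in> Ch"
  shows "(inv\<^bsub>A\<^esub> f) (f x) = x" "f ((inv\<^bsub>A\<^esub> f) x) = x"
proof -
  show "(inv\<^bsub>A\<^esub> f) (f x) = x"
    using aut_mult[of "inv\<^bsub>A\<^esub> f" f x] assms by simp
  show "f ((inv\<^bsub>A\<^esub> f) x) = x"
    using aut_mult[of f "inv\<^bsub>A\<^esub> f" x] assms by simp
qed

lemma aut_cancel: "f \<in> carrier A \<Longrightarrow> g \<in> carrier A \<Longrightarrow> f \<otimes>\<^bsub>A\<^esub> (inv\<^bsub>A\<^esub> f \<otimes>\<^bsub>A\<^esub> g) = g"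
  by (simp add: A.m_assoc[symmetric])

lemma aut_ext:
  assumes "f \<in> carrier A" "g \<in> carrier A" "\<And>x. x \<in> Ch \<Longrightarrow> f x = g x"
  shows "f = g"
  using assms by (auto simp: aut_carrier Bij_def intro: extensionalityI)

section \<open>Generation by small elements and extension of local homomorphisms\<close>

definition chamber_transitive :: "('c \<Rightarrow> 'c) set \<Rightarrow> bool" where
  "chamber_transitive G \<longleftrightarrow> (\<forall>x\<in>Ch. \<forall>y\<in>Ch. \<exists>g\<in>G. g x = y)"

text \<open>Elements of displacement at most 1 generate \<open>G\<close>: if \<open>h\<close> takes
  \<open>c\<close> to the first chamber on the way from \<open>g c\<close> back to \<open>c\<close>,
  then g = he with \<open>e\<close> of displacement 1. Elements fixing \<open>c\<close> are among
  the generators.\<close>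

lemma chamber_transitive_induct:
  assumes G: "subgroup G A" "chamber_transitive G" and c: "c \<in> Ch"
    and one: "P \<one>\<^bsub>A\<^esub>"
    and step: "\<And>g e. \<lbrakk>g \<in> G; P g; e \<in> G; gdist c (e c) \<le> 1\<rbrakk> \<Longrightarrow> P (g \<otimes>\<^bsub>A\<^esub> e)"
    and "g \<in> G"
  shows "P g"
proof -
  interpret G: subgroup G A by (rule G(1))
  show ?thesis using \<open>g \<in> G\<close>
  proof (induction "gdist (g c) c" arbitrary: g)
    case 0
    then have "g c = c" using gdist_eq_0_iff[of "g c" c] c by simp
    then show ?case using step[OF G.one_closed one, of g] 0 c by simp
  next
    case (Suc n)
    have g: "g \<in> carrier A" using Suc by simp
    have "g c \<noteq> c" using Suc.hyps(2) c by auto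
    then obtain z where z: "z \<in> Ch" "\<delta> (g c) z \<in> S" "gdist (g c) c = gdist z c + 1"
      using delta_first_step[of "g c" c] c g by (metis aut_mem)
    obtain h where h: "h \<in> G" "h c = z" using G(2) c z(1) by (auto simp: chamber_transitive_def)
    define e where "e = inv\<^bsub>A\<^esub> h \<otimes>\<^bsub>A\<^esub> g"
    have e: "e \<in> G" using h Suc.prems by (simp add: e_def)
    have hA: "h \<in> carrier A" using h by simp
    have "h (e c) = g c" using hA g c by (simp add: e_def)
    then have "gdist c (e c) = gdist z (g c)"
      using aut_delta[of h c "e c"] hA e c h(2) by simp
    also have "\<dots> = 1" using gdist_sym[of z "g c"] z g c by simp
    finally have "P (h \<otimes>\<^bsub>A\<^esub> e)"
      using step h e Suc.hyps(1)[of h] Suc.hyps(2) z(3) by simp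
    moreover have "h \<otimes>\<^bsub>A\<^esub> e = g" using hA g by (simp add: e_def A.m_assoc[symmetric])
    ultimately show ?case by simp
  qed
qed

text \<open>If the extension \<open>\<theta>\<close> existed, the inverse of
  \<open>\<theta> (\<sigma> x)\<close>, times a constant on the right, would solve the coboundary
  equation for the cocycle \<open>\<phi> (?t x (\<sigma> y))\<close>. So a solution
  \<open>\<psi>\<close> is taken and \<open>\<theta>\<close> is read off from it.\<close>

lemma extend_local_hom:
  fixes Q (structure)
  assumes G: "subgroup G A" "chamber_transitive G" and c: "c \<in> Ch"
    and k: "dihedral_bound k" and "group Q"
    and closed: "\<And>g. \<lbrakk>g \<in> G; gdist c (g c) \<le> k\<rbrakk> \<Longrightarrow> \<phi> g \<in> carrier Q"
    and mult: "\<And>g h. \<lbrakk>g \<in> G; h \<in> G; gdist c (g c) \<le> k; gdist c (h c) \<le> k; gdist c (g (h c)) \<le> k\<rbrakk>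
      \<Longrightarrow> \<phi> (g \<otimes>\<^bsub>A\<^esub> h) = \<phi> g \<otimes>\<^bsub>Q\<^esub> \<phi> h"
  obtains \<theta> where "\<theta> \<in> hom (subgroup_of A G) Q" "\<And>g. \<lbrakk>g \<in> G; gdist c (g c) \<le> 1\<rbrakk> \<Longrightarrow> \<theta> g = \<phi> g"
proof -
  interpret Q: group Q by fact
  interpret G: subgroup G A by (rule G(1))
  have GA: "g \<in> carrier A" if "g \<in> G" for g using that by simp
  have "\<forall>x\<in>Ch. \<exists>g\<in>G. g c = x" using G(2) c by (auto simp: chamber_transitive_def)
  then obtain \<sigma> where \<sigma>: "\<And>x. x \<in> Ch \<Longrightarrow> \<sigma> x \<in> G" "\<And>x. x \<in> Ch \<Longrightarrow> \<sigma> x c = x" by metis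
  let ?t = "\<lambda>x g. inv\<^bsub>A\<^esub> \<sigma> x \<otimes>\<^bsub>A\<^esub> g"
  have tG: "?t x g \<in> G" if "x \<in> Ch" "g \<in> G" for x g
    using that \<sigma> by simp
  have tc: "gdist c (?t x g c) = gdist x (g c)" if "x \<in> Ch" "g \<in> G" for x g
  proof -
    have "\<delta> (\<sigma> x c) (\<sigma> x (?t x g c)) = \<delta> c (?t x g c)"
      using that \<sigma>(1) c tG by (intro aut_delta) auto
    then show ?thesis using that \<sigma> c by simp
  qed
  have tt: "?t x (\<sigma> y) \<otimes>\<^bsub>A\<^esub> ?t y g = ?t x g" if "x \<in> Ch" "y \<in> Ch" "g \<in> G" for x y g
    using that \<sigma>(1) by (simp add: A.m_assoc aut_cancel)
  have \<phi>t: "\<phi> (?t x (\<sigma> y)) \<otimes>\<^bsub>Q\<^esub> \<phi> (?t y g) = \<phi> (?t x g)"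
    if "x \<in> Ch" "y \<in> Ch" "g \<in> G" "gdist x y \<le> k" "gdist y (g c) \<le> k" "gdist x (g c) \<le> k" for x y g
  proof -
    have "(?t x (\<sigma> y) \<otimes>\<^bsub>A\<^esub> ?t y g) c = ?t x (\<sigma> y) (?t y g c)"
      using that \<sigma>(1) c by (intro aut_mult) auto
    then show ?thesis
      using mult[of "?t x (\<sigma> y)" "?t y g"] tt[of x y g] tc[of x g] tc[of y g] tc[of x "\<sigma> y"]
        tG that \<sigma> by simp
  qed
  interpret local_cocycle W S Ch \<delta> Q "\<lambda>x y. \<phi> (?t x (\<sigma> y))" k c
  proof
    show "\<phi> (?t x (\<sigma> y)) \<in> carrier Q" if "x \<in> Ch" "y \<in> Ch" "gdist x y \<le> k" for x y
      using closed tG tc[of x "\<sigma> y"] that \<sigma> by simp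
    show "\<phi> (?t x (\<sigma> y)) \<otimes>\<^bsub>Q\<^esub> \<phi> (?t y (\<sigma> z)) = \<phi> (?t x (\<sigma> z))"
      if "x \<in> Ch" "y \<in> Ch" "z \<in> Ch" "gdist x y \<le> k" "gdist y z \<le> k" "gdist x z \<le> k" for x y z
      using \<phi>t[of x y "\<sigma> z"] that \<sigma> by simp
  qed (use k c in auto)
  obtain \<psi> where \<psi>: "\<And>x. x \<in> Ch \<Longrightarrow> \<psi> x \<in> carrier Q"
    "\<And>x y. x \<in> Ch \<Longrightarrow> y \<in> Ch \<Longrightarrow> \<delta> x y \<in> S \<Longrightarrow> \<psi> x = \<phi> (?t x (\<sigma> y)) \<otimes>\<^bsub>Q\<^esub> \<psi> y"
    using coboundary by blast
  \<comment> \<open>Here \<open>g\<close> is written as \<open>\<sigma> (g c)\<close> times an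
    element fixing \<open>c\<close>, on which \<open>\<phi>\<close> is under control.\<close>
  define \<theta>0 where "\<theta>0 g = inv\<^bsub>Q\<^esub> \<psi> (g c) \<otimes>\<^bsub>Q\<^esub> \<phi> (?t (g c) g)" for g
  \<comment> \<open>\<open>\<sigma> c\<close> need not be the identity, so the value at the identity
    is divided out.\<close>
  define \<theta> where "\<theta> g = inv\<^bsub>Q\<^esub> \<theta>0 \<one>\<^bsub>A\<^esub> \<otimes>\<^bsub>Q\<^esub> \<theta>0 g" for g
  have gc: "g c \<in> Ch" if "g \<in> G" for g using that c by simp
  have \<phi>0: "\<phi> (?t (g c) g) \<in> carrier Q" if "g \<in> G" for g
    using closed tG tc[of "g c" g] that c by simp
  have \<theta>0_closed: "\<theta>0 g \<in> carrier Q" if "g \<in> G" for g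
    using \<phi>0 \<psi>(1) gc that by (simp add: \<theta>0_def)
  have \<theta>0_step: "\<theta>0 (g \<otimes>\<^bsub>A\<^esub> e) = \<theta>0 g \<otimes>\<^bsub>Q\<^esub> \<phi> e"
    if g: "g \<in> G" and e: "e \<in> G" and ec: "gdist c (e c) \<le> 1" for g e
  proof -
    let ?x = "g c" and ?y = "g (e c)" and ?h = "g \<otimes>\<^bsub>A\<^esub> e"
    have h: "?h \<in> G" "?h c = ?y" "?x \<in> Ch" "?y \<in> Ch" using g e c by auto
    have xy: "\<delta> ?x ?y = \<delta> c (e c)" using g e c by simp
    have le: "gdist ?x ?y \<le> 1" using xy ec by simp
    have cl: "\<phi> (?t ?y ?h) \<in> carrier Q" "\<phi> (?t ?x (\<sigma> ?y)) \<in> carrier Q" "\<phi> e \<in> carrier Q"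
      using \<phi>0[OF h(1)] h closed[of e] q_closed[OF h(3,4)] le e ec k_pos by auto
    have "\<psi> ?x = \<phi> (?t ?x (\<sigma> ?y)) \<otimes>\<^bsub>Q\<^esub> \<psi> ?y"
    proof (cases "?x = ?y")
      case True
      then show ?thesis using q_refl[OF h(4)] \<psi>(1)[OF h(4)] by simp
    next
      case False
      then have "gdist ?x ?y = 1" using le gdist_eq_0_iff[OF h(3,4)] by linarith
      then show ?thesis using \<psi>(2)[OF h(3,4)] gdist_eq_1_iff[OF h(3,4)] by blast
    qed
    then have "inv\<^bsub>Q\<^esub> \<psi> ?y = inv\<^bsub>Q\<^esub> \<psi> ?x \<otimes>\<^bsub>Q\<^esub> \<phi> (?t ?x (\<sigma> ?y))"
      using \<psi>(1)[OF h(4)] cl by (simp add: Q.inv_mult_group Q.m_assoc)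
    then have "\<theta>0 ?h = inv\<^bsub>Q\<^esub> \<psi> ?x \<otimes>\<^bsub>Q\<^esub> (\<phi> (?t ?x (\<sigma> ?y)) \<otimes>\<^bsub>Q\<^esub> \<phi> (?t ?y ?h))"
      using \<psi>(1)[OF h(3)] cl h by (simp add: \<theta>0_def Q.m_assoc)
    also have "\<phi> (?t ?x (\<sigma> ?y)) \<otimes>\<^bsub>Q\<^esub> \<phi> (?t ?y ?h) = \<phi> (?t ?x ?h)"
      using \<phi>t[OF h(3,4,1)] le h k_pos by simp
    also have "?t ?x ?h = ?t ?x g \<otimes>\<^bsub>A\<^esub> e"
      using g e \<sigma>(1)[OF h(3)] by (simp add: A.m_assoc)
    also have "\<phi> (?t ?x g \<otimes>\<^bsub>A\<^esub> e) = \<phi> (?t ?x g) \<otimes>\<^bsub>Q\<^esub> \<phi> e"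
    proof (rule mult)
      have "?t ?x g (e c) = (?t ?x g \<otimes>\<^bsub>A\<^esub> e) c"
        using g e \<sigma>(1)[OF h(3)] c by (intro aut_mult[symmetric]) auto
      also have "\<dots> = ?t ?x ?h c" using g e \<sigma>(1)[OF h(3)] by (simp add: A.m_assoc)
      finally show "gdist c (?t ?x g (e c)) \<le> k" using tc[OF h(3,1)] h(2) le k_pos by simp
      show "gdist c (?t ?x g c) \<le> k" using tc[OF h(3) g] h(3) by simp
      show "gdist c (e c) \<le> k" using ec k_pos by simp
    qed (use g e tG h in auto)
    finally show ?thesis using \<psi>(1)[OF h(3)] \<phi>0[OF g] cl by (simp add: \<theta>0_def Q.m_assoc)
  qed
  have \<theta>_closed: "\<theta> g \<in> carrier Q" if "g \<in> G" for g
    using \<theta>0_closed that by (simp add: \<theta>_def)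
  have \<theta>_step: "\<theta> (g \<otimes>\<^bsub>A\<^esub> e) = \<theta> g \<otimes>\<^bsub>Q\<^esub> \<phi> e"
    if "g \<in> G" "e \<in> G" "gdist c (e c) \<le> 1" for g e
    using \<theta>0_step[OF that] \<theta>0_closed that closed[of e] k_pos by (simp add: \<theta>_def Q.m_assoc)
  have \<theta>_one: "\<theta> \<one>\<^bsub>A\<^esub> = \<one>\<^bsub>Q\<^esub>" using \<theta>0_closed by (simp add: \<theta>_def)
  have \<theta>_local: "\<theta> e = \<phi> e" if "e \<in> G" "gdist c (e c) \<le> 1" for e
    using \<theta>_step[of "\<one>\<^bsub>A\<^esub>" e] that \<theta>_one closed[of e] k_pos by simp
  \<comment> \<open>The second factor is built up from elements of displacement at most 1, each of
    which is handled by \<open>\<theta>_step\<close>.\<close>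
  have "\<theta> (g \<otimes>\<^bsub>A\<^esub> h) = \<theta> g \<otimes>\<^bsub>Q\<^esub> \<theta> h" if g: "g \<in> G" and h: "h \<in> G" for g h
  proof (rule chamber_transitive_induct[OF G c _ _ h])
    show "\<theta> (g \<otimes>\<^bsub>A\<^esub> \<one>\<^bsub>A\<^esub>) = \<theta> g \<otimes>\<^bsub>Q\<^esub> \<theta> \<one>\<^bsub>A\<^esub>"
      using g \<theta>_one \<theta>_closed by simp
    show "\<theta> (g \<otimes>\<^bsub>A\<^esub> (h \<otimes>\<^bsub>A\<^esub> e)) = \<theta> g \<otimes>\<^bsub>Q\<^esub> \<theta> (h \<otimes>\<^bsub>A\<^esub> e)"
      if "h \<in> G" "\<theta> (g \<otimes>\<^bsub>A\<^esub> h) = \<theta> g \<otimes>\<^bsub>Q\<^esub> \<theta> h" "e \<in> G" "gdist c (e c) \<le> 1" for h e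
      using that g \<theta>_step[of "g \<otimes>\<^bsub>A\<^esub> h" e] \<theta>_step[of h e] \<theta>_closed closed[of e] k_pos
      by (simp add: A.m_assoc Q.m_assoc)
  qed
  then have "\<theta> \<in> hom (subgroup_of A G) Q"
    using \<theta>_closed by (auto simp: hom_def)
  then show ?thesis using that \<theta>_local by blast
qed

section \<open>Normal subgroups of Weyl-transitive groups\<close>

lemma thick_other:
  assumes "thick_building W S Ch \<delta>" "x \<in> Ch" "y \<in> Ch" "s \<in> S" "len (s \<otimes> \<delta> x y) < gdist x y"
  obtains x' where "x' \<in> Ch" "\<delta> x x' = s" "\<delta> x' y = \<delta> x y"
proof -
  obtain z where z: "z \<in> Ch" "\<delta> z x = s" "\<delta> z y = s \<otimes> \<delta> x y"
    using WD3[OF assms(2,3,4)] by blast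
  \<comment> \<open>Besides \<open>x\<close> and the chamber \<open>z\<close> nearest to
    \<open>y\<close> the panel has a third chamber; it is not nearest, so its distance to
    \<open>y\<close> is that of \<open>x\<close>.\<close>
  have "3 \<le> ecard (panel W Ch \<delta> s x)"
    using assms by (auto simp: thick_building_def)
  then have "\<not> panel W Ch \<delta> s x \<subseteq> {x, z}"
  proof (rule contrapos_pn)
    assume sub: "panel W Ch \<delta> s x \<subseteq> {x, z}"
    then have "card (panel W Ch \<delta> s x) \<le> card {x, z}" by (intro card_mono) auto
    also have "\<dots> \<le> 2" by (simp add: card_insert_if)
    finally have "card (panel W Ch \<delta> s x) < 3" by simp
    moreover have "finite (panel W Ch \<delta> s x)" using sub finite_subset by blast
    ultimately show "\<not> 3 \<le> ecard (panel W Ch \<delta> s x)"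
      by (simp add: ecard_def not_le numeral_eq_enat)
  qed
  then obtain x' where x': "x' \<in> Ch" "x' \<noteq> x" "x' \<noteq> z" "\<delta> x x' \<in> {\<one>, s}"
    by (auto simp: panel_def)
  then have xx': "\<delta> x x' = s" using WD1[of x x'] assms by auto
  then have x'x: "\<delta> x' x = s" using adj_sym[of x x'] x' assms by simp
  have "\<delta> x' y \<noteq> s \<otimes> \<delta> x y"
    using panel_gate_unique[of x x' z y s] x' x'x z assms by blast
  then have "\<delta> x' y = \<delta> x y" using delta_step(1)[of x' x y] x' x'x assms by auto
  then show ?thesis using that x' xx' by blast
qed

lemma reduced_pair:
  assumes "s \<in> S" "t \<in> S" "s \<noteq> t"
  shows "reduced [s, t]"
proof (rule ccontr)
  assume "\<not> reduced [s, t]"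
  then obtain as a bs b cs where "[s, t] = as @ a # bs @ b # cs" "ev [s, t] = ev (as @ bs @ cs)"
    using deletion[OF _ \<open>\<not> reduced [s, t]\<close>] assms(1,2)
    by (metis Cons_in_lists_iff lists.Nil)
  then have "s \<otimes> t = \<one>" using assms
    by (auto simp: Cons_eq_append_conv append_eq_Cons_conv)
  then have "inv t = s" using assms by (intro inv_equality) auto
  then show False using assms by simp
qed

text \<open>Deleting two letters of t, s, t leaves either t, which forces st = 1 and hence
  \<open>s = t\<close>, or s, which gives commutation.\<close>

lemma commute_or_reduced:
  assumes "s \<in> S" "t \<in> S" "s \<noteq> t" "\<not> reduced [t, s, t]"
  shows "s \<otimes> t = t \<otimes> s"
proof -
  obtain as a bs b cs where "[t, s, t] = as @ a # bs @ b # cs" "ev [t, s, t] = ev (as @ bs @ cs)"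
    using deletion[OF _ assms(4)] assms(1,2) by (metis Cons_in_lists_iff lists.Nil)
  then have "t \<otimes> (s \<otimes> t) = t \<or> t \<otimes> (s \<otimes> t) = s" using assms
    by (auto simp: Cons_eq_append_conv append_eq_Cons_conv)
  then consider "t \<otimes> (s \<otimes> t) = t" | "t \<otimes> (s \<otimes> t) = s" by blast
  then show ?thesis
  proof cases
    case 1
    then have "s \<otimes> t = \<one>" using assms l_cancel_one[of t "s \<otimes> t"] by auto
    then have "inv t = s" using assms by (intro inv_equality) auto
    then show ?thesis using assms by simp
  next
    case 2
    then have "t \<otimes> (t \<otimes> (s \<otimes> t)) = t \<otimes> s" by simp
    then show ?thesis using assms by simp
  qed
qed

text \<open>The types of adjacent chambers lying in one \<open>N\<close>-orbit form a set \<open>J\<close> of generators, and \<open>N\<close>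
  acts transitively on \<open>J\<close>-residues. Thickness makes \<open>J\<close> contain all letters of \<open>\<delta> x (n x)\<close>, and
  then \<open>J\<close> commutes with its complement.\<close>

lemma normal_subgroup_transitive:
  assumes thick: "thick_building W S Ch \<delta>"
    and irr: "coxeter_irreducible W S"
    and H: "subgroup H A" "weyl_transitive W Ch \<delta> H"
    and N: "N \<lhd> subgroup_of A H" "N \<noteq> {\<one>\<^bsub>A\<^esub>}"
  shows "chamber_transitive N"
proof -
  interpret H: subgroup H A by (rule H(1))
  interpret N: normal N "subgroup_of A H" by (rule N(1))
  have NH: "n \<in> H" if "n \<in> N" for n using N.subset that by auto
  have NA: "n \<in> carrier A" if "n \<in> N" for n using NH that by auto
  have invH: "inv\<^bsub>subgroup_of A H\<^esub> h = inv\<^bsub>A\<^esub> h" if "h \<in> H" for h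
    using A.m_inv_consistent[OF H(1) that] by (simp add: subgroup_of_def)
  have oneN: "\<one>\<^bsub>A\<^esub> \<in> N" using subgroup.one_closed[OF N.subgroup_axioms] by simp
  define orb where "orb x y \<longleftrightarrow> (\<exists>n\<in>N. n x = y)" for x y
  have orbE: "\<exists>n. n \<in> N \<and> n x = y" if "orb x y" for x y
    using that by (simp only: orb_def Bex_def)
  have orbI: "orb x (n x)" if "n \<in> N" for x n
    unfolding orb_def by (intro bexI[of _ n] refl that)
  have orb_sym: "orb y x" if "orb x y" "x \<in> Ch" for x y
  proof -
    from orbE[OF that(1)] obtain n where n: "n \<in> N" "n x = y" by (elim exE conjE)
    have "inv\<^bsub>A\<^esub> n \<in> N" using N.m_inv_closed[OF n(1)] invH[OF NH[OF n(1)]] by simp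
    from orbI[OF this, of y] show ?thesis
      using aut_inv(1)[OF NA[OF n(1)] that(2)] by (simp only: n(2))
  qed
  have orb_trans: "orb x z" if "orb x y" "orb y z" "x \<in> Ch" for x y z
  proof -
    from orbE[OF that(1)] obtain n where n: "n \<in> N" "n x = y" by (elim exE conjE)
    from orbE[OF that(2)] obtain m where m: "m \<in> N" "m y = z" by (elim exE conjE)
    have "m \<otimes>\<^bsub>A\<^esub> n \<in> N" using subgroup.m_closed[OF N.subgroup_axioms m(1) n(1)] by simp
    from orbI[OF this, of x] show ?thesis
      by (simp only: aut_mult[OF NA[OF m(1)] NA[OF n(1)] that(3)] n(2) m(2))
  qed
  \<comment> \<open>Being in one orbit depends on the Weyl distance only: Weyl-transitivity of
    \<open>H\<close> moves one pair to the other, and \<open>N\<close> is normal in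
    \<open>H\<close>.\<close>
  have orb_delta: "orb x' y'"
    if xy: "orb x y" "x \<in> Ch" "x' \<in> Ch" "y' \<in> Ch" "\<delta> x y = \<delta> x' y'" for x y x' y'
  proof -
    from orbE[OF xy(1)] obtain n where n: "n \<in> N" "n x = y" by (elim exE conjE)
    have y: "y \<in> Ch" using aut_mem[OF NA[OF n(1)] xy(2)] n(2) by simp
    have "\<exists>h\<in>H. h x = x' \<and> h y = y'"
      by (rule H(2)[unfolded weyl_transitive_def, rule_format, OF dist_closed[OF xy(2) y]
          xy(2) y xy(3,4) conjI[OF refl xy(5)[symmetric]]])
    then obtain h where h: "h \<in> H" "h x = x'" "h y = y'" by (elim bexE conjE)
    have hA: "h \<in> carrier A" using h by simp
    have "h \<otimes>\<^bsub>A\<^esub> n \<otimes>\<^bsub>A\<^esub> inv\<^bsub>A\<^esub> h \<in> N" using N.inv_op_closed2[of h n] h(1) n(1) invH[OF h(1)] by simp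
    from orbI[OF this, of x'] have "orb x' ((h \<otimes>\<^bsub>A\<^esub> n \<otimes>\<^bsub>A\<^esub> inv\<^bsub>A\<^esub> h) x')" .
    moreover have "(h \<otimes>\<^bsub>A\<^esub> n \<otimes>\<^bsub>A\<^esub> inv\<^bsub>A\<^esub> h) x' = y'"
    proof -
      have "(h \<otimes>\<^bsub>A\<^esub> n \<otimes>\<^bsub>A\<^esub> inv\<^bsub>A\<^esub> h) x' = h (n ((inv\<^bsub>A\<^esub> h) x'))"
        using hA NA[OF n(1)] xy(3) by simp
      also have "(inv\<^bsub>A\<^esub> h) x' = x" using aut_inv(1)[OF hA xy(2)] h(2) by simp
      finally show ?thesis using n(2) h(3) by simp
    qed
    ultimately show ?thesis by simp
  qed
  define J where "J = {s \<in> S. \<exists>x\<in>Ch. \<exists>y\<in>Ch. orb x y \<and> \<delta> x y = s}"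
  have J_orb: "orb x y" if xy: "\<delta> x y \<in> J" "x \<in> Ch" "y \<in> Ch" for x y
  proof -
    obtain x0 y0 where "x0 \<in> Ch" "y0 \<in> Ch" "orb x0 y0" "\<delta> x0 y0 = \<delta> x y"
      using xy(1) unfolding J_def by blast
    then show ?thesis using orb_delta[of x0 y0 x y] xy(2,3) by blast
  qed
  \<comment> \<open>Thickness gives \<open>x'\<close> next to \<open>x\<close> at the same distance
    from \<open>y\<close>, hence in the same orbit. So the first letter is in \<open>J\<close>, and
    the step towards \<open>y\<close> stays in the orbit.\<close>
  have letters: "set xs \<subseteq> J" if "reduced xs" "orb x y" "x \<in> Ch" "y \<in> Ch" "\<delta> x y = ev xs" for xs x y
    using that
  proof (induction xs arbitrary: x rule: list.induct)
    case (Cons s xs)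
    have s: "s \<in> S" "xs \<in> lists S" "reduced xs"
      using reducedD(1)[OF Cons.prems(1)] reduced_Cons[OF Cons.prems(1)] by auto
    have sw: "s \<otimes> \<delta> x y = ev xs" using Cons.prems(5) s by simp
    have less: "len (s \<otimes> \<delta> x y) < gdist x y"
      using sw Cons.prems(5) reducedD(2)[OF Cons.prems(1)] reducedD(2)[OF s(3)] by simp
    obtain x' where x': "x' \<in> Ch" "\<delta> x x' = s" "\<delta> x' y = \<delta> x y"
      by (rule thick_other[OF thick Cons.prems(3,4) s(1) less])
    have x'y: "orb x' y" using orb_delta[OF Cons.prems(2,3) x'(1) Cons.prems(4)] x'(3) by simp
    have xx': "orb x x'"
      by (rule orb_trans[OF Cons.prems(2) orb_sym[OF x'y x'(1)] Cons.prems(3)])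
    have sJ: "s \<in> J" unfolding J_def using xx' x'(1,2) s(1) Cons.prems(3) by blast
    obtain z where z: "z \<in> Ch" "\<delta> z x = s" "\<delta> z y = ev xs"
      using WD3[OF Cons.prems(3,4) s(1)] sw by auto
    have "orb z x" using J_orb[of z x] z(1,2) sJ Cons.prems(3) by blast
    then have "orb z y" using orb_trans[of z x y] Cons.prems(2) z(1) by blast
    then show ?case using Cons.IH[OF s(3) _ z(1) Cons.prems(4) z(3)] sJ by simp
  qed simp
  \<comment> \<open>Let \<open>n\<close> move \<open>c\<close> along an \<open>s\<close>-step and
    let \<open>d\<close> be \<open>t\<close>-adjacent to \<open>c\<close>. The distance from
    \<open>d\<close> to \<open>n d\<close> is st or tst. Reduced words for it have letters in
    \<open>J\<close> only, which rules out st and shows that [t, s, t] is not reduced.\<close>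
  have comm: "s \<otimes> t = t \<otimes> s" if s: "s \<in> J" and t: "t \<in> S" "t \<notin> J" for s t
  proof (rule commute_or_reduced)
    have sS: "s \<in> S" using s by (simp add: J_def)
    then show "s \<in> S" .
    show st: "s \<noteq> t" using s t by blast
    obtain c x where cx: "c \<in> Ch" "x \<in> Ch" "orb c x" "\<delta> c x = s" using s J_def by blast
    from orbE[OF cx(3)] obtain n where n: "n \<in> N" "n c = x" by (elim exE conjE)
    obtain d where d: "d \<in> Ch" "\<delta> d c = t" using WD3[OF cx(1,1) t(1)] by blast
    have nd: "n d \<in> Ch" "orb d (n d)"
      using aut_mem[OF NA[OF n(1)] d(1)] orbI[OF n(1)] by auto
    have "\<delta> (n d) x = t" using aut_delta[OF NA[OF n(1)] d(1) cx(1)] n(2) d(2) by simp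
    then have xnd: "\<delta> x (n d) = t" using adj_sym[OF nd(1) cx(2)] t(1) by simp
    have "gdist c x + gdist x (n d) = 2" using cx xnd sS t by simp
    moreover have "len (s \<otimes> t) = 2"
      using reducedD(2)[OF reduced_pair[OF sS t(1) st]] sS t by simp
    ultimately have cnd: "\<delta> c (n d) = s \<otimes> t"
      using delta_mult[OF cx(1,2) nd(1)] cx(4) xnd by simp
    have "\<delta> d (n d) \<noteq> s \<otimes> t"
      using letters[OF reduced_pair[OF sS t(1) st] nd(2) d(1) nd(1)] t sS by auto
    then have "\<delta> d (n d) = t \<otimes> (s \<otimes> t)"
      using delta_step(1)[OF d(1) cx(1) nd(1)] d t cnd by auto
    then show "\<not> reduced [t, s, t]"
      using letters[OF _ nd(2) d(1) nd(1), of "[t, s, t]"] t sS by auto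
  qed (use t in auto)
  have J_ne: "J \<noteq> {}"
  proof
    assume J: "J = {}"
    have "n = \<one>\<^bsub>A\<^esub>" if n: "n \<in> N" for n
    proof (rule aut_ext)
      fix x assume x: "x \<in> Ch"
      have nx: "n x \<in> Ch" using NA n x by simp
      obtain xs where xs: "reduced xs" "ev xs = \<delta> x (n x)" using ex_reduced dist_closed x nx by metis
      have "orb x (n x)" using orbI[OF n] .
      then have "xs = []" using letters[OF xs(1) _ x nx] xs(2) J by auto
      then show "n x = \<one>\<^bsub>A\<^esub> x" using xs WD1[OF x nx] x by auto
    qed (use NA n in auto)
    moreover have "\<one>\<^bsub>A\<^esub> \<in> N" by (rule oneN)
    ultimately show False using N(2) by blast
  qed
  have "S - J = {}"
  proof (rule ccontr)
    assume "S - J \<noteq> {}"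
    moreover have "J \<inter> (S - J) = {}" "J \<union> (S - J) = S" by (auto simp: J_def)
    moreover have "\<forall>s\<in>J. \<forall>t\<in>S - J. s \<otimes> t = t \<otimes> s" using comm by auto
    ultimately have "\<exists>I K. I \<noteq> {} \<and> K \<noteq> {} \<and> I \<inter> K = {} \<and> I \<union> K = S \<and>
        (\<forall>s\<in>I. \<forall>t\<in>K. s \<otimes> t = t \<otimes> s)"
      using J_ne by (intro exI[of _ J] exI[of _ "S - J"] conjI)
    then show False using irr by (simp only: coxeter_irreducible_def simp_thms)
  qed
  then have JS: "J = S" by (auto simp: J_def)
  have "orb x y" if xy: "x \<in> Ch" "y \<in> Ch" for x y
    using xy(1)
  proof (induction "gdist x y" arbitrary: x)
    case 0
    then have "x = y" using gdist_eq_0_iff xy by metis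
    then show ?case using orbI[OF oneN, of x] \<open>x \<in> Ch\<close> by simp
  next
    case (Suc m)
    then have "x \<noteq> y" by auto
    then obtain z where z: "z \<in> Ch" "\<delta> x z \<in> S" "gdist x y = gdist z y + 1"
      using delta_first_step[OF Suc.prems xy(2)] by metis
    have "orb z y" using Suc.hyps(1)[of z] Suc.hyps(2) z by simp
    moreover have "orb x z" using J_orb[of x z] z(1,2) JS Suc.prems by blast
    ultimately show ?case using orb_trans[of x z y] Suc.prems by blast
  qed
  then show ?thesis unfolding chamber_transitive_def orb_def[symmetric] by blast
qed

end

section \<open>The topology of the automorphism group\<close>

lemma openin_product_discrete:
  "openin (product_topology (\<lambda>_. discrete_topology B) I) U \<longleftrightarrow>
    U \<subseteq> (\<Pi>\<^sub>E i\<in>I. B) \<and>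
    (\<forall>f\<in>U. \<exists>F. finite F \<and> F \<subseteq> I \<and> (\<forall>g\<in>(\<Pi>\<^sub>E i\<in>I. B). (\<forall>x\<in>F. g x = f x) \<longrightarrow> g \<in> U))"
    (is "?L \<longleftrightarrow> ?R")
proof
  assume L: ?L
  then have sub: "U \<subseteq> (\<Pi>\<^sub>E i\<in>I. B)" using openin_subset by fastforce
  have "\<exists>F. finite F \<and> F \<subseteq> I \<and> (\<forall>g\<in>(\<Pi>\<^sub>E i\<in>I. B). (\<forall>x\<in>F. g x = f x) \<longrightarrow> g \<in> U)"
    if f: "f \<in> U" for f
  proof -
    obtain V where V: "finite {i \<in> I. V i \<noteq> B}" "f \<in> Pi\<^sub>E I V" "Pi\<^sub>E I V \<subseteq> U"
      using L f unfolding openin_product_topology_alt by auto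
    let ?F = "{i \<in> I. V i \<noteq> B}"
    have "g \<in> U" if g: "g \<in> (\<Pi>\<^sub>E i\<in>I. B)" "\<forall>x\<in>?F. g x = f x" for g
    proof -
      have "g i \<in> V i" if "i \<in> I" for i
      proof (cases "V i = B")
        case True
        then show ?thesis using g(1) that by (auto simp: PiE_iff)
      next
        case False
        then show ?thesis using g(2) V(2) that by (auto simp: PiE_iff)
      qed
      then have "g \<in> Pi\<^sub>E I V" using g(1) by (auto simp: PiE_iff)
      then show ?thesis using V(3) by blast
    qed
    then show ?thesis using V(1) by (intro exI[of _ ?F]) auto
  qed
  then show ?R using sub by blast
next
  assume R: ?R
  show ?L unfolding openin_product_topology_alt
  proof
    fix f assume f: "f \<in> U"
    then obtain F where F: "finite F" "F \<subseteq> I"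
      "\<And>g. g \<in> (\<Pi>\<^sub>E i\<in>I. B) \<Longrightarrow> \<forall>x\<in>F. g x = f x \<Longrightarrow> g \<in> U" using R by metis
    define V where "V = (\<lambda>i. if i \<in> F then {f i} else B)"
    have fB: "f \<in> (\<Pi>\<^sub>E i\<in>I. B)" using R f by blast
    have "{i \<in> I. V i \<noteq> B} \<subseteq> F" by (auto simp: V_def)
    then have "finite {i \<in> I. V i \<noteq> B}" using F(1) finite_subset by blast
    moreover have "\<forall>i\<in>I. V i \<subseteq> B" using fB by (auto simp: V_def PiE_iff)
    moreover have "f \<in> Pi\<^sub>E I V" using fB by (auto simp: V_def PiE_iff)
    moreover have "Pi\<^sub>E I V \<subseteq> U"
    proof
      fix g assume g: "g \<in> Pi\<^sub>E I V"
      then have "g \<in> (\<Pi>\<^sub>E i\<in>I. B)" using \<open>\<forall>i\<in>I. V i \<subseteq> B\<close> by (auto simp: PiE_iff)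
      moreover have "\<forall>x\<in>F. g x = f x" using g F(2) by (auto simp: V_def PiE_iff split: if_splits)
      ultimately show "g \<in> U" by (rule F(3))
    qed
    ultimately show "\<exists>V. finite {i \<in> I. V i \<noteq> topspace (discrete_topology B)} \<and>
        (\<forall>i\<in>I. openin (discrete_topology B) (V i)) \<and> f \<in> Pi\<^sub>E I V \<and> Pi\<^sub>E I V \<subseteq> U"
      by (intro exI[of _ V]) simp
  qed
qed

context building
begin

abbreviation T :: "('c \<Rightarrow> 'c) topology" where
  "T \<equiv> building_aut_topology Ch \<delta>"

abbreviation FT :: "('c \<Rightarrow> 'c) topology" where
  "FT \<equiv> product_topology (\<lambda>_. discrete_topology Ch) Ch"

lemma aut_subset_PiE: "carrier A \<subseteq> (\<Pi>\<^sub>E c\<in>Ch. Ch)"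
  by (auto simp: aut_carrier Bij_def PiE_def bij_betw_def)

lemma openin_T_iff:
  "openin T U \<longleftrightarrow> U \<subseteq> carrier A \<and>
    (\<forall>f\<in>U. \<exists>F. finite F \<and> F \<subseteq> Ch \<and> (\<forall>g\<in>carrier A. (\<forall>x\<in>F. g x = f x) \<longrightarrow> g \<in> U))"
    (is "?L \<longleftrightarrow> ?R")
proof
  assume ?L
  then obtain V where V: "openin FT V" "U = V \<inter> carrier A"
    unfolding building_aut_topology_def openin_subtopology by blast
  have "\<exists>F. finite F \<and> F \<subseteq> Ch \<and> (\<forall>g\<in>carrier A. (\<forall>x\<in>F. g x = f x) \<longrightarrow> g \<in> U)" if f: "f \<in> U" for f
  proof -
    have "f \<in> V" using V(2) f by simp
    from V(1)[unfolded openin_product_discrete, THEN conjunct2, THEN bspec, OF this]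
    obtain F where F: "finite F" "F \<subseteq> Ch"
      "\<forall>g\<in>(\<Pi>\<^sub>E c\<in>Ch. Ch). (\<forall>x\<in>F. g x = f x) \<longrightarrow> g \<in> V" by (elim exE conjE)
    have "\<forall>g\<in>carrier A. (\<forall>x\<in>F. g x = f x) \<longrightarrow> g \<in> U"
    proof (intro ballI impI)
      fix g assume g: "g \<in> carrier A" "\<forall>x\<in>F. g x = f x"
      then have "g \<in> V" using F(3) aut_subset_PiE by (meson subsetD)
      then show "g \<in> U" using V(2) g(1) by simp
    qed
    then show ?thesis using F(1,2) by (intro exI[of _ F] conjI)
  qed
  moreover have "U \<subseteq> carrier A" using V(2) by simp
  ultimately show ?R by simp
next
  assume R: ?R
  then obtain F where F: "\<And>f. f \<in> U \<Longrightarrow> finite (F f)" "\<And>f. f \<in> U \<Longrightarrow> F f \<subseteq> Ch"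
      "\<And>f g. f \<in> U \<Longrightarrow> g \<in> carrier A \<Longrightarrow> \<forall>x\<in>F f. g x = f x \<Longrightarrow> g \<in> U" by metis
  define V where "V = {g \<in> (\<Pi>\<^sub>E c\<in>Ch. Ch). \<exists>f\<in>U. \<forall>x\<in>F f. g x = f x}"
  have "openin FT V"
    unfolding openin_product_discrete
  proof (intro conjI ballI)
    fix g assume "g \<in> V"
    then obtain f where "f \<in> U" "\<forall>x\<in>F f. g x = f x" by (auto simp: V_def)
    then show "\<exists>F. finite F \<and> F \<subseteq> Ch \<and>
        (\<forall>h\<in>(\<Pi>\<^sub>E c\<in>Ch. Ch). (\<forall>x\<in>F. h x = g x) \<longrightarrow> h \<in> V)"
      using F(1,2)[of f] by (intro exI[of _ "F f"]) (auto simp: V_def intro!: bexI[of _ f])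
  qed (auto simp: V_def)
  moreover have "U = V \<inter> carrier A"
  proof
    show "U \<subseteq> V \<inter> carrier A" using R aut_subset_PiE by (auto simp: V_def)
    show "V \<inter> carrier A \<subseteq> U" using F(3) by (auto simp: V_def)
  qed
  ultimately show ?L
    unfolding building_aut_topology_def openin_subtopology by blast
qed

lemma openin_T_local:
  assumes "finite F" "F \<subseteq> Ch"
    and "\<And>f g. \<lbrakk>f \<in> carrier A; g \<in> carrier A; P f; \<forall>x\<in>F. g x = f x\<rbrakk> \<Longrightarrow> P g"
  shows "openin T {f \<in> carrier A. P f}"
  unfolding openin_T_iff using assms by (auto intro!: exI[of _ F])

definition gball :: "'c \<Rightarrow> nat \<Rightarrow> 'c set" where
  "gball c n = {x \<in> Ch. gdist c x \<le> n}"

lemma gball_subset: "gball c n \<subseteq> Ch"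
  by (auto simp: gball_def)

lemma finite_gball:
  assumes "locally_finite_building S Ch \<delta>" "c \<in> Ch"
  shows "finite (gball c n)"
proof -
  have "gball c n = {x \<in> Ch. gdist x c \<le> n}"
    using gdist_sym assms(2) by (auto simp: gball_def)
  then show ?thesis using finite_ball[OF assms] by simp
qed

lemma finite_subset_gball:
  assumes "c \<in> Ch" "finite F" "F \<subseteq> Ch"
  obtains n where "F \<subseteq> gball c n"
proof
  show "F \<subseteq> gball c (Max (gdist c ` F))"
    using assms by (auto simp: gball_def intro!: Max_ge)
qed

text \<open>Local finiteness puts the set inside a product of finite balls, compact by Tychonoff. It
  is closed even among all maps from \<open>Ch\<close> to \<open>Ch\<close>: a pointwise limit of
  isometries could lose surjectivity only if preimages escaped to infinity, which the displacement
  bound prevents.\<close>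

lemma compactin_T_bounded_displacement:
  assumes lf: "locally_finite_building S Ch \<delta>" and c: "c \<in> Ch"
  shows "compactin T {f \<in> carrier A. gdist c (f c) \<le> k}" (is "compactin T ?K")
proof -
  have bound: "f x \<in> gball c (k + gdist c x)" if f: "f \<in> ?K" and x: "x \<in> Ch" for f x
  proof -
    have "gdist c (f x) \<le> gdist c (f c) + gdist (f c) (f x)"
      by (rule gdist_triangle) (use f x c in simp_all)
    then show ?thesis using f x c by (simp add: gball_def)
  qed
  have inv: "\<exists>x\<in>gball c (k + gdist c y). f x = y" if f: "f \<in> ?K" and y: "y \<in> Ch" for f y
  proof -
    let ?x = "(inv\<^bsub>A\<^esub> f) y"
    have x: "?x \<in> Ch" "f ?x = y" using f y by simp_all
    have "gdist c ?x = gdist (f c) y"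
      using aut_delta[of f c ?x] f c x by simp
    also have "\<dots> \<le> gdist (f c) c + gdist c y" by (rule gdist_triangle) (use f y c in simp_all)
    also have "gdist (f c) c = gdist c (f c)" by (rule gdist_sym) (use f c in simp_all)
    finally show ?thesis using x f by (intro bexI[of _ ?x]) (auto simp: gball_def)
  qed
  have "closedin FT ?K"
    unfolding closedin_def openin_product_discrete
  proof (intro conjI ballI)
    show "?K \<subseteq> topspace FT" using aut_subset_PiE by auto
  next
    fix f assume f: "f \<in> topspace FT - ?K"
    then have fE: "f \<in> (\<Pi>\<^sub>E c\<in>Ch. Ch)" by simp
    show "\<exists>F. finite F \<and> F \<subseteq> Ch \<and>
        (\<forall>g\<in>(\<Pi>\<^sub>E c\<in>Ch. Ch). (\<forall>x\<in>F. g x = f x) \<longrightarrow> g \<in> topspace FT - ?K)"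
    proof (cases "gdist c (f c) \<le> k")
      case False
      then show ?thesis using c by (intro exI[of _ "{c}"]) auto
    next
      case le: True
      show ?thesis
      proof (cases "\<forall>x\<in>Ch. \<forall>y\<in>Ch. \<delta> (f x) (f y) = \<delta> x y")
        case False
        then obtain x y where "x \<in> Ch" "y \<in> Ch" "\<delta> (f x) (f y) \<noteq> \<delta> x y" by blast
        moreover from this have "g \<notin> carrier A" if "g x = f x" "g y = f y" for g
          using aut_delta[of g x y] that by auto
        ultimately show ?thesis by (intro exI[of _ "{x, y}"]) auto
      next
        case iso: True
        have "inj_on f Ch"
        proof (rule inj_onI)
          fix x y assume *: "x \<in> Ch" "y \<in> Ch" "f x = f y"
          have "f y \<in> Ch" using fE * by auto
          then have "\<delta> x y = \<one>" using iso * delta_refl by metis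
          then show "x = y" using WD1 * by blast
        qed
        moreover have "f \<in> extensional Ch" "f ` Ch \<subseteq> Ch" using fE by (auto simp: PiE_iff)
        ultimately have "f ` Ch \<noteq> Ch"
          using f le iso by (auto simp: aut_carrier Bij_def bij_betw_def)
        then obtain y where y: "y \<in> Ch" "y \<notin> f ` Ch" using \<open>f ` Ch \<subseteq> Ch\<close> by blast
        \<comment> \<open>A member of \<open>?K\<close> attains \<open>y\<close> on this ball, so it
          cannot agree there with \<open>f\<close>, which misses \<open>y\<close>.\<close>
        let ?F = "gball c (k + gdist c y)"
        have "g \<notin> ?K" if g: "\<forall>x\<in>?F. g x = f x" for g
        proof
          assume "g \<in> ?K"
          then obtain x where "x \<in> ?F" "g x = y" using inv[of g y] y(1) by blast
          then show False using g y(2) gball_subset by (metis image_eqI subsetD)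
        qed
        then show ?thesis using finite_gball[OF lf c] gball_subset
          by (intro exI[of _ ?F]) auto
      qed
    qed
  qed auto
  moreover have "compactin FT (\<Pi>\<^sub>E x\<in>Ch. gball c (k + gdist c x))"
    unfolding compactin_PiE
    by (intro disjI2 ballI finite_imp_compactin) (use finite_gball[OF lf c] gball_subset in auto)
  moreover have "?K \<subseteq> (\<Pi>\<^sub>E x\<in>Ch. gball c (k + gdist c x))"
    using bound aut_subset_PiE by (auto simp: PiE_iff)
  ultimately have "compactin FT ?K"
    using closed_compactin by blast
  then show ?thesis
    unfolding building_aut_topology_def compactin_subtopology by auto
qed

end

section \<open>Subgroups of finite index\<close>

lemma finite_image_factor:
  assumes "finite (g ` X)" "\<And>x y. \<lbrakk>x \<in> X; y \<in> X; g x = g y\<rbrakk> \<Longrightarrow> f x = f y"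
  shows "finite (f ` X)"
proof -
  have "f ` X \<subseteq> (\<lambda>z. f (SOME x. x \<in> X \<and> g x = z)) ` (g ` X)"
  proof
    fix y assume "y \<in> f ` X"
    then obtain x where x: "x \<in> X" "y = f x" by blast
    then have "(SOME x'. x' \<in> X \<and> g x' = g x) \<in> X \<and> g (SOME x'. x' \<in> X \<and> g x' = g x) = g x"
      by (intro someI[of "\<lambda>x'. x' \<in> X \<and> g x' = g x" x]) simp
    then have "f x = f (SOME x'. x' \<in> X \<and> g x' = g x)" using assms(2) x by metis
    then show "y \<in> (\<lambda>z. f (SOME x. x \<in> X \<and> g x = z)) ` (g ` X)" using x by blast
  qed
  then show ?thesis using assms(1) finite_subset by blast
qed

lemma (in group) rcos_eq_iff:
  assumes "subgroup U G" "x \<in> carrier G" "y \<in> carrier G"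
  shows "U #> x = U #> y \<longleftrightarrow> x \<otimes> inv y \<in> U"
proof
  assume "U #> x = U #> y"
  then have "x \<in> U #> y" using rcos_self[OF assms(2,1)] by simp
  then obtain u where u: "u \<in> U" "x = u \<otimes> y" by (auto simp: r_coset_def)
  then have "u \<in> carrier G" using subgroup.mem_carrier[OF assms(1)] by blast
  then have "x \<otimes> inv y = u" using u assms(3) by (simp add: m_assoc)
  then show "x \<otimes> inv y \<in> U" using u by simp
next
  assume "x \<otimes> inv y \<in> U"
  then have "U #> (x \<otimes> inv y) = U" using coset_join2 assms by simp
  then show "U #> x = U #> y"
    using coset_mult_inv1 assms subgroup.subset[OF assms(1)] by blast
qed

lemma (in group) finite_rcosets_Int:
  assumes "subgroup U G" "subgroup V G" "finite (rcosets U)" "finite (rcosets V)"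
  shows "finite (rcosets (U \<inter> V))"
proof -
  have r: "rcosets M = (\<lambda>x. M #> x) ` carrier G" for M by (auto simp: RCOSETS_def)
  let ?g = "\<lambda>x. (U #> x, V #> x)"
  have "?g ` carrier G \<subseteq> (rcosets U) \<times> (rcosets V)" by (auto simp: r)
  then have "finite (?g ` carrier G)" using assms finite_subset by blast
  then show ?thesis unfolding r
  proof (rule finite_image_factor)
    fix x y assume "x \<in> carrier G" "y \<in> carrier G" "?g x = ?g y"
    then show "(U \<inter> V) #> x = (U \<inter> V) #> y"
      using rcos_eq_iff[OF assms(1), of x y] rcos_eq_iff[OF assms(2), of x y]
        rcos_eq_iff[OF subgroups_Inter_pair[OF assms(1,2)], of x y] by simp
  qed
qed

context building
begin

lemma inv_subgroup_of [simp]: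
  assumes "subgroup H A" "h \<in> H"
  shows "inv\<^bsub>subgroup_of A H\<^esub> h = inv\<^bsub>A\<^esub> h"
  using A.m_inv_consistent[OF assms] by (simp add: subgroup_of_def)

lemma group_subgroup_of: "subgroup H A \<Longrightarrow> group (subgroup_of A H)"
  unfolding subgroup_of_def by (rule A.subgroup_imp_group)

lemma gball_center: "c \<in> Ch \<Longrightarrow> c \<in> gball c n"
  by (simp add: gball_def)

lemma aut_gball:
  assumes "f \<in> carrier A" "c \<in> Ch" "gdist c (f c) \<le> k" "x \<in> gball c n"
  shows "f x \<in> gball c (n + k)"
proof -
  have x: "x \<in> Ch" "gdist c x \<le> n" using assms(4) by (auto simp: gball_def)
  have "gdist c (f x) \<le> gdist c (f c) + gdist (f c) (f x)"
    by (rule gdist_triangle) (use assms x in simp_all)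
  then show ?thesis using assms x by (simp add: gball_def)
qed

lemma weyl_transitive_imp_chamber_transitive:
  assumes "weyl_transitive W Ch \<delta> H"
  shows "chamber_transitive H"
  unfolding chamber_transitive_def
proof (intro ballI)
  fix x y assume xy: "x \<in> Ch" "y \<in> Ch"
  have "\<exists>h\<in>H. h x = y \<and> h x = y"
    by (rule assms[unfolded weyl_transitive_def, rule_format, OF one_closed xy(1,1,2,2)])
      (use xy in simp)
  then show "\<exists>h\<in>H. h x = y" by (elim bexE conjE) (rule bexI)
qed

section \<open>Congruence subgroups\<close>

definition fixator :: "('c \<Rightarrow> 'c) set \<Rightarrow> 'c \<Rightarrow> nat \<Rightarrow> ('c \<Rightarrow> 'c) set" where
  "fixator H c n = {h \<in> H. \<forall>x\<in>gball c n. h x = x}"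

text \<open>Any open normal subgroup of finite index contains a fixator of a ball; it is the latter
  condition that survives passing to nearby subgroups.\<close>

definition congruence_subgroup :: "('c \<Rightarrow> 'c) set \<Rightarrow> 'c \<Rightarrow> ('c \<Rightarrow> 'c) set \<Rightarrow> bool" where
  "congruence_subgroup H c U \<longleftrightarrow> U \<lhd> subgroup_of A H \<and> finite (rcosets\<^bsub>subgroup_of A H\<^esub> U) \<and>
     (\<exists>n. fixator H c n \<subseteq> U)"

lemma congruence_subgroup_self:
  assumes "subgroup H A"
  shows "congruence_subgroup H c H"
proof -
  interpret K: group "subgroup_of A H" by (rule group_subgroup_of[OF assms])
  have sub: "subgroup H (subgroup_of A H)" using K.subgroup_self by simp
  then have "H \<lhd> subgroup_of A H"
    unfolding K.normal_inv_iff using K.m_closed K.inv_closed by simp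
  moreover have "rcosets\<^bsub>subgroup_of A H\<^esub> H \<subseteq> {H}"
    using K.coset_join2[OF _ sub] by (auto simp: RCOSETS_def)
  then have "finite (rcosets\<^bsub>subgroup_of A H\<^esub> H)" using finite_subset by blast
  ultimately show ?thesis by (auto simp: congruence_subgroup_def fixator_def)
qed

lemma congruence_subgroup_Int:
  assumes "subgroup H A" "congruence_subgroup H c U" "congruence_subgroup H c V"
  shows "congruence_subgroup H c (U \<inter> V)"
proof -
  interpret K: group "subgroup_of A H" by (rule group_subgroup_of[OF assms(1)])
  obtain m n where "fixator H c m \<subseteq> U" "fixator H c n \<subseteq> V"
    using assms by (auto simp: congruence_subgroup_def)
  moreover have "fixator H c (max m n) \<subseteq> fixator H c m \<inter> fixator H c n"
    by (auto simp: fixator_def gball_def)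
  ultimately have "fixator H c (max m n) \<subseteq> U \<inter> V" by blast
  then show ?thesis
    using assms K.normal_subgroup_intersect K.finite_rcosets_Int normal_imp_subgroup
    unfolding congruence_subgroup_def by blast
qed

text \<open>The element h'^-1 h fixes the ball, hence lies in \<open>U\<close>; conjugation by
  \<open>h'\<close> turns it into h h'^-1, as right cosets require.\<close>

lemma fixator_rcos_eq:
  assumes H: "subgroup H A" and U: "U \<lhd> subgroup_of A H" "fixator H c n \<subseteq> U"
    and h: "h \<in> H" "h' \<in> H" "\<And>x. x \<in> gball c n \<Longrightarrow> h x = h' x"
  shows "U #>\<^bsub>subgroup_of A H\<^esub> h = U #>\<^bsub>subgroup_of A H\<^esub> h'"
proof -
  interpret K: group "subgroup_of A H" by (rule group_subgroup_of[OF H])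
  interpret H: subgroup H A by (rule H)
  interpret U: normal U "subgroup_of A H" by (rule U(1))
  let ?v = "inv\<^bsub>A\<^esub> h' \<otimes>\<^bsub>A\<^esub> h"
  have hA: "h \<in> carrier A" "h' \<in> carrier A" using h by auto
  have "?v x = x" if "x \<in> gball c n" for x
  proof -
    have x: "x \<in> Ch" using that gball_subset by blast
    then have "?v x = (inv\<^bsub>A\<^esub> h') (h' x)" using hA h(3)[OF that] by simp
    then show ?thesis using aut_inv(1)[OF hA(2) x] by simp
  qed
  then have "?v \<in> U" using U(2) h by (auto simp: fixator_def)
  then have "h' \<otimes>\<^bsub>A\<^esub> ?v \<otimes>\<^bsub>A\<^esub> inv\<^bsub>A\<^esub> h' \<in> U" using U.inv_op_closed2[of h' ?v] H h by simp
  then have "h \<otimes>\<^bsub>A\<^esub> inv\<^bsub>A\<^esub> h' \<in> U" using aut_cancel[of h' h] hA by simp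
  then show ?thesis
    using K.rcos_eq_iff[OF normal_imp_subgroup[OF U(1)]] H h by simp
qed

text \<open>The fixator is visibly normalised by the stabiliser of \<open>c\<close>, and
  transitivity of \<open>N\<close> reduces conjugation by \<open>H\<close> to conjugation by
  \<open>N\<close> and this stabiliser. The stabiliser also represents all cosets, and the coset of
  an element depends only on its action on a finite ball.\<close>

lemma normal_mult_fixator_congruence:
  assumes lf: "locally_finite_building S Ch \<delta>" and c: "c \<in> Ch" and H: "subgroup H A"
    and N: "N \<lhd> subgroup_of A H" "chamber_transitive N"
  shows "congruence_subgroup H c {m \<otimes>\<^bsub>A\<^esub> v |m v. m \<in> N \<and> v \<in> fixator H c n}"
    (is "congruence_subgroup H c ?U")
proof -
  interpret K: group "subgroup_of A H" by (rule group_subgroup_of[OF H])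
  interpret H: subgroup H A by (rule H)
  interpret N: normal N "subgroup_of A H" by (rule N(1))
  note N_sub = normal_imp_subgroup[OF N(1)]
  let ?V = "fixator H c n"
  have HA: "h \<in> carrier A" if "h \<in> H" for h using that by simp
  have NH: "m \<in> H" if "m \<in> N" for m using N.subset that by auto
  have VH: "v \<in> H" if "v \<in> ?V" for v using that by (simp add: fixator_def)
  have Vfix: "v x = x" if "v \<in> ?V" "x \<in> gball c n" for v x using that by (simp add: fixator_def)
  have N_one: "\<one>\<^bsub>A\<^esub> \<in> N" using subgroup.one_closed[OF N_sub] by simp
  have N_mult: "m \<otimes>\<^bsub>A\<^esub> m' \<in> N" if "m \<in> N" "m' \<in> N" for m m'
    using subgroup.m_closed[OF N_sub that] by simp
  have N_inv: "inv\<^bsub>A\<^esub> m \<in> N" if "m \<in> N" for m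
    using subgroup.m_inv_closed[OF N_sub that] inv_subgroup_of[OF H NH[OF that]] by simp
  have N_conj: "h \<otimes>\<^bsub>A\<^esub> m \<otimes>\<^bsub>A\<^esub> inv\<^bsub>A\<^esub> h \<in> N" if "h \<in> H" "m \<in> N" for h m
    using N.inv_op_closed2[of h m] that H by simp
  have gx: "x \<in> Ch" if "x \<in> gball c n" for x using that gball_subset by blast
  have V_one: "\<one>\<^bsub>A\<^esub> \<in> ?V" using gx by (simp add: fixator_def)
  have V_mult: "v \<otimes>\<^bsub>A\<^esub> v' \<in> ?V" if "v \<in> ?V" "v' \<in> ?V" for v v'
    using that gx by (simp add: fixator_def)
  have V_inv: "inv\<^bsub>A\<^esub> v \<in> ?V" if v: "v \<in> ?V" for v
  proof -
    have "(inv\<^bsub>A\<^esub> v) x = x" if x: "x \<in> gball c n" for x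
      using aut_inv(1)[OF HA[OF VH[OF v]] gx[OF x]] Vfix[OF v x] by simp
    then show ?thesis using VH[OF v] by (simp add: fixator_def)
  qed
  have V_conj: "b \<otimes>\<^bsub>A\<^esub> v \<otimes>\<^bsub>A\<^esub> inv\<^bsub>A\<^esub> b \<in> ?V" if b: "b \<in> H" "b c = c" and v: "v \<in> ?V" for b v
  proof -
    have ib: "inv\<^bsub>A\<^esub> b \<in> H" "(inv\<^bsub>A\<^esub> b) c = c"
      using b aut_inv(1)[OF HA[OF b(1)] c] by simp_all
    have "(b \<otimes>\<^bsub>A\<^esub> v \<otimes>\<^bsub>A\<^esub> inv\<^bsub>A\<^esub> b) x = x" if x: "x \<in> gball c n" for x
    proof -
      have "(inv\<^bsub>A\<^esub> b) x \<in> gball c n" using aut_gball[OF HA[OF ib(1)] c _ x, of 0] ib(2) c by simp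
      then have "v ((inv\<^bsub>A\<^esub> b) x) = (inv\<^bsub>A\<^esub> b) x" by (rule Vfix[OF v])
      then show ?thesis
        using HA[OF b(1)] HA[OF VH[OF v]] gx[OF x] aut_inv(2)[OF HA[OF b(1)] gx[OF x]] by simp
    qed
    then show ?thesis using b(1) VH[OF v] by (simp add: fixator_def)
  qed
  have decomp: "\<exists>m\<in>N. \<exists>b\<in>H. b c = c \<and> h = m \<otimes>\<^bsub>A\<^esub> b" if h: "h \<in> H" for h
  proof -
    have "h c \<in> Ch" using HA[OF h] c by simp
    then obtain m where m: "m \<in> N" "m c = h c" using N(2) c by (auto simp: chamber_transitive_def)
    let ?b = "inv\<^bsub>A\<^esub> m \<otimes>\<^bsub>A\<^esub> h"
    have "?b \<in> H" using NH[OF m(1)] h by simp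
    moreover have "?b c = c"
      using HA[OF h] HA[OF NH[OF m(1)]] c m(2)[symmetric] aut_inv(1)[OF HA[OF NH[OF m(1)]] c] by simp
    moreover have "h = m \<otimes>\<^bsub>A\<^esub> ?b" using aut_cancel HA[OF h] HA[OF NH[OF m(1)]] by simp
    ultimately show ?thesis using m(1) by blast
  qed
  have U_I: "m \<otimes>\<^bsub>A\<^esub> v \<in> ?U" if "m \<in> N" "v \<in> ?V" for m v using that by blast
  have N_U: "m \<in> ?U" if "m \<in> N" for m using U_I[OF that V_one] HA[OF NH[OF that]] by simp
  have V_U: "v \<in> ?U" if "v \<in> ?V" for v using U_I[OF N_one that] HA[OF VH[OF that]] by simp
  have UH: "u \<in> H" if "u \<in> ?U" for u using that NH VH by auto
  have "subgroup ?V (subgroup_of A H)"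
  proof (rule K.subgroupI)
    show "?V \<noteq> {}" using V_one by blast
    show "inv\<^bsub>subgroup_of A H\<^esub> v \<in> ?V" if "v \<in> ?V" for v
      using V_inv[OF that] inv_subgroup_of[OF H VH[OF that]] by simp
    show "v \<otimes>\<^bsub>subgroup_of A H\<^esub> v' \<in> ?V" if "v \<in> ?V" "v' \<in> ?V" for v v'
      using V_mult[OF that] by simp
  qed (use VH in auto)
  moreover have "?U = N <#>\<^bsub>subgroup_of A H\<^esub> ?V" by (auto simp: set_mult_def)
  ultimately have U_sub: "subgroup ?U (subgroup_of A H)"
    using K.mult_norm_subgroup[OF N(1)] by simp
  have U_mult: "u \<otimes>\<^bsub>A\<^esub> u' \<in> ?U" if "u \<in> ?U" "u' \<in> ?U" for u u'
    using subgroup.m_closed[OF U_sub that] by simp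
  have U_conj: "h \<otimes>\<^bsub>A\<^esub> u \<otimes>\<^bsub>A\<^esub> inv\<^bsub>A\<^esub> h \<in> ?U" if h: "h \<in> H" and u: "u \<in> ?U" for h u
  proof -
    obtain m v where mv: "u = m \<otimes>\<^bsub>A\<^esub> v" "m \<in> N" "v \<in> ?V" using u by blast
    obtain l b where lb: "l \<in> N" "b \<in> H" "b c = c" "h = l \<otimes>\<^bsub>A\<^esub> b" using decomp[OF h] by blast
    note cl = HA[OF h] HA[OF NH[OF mv(2)]] HA[OF VH[OF mv(3)]] HA[OF NH[OF lb(1)]] HA[OF lb(2)]
    \<comment> \<open>With h = lb, the element \<open>b\<close> preserves the fixator, and
      conjugation by \<open>l\<close> in \<open>N\<close> stays inside the product.\<close>
    have "h \<otimes>\<^bsub>A\<^esub> v \<otimes>\<^bsub>A\<^esub> inv\<^bsub>A\<^esub> h = l \<otimes>\<^bsub>A\<^esub> (b \<otimes>\<^bsub>A\<^esub> v \<otimes>\<^bsub>A\<^esub> inv\<^bsub>A\<^esub> b) \<otimes>\<^bsub>A\<^esub> inv\<^bsub>A\<^esub> l"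
      using cl lb(4) by (simp add: A.inv_mult_group A.m_assoc)
    then have "h \<otimes>\<^bsub>A\<^esub> v \<otimes>\<^bsub>A\<^esub> inv\<^bsub>A\<^esub> h \<in> ?U"
      using U_mult[OF U_mult[OF N_U[OF lb(1)] V_U[OF V_conj[OF lb(2,3) mv(3)]]] N_U[OF N_inv[OF lb(1)]]]
      by simp
    moreover have "h \<otimes>\<^bsub>A\<^esub> u \<otimes>\<^bsub>A\<^esub> inv\<^bsub>A\<^esub> h =
        (h \<otimes>\<^bsub>A\<^esub> m \<otimes>\<^bsub>A\<^esub> inv\<^bsub>A\<^esub> h) \<otimes>\<^bsub>A\<^esub> (h \<otimes>\<^bsub>A\<^esub> v \<otimes>\<^bsub>A\<^esub> inv\<^bsub>A\<^esub> h)"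
      using cl mv(1) by (simp add: A.m_assoc A.m_assoc[symmetric, of "inv\<^bsub>A\<^esub> h" h])
    ultimately show ?thesis using U_mult[OF N_U[OF N_conj[OF h mv(2)]]] by simp
  qed
  have U_normal: "?U \<lhd> subgroup_of A H"
    unfolding K.normal_inv_iff using U_sub U_conj inv_subgroup_of[OF H] by simp
  have V_sub: "?V \<subseteq> ?U" using V_U by (rule subsetI)
  let ?B = "{b \<in> H. b c = c}"
  let ?r = "\<lambda>b. restrict b (gball c n)"
  have "?r ` ?B \<subseteq> (\<Pi>\<^sub>E x\<in>gball c n. gball c n)"
  proof -
    have "b x \<in> gball c n" if "b \<in> H" "b c = c" "x \<in> gball c n" for b x
      using aut_gball[OF HA[OF that(1)] c _ that(3), of 0] that(2) c by simp
    then show ?thesis by auto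
  qed
  then have "finite (?r ` ?B)"
    by (rule finite_subset) (rule finite_PiE[OF finite_gball[OF lf c] finite_gball[OF lf c]])
  then have "finite ((\<lambda>b. ?U #>\<^bsub>subgroup_of A H\<^esub> b) ` ?B)"
  proof (rule finite_image_factor)
    fix b b' assume b: "b \<in> ?B" "b' \<in> ?B" "?r b = ?r b'"
    have bH: "b \<in> H" "b' \<in> H" using b(1,2) by simp_all
    have "b x = b' x" if "x \<in> gball c n" for x
      using fun_cong[OF b(3), of x] that by (simp only: restrict_apply if_True)
    then show "?U #>\<^bsub>subgroup_of A H\<^esub> b = ?U #>\<^bsub>subgroup_of A H\<^esub> b'"
      by (rule fixator_rcos_eq[OF H U_normal V_sub bH])
  qed
  moreover have "rcosets\<^bsub>subgroup_of A H\<^esub> ?U \<subseteq> (\<lambda>b. ?U #>\<^bsub>subgroup_of A H\<^esub> b) ` ?B"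
  proof
    fix C assume "C \<in> rcosets\<^bsub>subgroup_of A H\<^esub> ?U"
    then obtain h where h: "h \<in> H" "C = ?U #>\<^bsub>subgroup_of A H\<^esub> h" by (auto simp: RCOSETS_def)
    obtain m b where mb: "m \<in> N" "b \<in> H" "b c = c" "h = m \<otimes>\<^bsub>A\<^esub> b" using decomp[OF h(1)] by blast
    have "h \<otimes>\<^bsub>A\<^esub> inv\<^bsub>A\<^esub> b = m" using mb HA[OF mb(2)] HA[OF NH[OF mb(1)]] by (simp add: A.m_assoc)
    then have "C = ?U #>\<^bsub>subgroup_of A H\<^esub> b"
      using K.rcos_eq_iff[OF U_sub, of h b] h mb(2) N_U[OF mb(1)] inv_subgroup_of[OF H mb(2)] by simp
    then show "C \<in> (\<lambda>b. ?U #>\<^bsub>subgroup_of A H\<^esub> b) ` ?B" using mb by blast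
  qed
  ultimately have "finite (rcosets\<^bsub>subgroup_of A H\<^esub> ?U)" by (rule rev_finite_subset)
  then show ?thesis
    unfolding congruence_subgroup_def using U_normal V_sub by (intro conjI exI)
qed

end

section \<open>Chabauty limits\<close>

lemma ecard_le_inj:
  assumes "inj_on f X" "f ` X \<subseteq> Y"
  shows "ecard X \<le> ecard Y"
proof (cases "finite Y")
  case True
  then have "finite X" using assms inj_on_finite by blast
  then show ?thesis using card_inj_on_le[OF assms True] True by (simp add: ecard_def)
qed (simp add: ecard_def)

context building
begin

text \<open>Some non-trivial closed normal \<open>N\<close> misses \<open>h\<close>, and then so
  does every element of \<open>N\<close> miss a basic neighbourhood of \<open>h\<close>. If h = mv
  with \<open>v\<close> fixing a large ball, then \<open>m\<close> agrees with \<open>h\<close>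
  there and would lie in that neighbourhood.\<close>

lemma not_Mon_imp_congruence_subgroup:
  assumes lf: "locally_finite_building S Ch \<delta>" and thick: "thick_building W S Ch \<delta>"
    and irr: "coxeter_irreducible W S" and c: "c \<in> Ch"
    and H: "subgroup H A" "weyl_transitive W Ch \<delta> H"
    and h: "h \<in> H" "h \<notin> Mon (subgroup_of A H) (subtopology T H)"
  obtains U where "congruence_subgroup H c U" "h \<notin> U"
proof -
  have HA: "H \<subseteq> carrier A" using subgroup.subset[OF H(1)] .
  obtain N where N: "N \<lhd> subgroup_of A H" "closedin (subtopology T H) N" "N \<noteq> {\<one>\<^bsub>A\<^esub>}" "h \<notin> N"
    using h by (auto simp: Mon_def closed_normal_subgroups_def)
  have NH: "N \<subseteq> H" using subgroup.subset[OF normal_imp_subgroup[OF N(1)]] by simp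
  have "openin (subtopology T H) (H - N)"
    using openin_diff[OF openin_topspace N(2)] HA by (simp add: Int_absorb1)
  then obtain V where V: "openin T V" "H - N = V \<inter> H" unfolding openin_subtopology by blast
  have "h \<in> V" using V(2) h(1) N(4) by blast
  from V(1)[unfolded openin_T_iff, THEN conjunct2, THEN bspec, OF this]
  obtain F where F: "finite F" "F \<subseteq> Ch" "\<forall>g\<in>carrier A. (\<forall>x\<in>F. g x = h x) \<longrightarrow> g \<in> V"
    by (elim exE conjE)
  obtain n where n: "F \<subseteq> gball c n" by (rule finite_subset_gball[OF c F(1,2)])
  let ?U = "{m \<otimes>\<^bsub>A\<^esub> v |m v. m \<in> N \<and> v \<in> fixator H c n}"
  have "h \<notin> ?U"
  proof
    assume "h \<in> ?U"
    then obtain m v where mv: "h = m \<otimes>\<^bsub>A\<^esub> v" "m \<in> N" "v \<in> fixator H c n" by blast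
    have cl: "m \<in> carrier A" "v \<in> carrier A" using mv(2,3) NH HA by (auto simp: fixator_def)
    have "m x = h x" if "x \<in> F" for x
    proof -
      have "x \<in> gball c n" "x \<in> Ch" using that n F(2) by auto
      moreover from this have "v x = x" using mv(3) by (simp add: fixator_def)
      ultimately show ?thesis using aut_mult[OF cl, of x] mv(1) by simp
    qed
    then have "m \<in> V" using F(3) cl(1) by simp
    then show False using V(2) mv(2) NH by blast
  qed
  moreover have "congruence_subgroup H c ?U"
    by (rule normal_mult_fixator_congruence[OF lf c H(1) N(1)
          normal_subgroup_transitive[OF thick irr H N(1,3)]])
  ultimately show ?thesis using that by simp
qed

text \<open>The asymmetry is deliberate: from \<open>G\<close> to \<open>H\<close> displacement
  \<open>k\<close> is needed for the cocycle identity on residues, while from \<open>H\<close> to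
  \<open>G\<close> the elements of displacement at most 1 suffice, since they generate a
  chamber-transitive \<open>H\<close>.\<close>

definition approximates :: "('c \<Rightarrow> 'c) set \<Rightarrow> ('c \<Rightarrow> 'c) set \<Rightarrow> 'c \<Rightarrow> nat \<Rightarrow> nat \<Rightarrow> bool" where
  "approximates G H c k M \<longleftrightarrow>
     (\<forall>g\<in>G. gdist c (g c) \<le> k \<longrightarrow> (\<exists>h\<in>H. \<forall>x\<in>gball c M. g x = h x)) \<and>
     (\<forall>h\<in>H. gdist c (h c) \<le> 1 \<longrightarrow> (\<exists>g\<in>G. \<forall>x\<in>gball c M. g x = h x))"

lemma eventually_approximates:
  assumes lf: "locally_finite_building S Ch \<delta>" and c: "c \<in> Ch"
    and lim: "limitin (chabauty A T) Hseq H sequentially"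
  shows "\<forall>\<^sub>F n in sequentially. approximates (Hseq n) H c k M"
proof -
  let ?B = "gball c M"
  note fin = finite_gball[OF lf c]
  have Hcl: "H \<in> closed_subgroups A T" using limitin_topspace[OF lim] by simp
  then have H: "subgroup H A" by (simp add: closed_subgroups_def)
  have HA: "H \<subseteq> carrier A" using subgroup.subset[OF H] .
  have ev: "\<forall>\<^sub>F n in sequentially. Hseq n \<in> \<U>" if "openin (chabauty A T) \<U>" "H \<in> \<U>" for \<U>
    using lim that by (simp add: limitin_def)

  \<comment> \<open>The bad elements form a compact set missing \<open>H\<close>: badness depends on
    values on the ball only, which gives closedness, and the displacement is bounded.\<close>
  let ?P = "\<lambda>f. gdist c (f c) \<le> k \<and> \<not> (\<exists>h\<in>H. \<forall>x\<in>?B. f x = h x)"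
  let ?K = "{f \<in> carrier A. ?P f}"
  have "openin T {f \<in> carrier A. \<not> ?P f}"
  proof (rule openin_T_local[OF fin gball_subset])
    fix f g assume "\<forall>x\<in>?B. g x = f x" "\<not> ?P f"
    moreover from this(1) have "g c = f c" using gball_center[OF c] by simp
    ultimately show "\<not> ?P g" by simp
  qed
  moreover have "{f \<in> carrier A. \<not> ?P f} = topspace T - ?K" by auto
  ultimately have "closedin T ?K" by (simp add: closedin_def)
  then have "compactin T ?K"
    by (rule closed_compactin[OF compactin_T_bounded_displacement[OF lf c, of k], rotated]) auto
  then have "openin (chabauty A T) {L \<in> closed_subgroups A T. L \<inter> ?K = {}}"
    unfolding chabauty_def by (intro topology_generated_by_Basis) blast
  moreover have "H \<inter> ?K = {}" by auto
  ultimately have "\<forall>\<^sub>F n in sequentially. Hseq n \<in> {L \<in> closed_subgroups A T. L \<inter> ?K = {}}"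
    using Hcl by (intro ev) auto
  then have 1: "\<forall>\<^sub>F n in sequentially.
      \<forall>g\<in>Hseq n. gdist c (g c) \<le> k \<longrightarrow> (\<exists>h\<in>H. \<forall>x\<in>?B. g x = h x)"
  proof (rule eventually_mono, intro ballI impI)
    fix n g assume *: "Hseq n \<in> {L \<in> closed_subgroups A T. L \<inter> ?K = {}}"
      and g: "g \<in> Hseq n" "gdist c (g c) \<le> k"
    have "g \<in> carrier A"
      using * g(1) subgroup.mem_carrier by (auto simp: closed_subgroups_def)
    moreover have "g \<notin> ?K" using * g(1) by blast
    ultimately show "\<exists>h\<in>H. \<forall>x\<in>?B. g x = h x" using g(2) by simp
  qed

  \<comment> \<open>Only finitely many restrictions to the ball occur, so finitely many
    Chabauty-open conditions treat all of \<open>?E\<close> at once.\<close>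
  let ?E = "{h \<in> H. gdist c (h c) \<le> 1}"
  let ?R = "(\<lambda>h. restrict h ?B) ` ?E"
  have "?R \<subseteq> (\<Pi>\<^sub>E x\<in>?B. gball c (M + 1))"
  proof -
    have "h x \<in> gball c (M + 1)" if "h \<in> ?E" "x \<in> ?B" for h x
      using aut_gball[OF _ c _ that(2), of h 1] that(1) HA by auto
    then show ?thesis by auto
  qed
  then have finR: "finite ?R" by (rule finite_subset) (rule finite_PiE[OF fin fin])
  have ev_r: "\<forall>\<^sub>F n in sequentially. \<exists>g\<in>Hseq n. \<forall>x\<in>?B. g x = r x" if r: "r \<in> ?R" for r
  proof -
    obtain h where h: "h \<in> H" "r = restrict h ?B" using r by auto
    let ?U = "{f \<in> carrier A. \<forall>x\<in>?B. f x = r x}"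
    have "openin T ?U" by (rule openin_T_local[OF fin[of M] gball_subset]) simp
    then have "openin (chabauty A T) {L \<in> closed_subgroups A T. L \<inter> ?U \<noteq> {}}"
      unfolding chabauty_def by (intro topology_generated_by_Basis) blast
    moreover have "h \<in> H \<inter> ?U" using h HA by auto
    ultimately have "\<forall>\<^sub>F n in sequentially. Hseq n \<in> {L \<in> closed_subgroups A T. L \<inter> ?U \<noteq> {}}"
      using Hcl by (intro ev) auto
    then show ?thesis by (rule eventually_mono) auto
  qed
  have "\<forall>\<^sub>F n in sequentially. \<forall>r\<in>?R. \<exists>g\<in>Hseq n. \<forall>x\<in>?B. g x = r x"
    by (rule eventually_ball_finite[OF finR]) (rule ballI, rule ev_r)
  then have 2: "\<forall>\<^sub>F n in sequentially.
      \<forall>h\<in>H. gdist c (h c) \<le> 1 \<longrightarrow> (\<exists>g\<in>Hseq n. \<forall>x\<in>?B. g x = h x)"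
    by (rule eventually_mono) simp
  from eventually_conj[OF 1 2] show ?thesis unfolding approximates_def .
qed

text \<open>Chambers adjacent to \<open>c\<close> are images of \<open>c\<close> under elements of
  \<open>H\<close> of displacement 1, hence also under elements of \<open>G\<close>; translation by
  \<open>G\<close> propagates this along galleries.\<close>

lemma approximates_chamber_transitive:
  assumes G: "subgroup G A" and H: "subgroup H A" "chamber_transitive H" and c: "c \<in> Ch"
    and approx: "approximates G H c k M"
  shows "chamber_transitive G"
proof -
  have GA: "g \<in> carrier A" if "g \<in> G" for g using subgroup.mem_carrier[OF G that] .
  have G_mult: "g \<otimes>\<^bsub>A\<^esub> g' \<in> G" if "g \<in> G" "g' \<in> G" for g g' using subgroup.m_closed[OF G that] .
  have G_inv: "inv\<^bsub>A\<^esub> g \<in> G" if "g \<in> G" for g using subgroup.m_inv_closed[OF G that] .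
  have orbit: "\<exists>g\<in>G. g c = y" if "y \<in> Ch" for y
    using that
  proof (induction "gdist y c" arbitrary: y)
    case 0
    then have "y = c" using gdist_eq_0_iff c by metis
    then show ?case using subgroup.one_closed[OF G] c by (intro bexI[of _ "\<one>\<^bsub>A\<^esub>"]) simp_all
  next
    case (Suc n)
    then have "y \<noteq> c" using c by auto
    then obtain z where z: "z \<in> Ch" "\<delta> y z \<in> S" "gdist y c = gdist z c + 1"
      by (rule delta_first_step[OF Suc.prems c]) 
    then obtain g where g: "g \<in> G" "g c = z" using Suc.hyps(1)[of z] Suc.hyps(2) by auto
    let ?y = "(inv\<^bsub>A\<^esub> g) y"
    have y: "?y \<in> Ch" "g ?y = y" using GA[OF g(1)] Suc.prems by simp_all
    obtain h where h: "h \<in> H" "h c = ?y" using H(2) c y(1) unfolding chamber_transitive_def by blast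
    have "\<delta> z y \<in> S" using adj_sym[OF Suc.prems z(1,2)] z(2) by simp
    moreover have "\<delta> c ?y = \<delta> z y" using aut_delta[OF GA[OF g(1)] c y(1)] g(2) y(2) by simp
    ultimately have "gdist c (h c) \<le> 1" using h(2) by simp
    then obtain e where e: "e \<in> G" "\<forall>x\<in>gball c M. e x = h x"
      using approx h(1) unfolding approximates_def by blast
    then have "e c = ?y" using gball_center[OF c] h(2) by simp
    then have "(g \<otimes>\<^bsub>A\<^esub> e) c = y" using aut_mult[OF GA[OF g(1)] GA[OF e(1)] c] y(2) by simp
    then show ?case using G_mult[OF g(1) e(1)] by (rule bexI)
  qed
  show ?thesis unfolding chamber_transitive_def
  proof (intro ballI)
    fix x y assume xy: "x \<in> Ch" "y \<in> Ch"
    obtain g where g: "g \<in> G" "g c = x" using orbit[OF xy(1)] by (elim bexE)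
    obtain g' where g': "g' \<in> G" "g' c = y" using orbit[OF xy(2)] by (elim bexE)
    have "(g' \<otimes>\<^bsub>A\<^esub> inv\<^bsub>A\<^esub> g) x = y"
      using aut_mult[OF GA[OF g'(1)] GA[OF G_inv[OF g(1)]] xy(1)] aut_inv(1)[OF GA[OF g(1)] c] g(2) g'(2)
      by simp
    then show "\<exists>g\<in>G. g x = y" using G_mult[OF g'(1) G_inv[OF g(1)]] by (rule bexI)
  qed
qed

text \<open>An element of \<open>G\<close> with small displacement is sent to the \<open>U\<close>-coset of any element of \<open>H\<close>
  agreeing with it on a ball. This is a local homomorphism, hence extends to \<open>G\<close>.\<close>

lemma approximates_imp_hom:
  assumes c: "c \<in> Ch" and k: "dihedral_bound k"
    and H: "subgroup H A" "chamber_transitive H"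
    and U: "U \<lhd> subgroup_of A H" "fixator H c R \<subseteq> U"
    and G: "subgroup G A" and approx: "approximates G H c k (R + k)"
  obtains \<theta> where "\<theta> \<in> hom (subgroup_of A G) (subgroup_of A H Mod U)"
    and "\<theta> ` G = rcosets\<^bsub>subgroup_of A H\<^esub> U"
    and "\<forall>g\<in>G. (\<forall>x\<in>gball c (R + k). g x = x) \<longrightarrow> \<theta> g = U"
proof -
  let ?K = "subgroup_of A H" and ?B = "gball c (R + k)"
  interpret K: group ?K by (rule group_subgroup_of[OF H(1)])
  interpret U: normal U ?K by (rule U(1))
  have GA: "g \<in> carrier A" if "g \<in> G" for g using subgroup.mem_carrier[OF G that] .
  have HA: "h \<in> carrier A" if "h \<in> H" for h using subgroup.mem_carrier[OF H(1) that] .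
  have H_mult: "h \<otimes>\<^bsub>A\<^esub> h' \<in> H" if "h \<in> H" "h' \<in> H" for h h' using subgroup.m_closed[OF H(1) that] .
  have U_sub: "U \<subseteq> carrier ?K" using subgroup.subset[OF normal_imp_subgroup[OF U(1)]] .
  have k1: "1 \<le> k" using k by (simp add: dihedral_bound_def)
  have RB: "gball c R \<subseteq> ?B" by (auto simp: gball_def)
  define lift where "lift g = (SOME h. h \<in> H \<and> (\<forall>x\<in>?B. g x = h x))" for g :: "'c \<Rightarrow> 'c"
  define \<phi> where "\<phi> g = U #>\<^bsub>?K\<^esub> lift g" for g
  have lift: "lift g \<in> H" "\<And>x. x \<in> ?B \<Longrightarrow> g x = lift g x" if "g \<in> G" "gdist c (g c) \<le> k" for g
  proof -
    have "\<exists>h. h \<in> H \<and> (\<forall>x\<in>?B. g x = h x)"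
      using approx[unfolded approximates_def, THEN conjunct1, THEN bspec, OF that(1)] that(2)
      unfolding Bex_def by (rule mp)
    then have L: "lift g \<in> H \<and> (\<forall>x\<in>?B. g x = lift g x)"
      unfolding lift_def by (rule someI_ex)
    show "lift g \<in> H" by (rule conjunct1[OF L])
    show "g x = lift g x" if "x \<in> ?B" for x by (rule bspec[OF conjunct2[OF L] that])
  qed
  \<comment> \<open>Agreement on the smaller ball already determines the coset; for a product of
    lifts nothing more is available.\<close>
  have \<phi>_eq: "\<phi> g = U #>\<^bsub>?K\<^esub> h"
    if g: "g \<in> G" "gdist c (g c) \<le> k" and h: "h \<in> H" "\<And>x. x \<in> gball c R \<Longrightarrow> g x = h x" for g h
    unfolding \<phi>_def
  proof (rule fixator_rcos_eq[OF H(1) U lift(1)[OF g] h(1)])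
    fix x assume x: "x \<in> gball c R"
    then show "lift g x = h x" using lift(2)[OF g, of x] h(2)[OF x] RB by auto
  qed
  have gr: "group (?K Mod U)" by (rule U.factorgroup_is_group)
  obtain \<theta> where \<theta>: "\<theta> \<in> hom (subgroup_of A G) (?K Mod U)"
    "\<And>g. \<lbrakk>g \<in> G; gdist c (g c) \<le> 1\<rbrakk> \<Longrightarrow> \<theta> g = \<phi> g"
  proof (rule extend_local_hom[OF G _ c k gr, of \<phi>])
    show "chamber_transitive G" by (rule approximates_chamber_transitive[OF G H c approx])
    show "\<phi> g \<in> carrier (?K Mod U)" if "g \<in> G" "gdist c (g c) \<le> k" for g
      using lift(1)[OF that] U_sub by (auto simp: \<phi>_def FactGroup_def RCOSETS_def)
    show "\<phi> (g \<otimes>\<^bsub>A\<^esub> h) = \<phi> g \<otimes>\<^bsub>?K Mod U\<^esub> \<phi> h"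
      if *: "g \<in> G" "h \<in> G" "gdist c (g c) \<le> k" "gdist c (h c) \<le> k" "gdist c (g (h c)) \<le> k" for g h
    proof -
      note lg = lift[OF *(1,3)] and lh = lift[OF *(2,4)]
      have gh: "(g \<otimes>\<^bsub>A\<^esub> h) x = g (h x)" if "x \<in> Ch" for x
        by (rule aut_mult[OF GA[OF *(1)] GA[OF *(2)] that])
      have "\<phi> (g \<otimes>\<^bsub>A\<^esub> h) = U #>\<^bsub>?K\<^esub> (lift g \<otimes>\<^bsub>A\<^esub> lift h)"
      proof (rule \<phi>_eq)
        show "g \<otimes>\<^bsub>A\<^esub> h \<in> G" by (rule subgroup.m_closed[OF G *(1,2)])
        show "gdist c ((g \<otimes>\<^bsub>A\<^esub> h) c) \<le> k" using *(5) gh[OF c] by simp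
        show "lift g \<otimes>\<^bsub>A\<^esub> lift h \<in> H" by (rule H_mult[OF lg(1) lh(1)])
        fix x assume x: "x \<in> gball c R"
        then have xC: "x \<in> Ch" "x \<in> ?B" using gball_subset RB by auto
        \<comment> \<open>The margin \<open>k\<close> in \<open>R + k\<close> is spent here:
          \<open>h\<close> may move \<open>x\<close> outwards by \<open>k\<close>, and
          \<open>lift g\<close> must still agree with \<open>g\<close> at the new place.\<close>
        have "h x \<in> ?B" by (rule aut_gball[OF GA[OF *(2)] c *(4) x])
        then have "g (h x) = lift g (lift h x)" using lg(2) lh(2)[OF xC(2)] by simp
        then show "(g \<otimes>\<^bsub>A\<^esub> h) x = (lift g \<otimes>\<^bsub>A\<^esub> lift h) x"
          using gh[OF xC(1)] aut_mult[OF HA[OF lg(1)] HA[OF lh(1)] xC(1)] by simp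
      qed
      then show ?thesis
        using U.rcos_sum[of "lift g" "lift h"] lg(1) lh(1) by (simp add: \<phi>_def FactGroup_def)
    qed
  next
    fix \<theta> assume "\<theta> \<in> hom (subgroup_of A G) (?K Mod U)"
      "\<And>g. \<lbrakk>g \<in> G; gdist c (g c) \<le> 1\<rbrakk> \<Longrightarrow> \<theta> g = \<phi> g"
    then show thesis by (rule that)
  qed
  have \<theta>_mult: "\<theta> (g \<otimes>\<^bsub>A\<^esub> h) = \<theta> g <#>\<^bsub>?K\<^esub> \<theta> h" if "g \<in> G" "h \<in> G" for g h
    using hom_mult[OF \<theta>(1), of g h] that by (simp add: FactGroup_def)
  have \<theta>_triv: "\<theta> g = U" if g: "g \<in> G" "\<And>x. x \<in> ?B \<Longrightarrow> g x = x" for g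
  proof -
    have "g c = c" using g(2) gball_center[OF c] by simp
    then have gc: "gdist c (g c) \<le> 1" using c by simp
    have "\<phi> g = U #>\<^bsub>?K\<^esub> \<one>\<^bsub>A\<^esub>"
    proof (rule \<phi>_eq[OF g(1)])
      show "\<one>\<^bsub>A\<^esub> \<in> H" by (rule subgroup.one_closed[OF H(1)])
      show "g x = \<one>\<^bsub>A\<^esub> x" if x: "x \<in> gball c R" for x
      proof -
        have "x \<in> ?B" "x \<in> Ch" using x RB gball_subset by blast+
        then show ?thesis using g(2)[of x] aut_one[of x] by (simp only:)
      qed
    qed (use gc k1 in simp)
    also have "\<dots> = U" using K.coset_mult_one[OF U_sub] by simp
    finally show ?thesis using \<theta>(2)[OF g(1) gc] by simp
  qed
  \<comment> \<open>Generators of \<open>H\<close> of displacement at most 1 are matched on the ball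
    by elements of \<open>G\<close>, and the image of \<open>\<theta>\<close> is closed under
    products.\<close>
  have onto: "\<exists>g\<in>G. \<theta> g = U #>\<^bsub>?K\<^esub> h" if "h \<in> H" for h
  proof (rule chamber_transitive_induct[OF H c _ _ that])
    have "\<theta> \<one>\<^bsub>A\<^esub> = U" by (rule \<theta>_triv[OF subgroup.one_closed[OF G]], rule aut_one) (erule subsetD[OF gball_subset])
    then have "\<theta> \<one>\<^bsub>A\<^esub> = U #>\<^bsub>?K\<^esub> \<one>\<^bsub>A\<^esub>" using K.coset_mult_one[OF U_sub] by simp
    then show "\<exists>g\<in>G. \<theta> g = U #>\<^bsub>?K\<^esub> \<one>\<^bsub>A\<^esub>" using subgroup.one_closed[OF G] by (rule bexI)
  next
    fix h e assume h: "h \<in> H" "\<exists>g\<in>G. \<theta> g = U #>\<^bsub>?K\<^esub> h" and e: "e \<in> H" "gdist c (e c) \<le> 1"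
    obtain g where g: "g \<in> G" "\<theta> g = U #>\<^bsub>?K\<^esub> h" using h(2) by (elim bexE)
    have "\<exists>g\<in>G. \<forall>x\<in>?B. g x = e x"
      by (rule approx[unfolded approximates_def, THEN conjunct2, THEN bspec, OF e(1), THEN mp, OF e(2)])
    then obtain g' where g': "g' \<in> G" "\<forall>x\<in>?B. g' x = e x" by (elim bexE)
    have "gdist c (g' c) \<le> 1" using g'(2) gball_center[OF c] e(2) by simp
    moreover from this have "\<phi> g' = U #>\<^bsub>?K\<^esub> e"
      using g'(2) RB k1 by (intro \<phi>_eq[OF g'(1) _ e(1)]) auto
    ultimately have "\<theta> g' = U #>\<^bsub>?K\<^esub> e" using \<theta>(2)[OF g'(1)] by simp
    then have "\<theta> (g \<otimes>\<^bsub>A\<^esub> g') = U #>\<^bsub>?K\<^esub> (h \<otimes>\<^bsub>A\<^esub> e)"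
      using \<theta>_mult[OF g(1) g'(1)] g(2) U.rcos_sum[of h e] h(1) e(1) by simp
    then show "\<exists>g\<in>G. \<theta> g = U #>\<^bsub>?K\<^esub> (h \<otimes>\<^bsub>A\<^esub> e)"
      using subgroup.m_closed[OF G g(1) g'(1)] by (rule bexI)
  qed
  have "\<theta> ` G = rcosets\<^bsub>?K\<^esub> U"
  proof
    show "\<theta> ` G \<subseteq> rcosets\<^bsub>?K\<^esub> U" using hom_carrier[OF \<theta>(1)] by (simp add: FactGroup_def)
    show "rcosets\<^bsub>?K\<^esub> U \<subseteq> \<theta> ` G"
    proof
      fix C assume "C \<in> rcosets\<^bsub>?K\<^esub> U"
      then obtain h where "h \<in> H" "C = U #>\<^bsub>?K\<^esub> h" by (auto simp: RCOSETS_def)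
      then show "C \<in> \<theta> ` G" using onto[of h] by (metis imageI)
    qed
  qed
  with \<theta>(1) \<theta>_triv show ?thesis using that by simp
qed

text \<open>The kernel of the homomorphism onto the quotient by \<open>U\<close> is open of finite
  index in \<open>G\<close>, so it contains the finite residual. Lifts to \<open>G\<close> of
  distinct elements of the quotient thus lie in distinct cosets of the residual.\<close>

lemma index_le_fin_residual_index:
  assumes c: "c \<in> Ch" and k: "dihedral_bound k" and lf: "locally_finite_building S Ch \<delta>"
    and H: "subgroup H A" "chamber_transitive H"
    and U: "U \<lhd> subgroup_of A H" "fixator H c R \<subseteq> U" "finite (rcosets\<^bsub>subgroup_of A H\<^esub> U)"
    and G: "subgroup G A" and approx: "approximates G H c k (R + k)"
  shows "ecard (rcosets\<^bsub>subgroup_of A H\<^esub> U)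
    \<le> group_index (subgroup_of A G) (fin_residual (subgroup_of A G) (subtopology T G))"
proof -
  let ?K = "subgroup_of A H" and ?L = "subgroup_of A G" and ?B = "gball c (R + k)"
  let ?Q = "rcosets\<^bsub>?K\<^esub> U" and ?F = "fin_residual ?L (subtopology T G)"
  interpret K: group ?K by (rule group_subgroup_of[OF H(1)])
  interpret L: group ?L by (rule group_subgroup_of[OF G])
  interpret U: normal U ?K by (rule U(1))
  have GA: "g \<in> carrier A" if "g \<in> G" for g using subgroup.mem_carrier[OF G that] .
  obtain \<theta> where \<theta>: "\<theta> \<in> hom ?L (?K Mod U)" "\<theta> ` G = ?Q"
    "\<forall>g\<in>G. (\<forall>x\<in>?B. g x = x) \<longrightarrow> \<theta> g = U"
    by (rule approximates_imp_hom[OF c k H U(1,2) G approx])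
  interpret hom: group_hom ?L "?K Mod U" \<theta>
    by (intro group_hom.intro group_hom_axioms.intro L.group_axioms U.factorgroup_is_group \<theta>(1))
  define N where "N = kernel ?L (?K Mod U) \<theta>"
  have N_sub: "subgroup N ?L" unfolding N_def by (rule hom.subgroup_kernel)
  have N_iff: "g \<in> N \<longleftrightarrow> g \<in> G \<and> \<theta> g = U" for g
    by (simp add: N_def kernel_def FactGroup_def)
  have coset_eq: "N #>\<^bsub>?L\<^esub> g = N #>\<^bsub>?L\<^esub> g'" if g: "g \<in> G" "g' \<in> G" "\<theta> g = \<theta> g'" for g g'
  proof -
    have "\<theta> (g \<otimes>\<^bsub>?L\<^esub> inv\<^bsub>?L\<^esub> g') = \<theta> g \<otimes>\<^bsub>?K Mod U\<^esub> inv\<^bsub>?K Mod U\<^esub> \<theta> g'"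
      using g(1,2) L.inv_closed[of g'] hom.hom_mult[of g "inv\<^bsub>?L\<^esub> g'"] hom.hom_inv[of g'] by simp
    also have "\<dots> = \<one>\<^bsub>?K Mod U\<^esub>"
    proof -
      have "\<theta> g' \<in> carrier (?K Mod U)" using hom.hom_closed[of g'] g(2) by simp
      then show ?thesis unfolding g(3) by (rule group.r_inv[OF U.factorgroup_is_group])
    qed
    finally have "g \<otimes>\<^bsub>?L\<^esub> inv\<^bsub>?L\<^esub> g' \<in> N"
      using g(1,2) L.m_closed[of g "inv\<^bsub>?L\<^esub> g'"] L.inv_closed[of g'] by (simp add: N_iff FactGroup_def)
    then show ?thesis using L.rcos_eq_iff[OF N_sub] g(1,2) by simp
  qed
  have "finite (\<theta> ` G)" using \<theta>(2) U(3) by simp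
  then have "finite ((\<lambda>g. N #>\<^bsub>?L\<^esub> g) ` G)" by (rule finite_image_factor) (rule coset_eq)
  moreover have "rcosets\<^bsub>?L\<^esub> N = (\<lambda>g. N #>\<^bsub>?L\<^esub> g) ` G" by (auto simp: RCOSETS_def)
  ultimately have N_fin: "group_index ?L N < \<infinity>" by (simp add: group_index_def ecard_def)
  \<comment> \<open>Elements of \<open>G\<close> fixing the ball are in the kernel, so membership of
    the kernel depends only on values on this finite ball.\<close>
  let ?P = "\<lambda>g. \<exists>n\<in>N. \<forall>x\<in>?B. g x = n x"
  have "openin T {g \<in> carrier A. ?P g}"
    by (rule openin_T_local[OF finite_gball[OF lf c, of "R + k"] gball_subset]) simp
  moreover have "N = {g \<in> carrier A. ?P g} \<inter> G"
  proof (intro equalityI subsetI)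
    fix g assume g: "g \<in> N"
    then have "g \<in> G" by (simp add: N_iff)
    moreover have "?P g" using g by (intro bexI[of _ g]) simp
    ultimately show "g \<in> {g \<in> carrier A. ?P g} \<inter> G" using GA by simp
  next
    fix g assume g: "g \<in> {g \<in> carrier A. ?P g} \<inter> G"
    then have gG: "g \<in> G" by simp
    obtain n where n: "n \<in> N" "\<forall>x\<in>?B. g x = n x" using g by auto
    have nG: "n \<in> G" "\<theta> n = U" using n(1) by (simp_all add: N_iff)
    let ?e = "inv\<^bsub>A\<^esub> n \<otimes>\<^bsub>A\<^esub> g"
    have e: "?e \<in> G" by (rule subgroup.m_closed[OF G subgroup.m_inv_closed[OF G nG(1)] gG])
    have "\<theta> ?e = U"
    proof (rule \<theta>(3)[THEN bspec, OF e, THEN mp], rule ballI)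
      fix x assume x: "x \<in> ?B"
      then have xC: "x \<in> Ch" using gball_subset by blast
      have "?e x = (inv\<^bsub>A\<^esub> n) (n x)"
        using aut_mult[OF _ GA[OF gG] xC, of "inv\<^bsub>A\<^esub> n"] GA[OF nG(1)] n(2) x by simp
      then show "?e x = x" using aut_inv(1)[OF GA[OF nG(1)] xC] by simp
    qed
    then have "?e \<in> N" using e by (simp add: N_iff)
    then have "n \<otimes>\<^bsub>A\<^esub> ?e \<in> N" using subgroup.m_closed[OF N_sub n(1)] by simp
    then show "g \<in> N" using aut_cancel[OF GA[OF nG(1)] GA[OF gG]] by simp
  qed
  ultimately have "openin (subtopology T G) N" unfolding openin_subtopology by (intro exI conjI)
  then have "N \<in> open_fin_index_subgroups ?L (subtopology T G)"
    using N_sub N_fin by (simp add: open_fin_index_subgroups_def)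
  then have FN: "?F \<subseteq> N" by (auto simp: fin_residual_def)
  have F_one: "\<one>\<^bsub>A\<^esub> \<in> ?F"
    using subgroup.one_closed subgroup.one_closed[OF G]
    by (force simp: fin_residual_def open_fin_index_subgroups_def)
  define \<gamma> where "\<gamma> = inv_into G \<theta>"
  have \<gamma>: "\<gamma> q \<in> G" "\<theta> (\<gamma> q) = q" if "q \<in> ?Q" for q
    using that \<theta>(2) by (auto simp: \<gamma>_def inv_into_into f_inv_into_f)
  have "inj_on (\<lambda>q. ?F #>\<^bsub>?L\<^esub> \<gamma> q) ?Q"
  proof (rule inj_onI)
    fix q q' assume q: "q \<in> ?Q" "q' \<in> ?Q" and eq: "?F #>\<^bsub>?L\<^esub> \<gamma> q = ?F #>\<^bsub>?L\<^esub> \<gamma> q'"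
    have "\<one>\<^bsub>A\<^esub> \<otimes>\<^bsub>A\<^esub> \<gamma> q \<in> ?F #>\<^bsub>?L\<^esub> \<gamma> q" using F_one by (auto simp: r_coset_def)
    then have "\<gamma> q \<in> ?F #>\<^bsub>?L\<^esub> \<gamma> q'" using GA[OF \<gamma>(1)[OF q(1)]] eq by simp
    then obtain f where f: "f \<in> ?F" "\<gamma> q = f \<otimes>\<^bsub>A\<^esub> \<gamma> q'" by (auto simp: r_coset_def)
    have fN: "f \<in> G" "\<theta> f = \<one>\<^bsub>?K Mod U\<^esub>" using f(1) FN by (auto simp: N_iff FactGroup_def)
    have mult: "\<theta> (\<gamma> q) = \<theta> f \<otimes>\<^bsub>?K Mod U\<^esub> \<theta> (\<gamma> q')"
      using hom.hom_mult[of f "\<gamma> q'"] fN(1) \<gamma>(1)[OF q(2)] f(2) by simp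
    have cl: "\<theta> (\<gamma> q') \<in> carrier (?K Mod U)"
      using hom.hom_closed[of "\<gamma> q'"] \<gamma>(1)[OF q(2)] by simp
    have "\<theta> (\<gamma> q) = \<theta> (\<gamma> q')"
      using mult unfolding fN(2) monoid.l_one[OF group.is_monoid[OF U.factorgroup_is_group] cl] .
    then show "q = q'" using \<gamma>(2) q by simp
  qed
  moreover have "(\<lambda>q. ?F #>\<^bsub>?L\<^esub> \<gamma> q) ` ?Q \<subseteq> rcosets\<^bsub>?L\<^esub> ?F"
    using \<gamma>(1) by (auto simp: RCOSETS_def)
  ultimately show ?thesis unfolding group_index_def by (rule ecard_le_inj)
qed

section \<open>Comparison of indices and topological simplicity\<close>

lemma subgroup_Mon:
  assumes "subgroup H A"
  shows "subgroup (Mon (subgroup_of A H) T') (subgroup_of A H)"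
proof -
  interpret K: group "subgroup_of A H" by (rule group_subgroup_of[OF assms])
  let ?N = "{N \<in> closed_normal_subgroups (subgroup_of A H) T'. N \<noteq> {\<one>\<^bsub>subgroup_of A H\<^esub>}}"
  have "Mon (subgroup_of A H) T' = \<Inter> (insert (carrier (subgroup_of A H)) ?N)"
    by (auto simp: Mon_def)
  moreover have "subgroup (\<Inter> (insert (carrier (subgroup_of A H)) ?N)) (subgroup_of A H)"
    by (rule K.subgroups_Inter)
      (auto simp: closed_normal_subgroups_def K.subgroup_self[simplified] intro: normal_imp_subgroup)
  ultimately show ?thesis by simp
qed

lemma ex_congruence_subgroup_avoiding:
  assumes "locally_finite_building S Ch \<delta>" "thick_building W S Ch \<delta>"
    and "coxeter_irreducible W S" "c \<in> Ch"
    and H: "subgroup H A" "weyl_transitive W Ch \<delta> H"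
    and "finite P" "P \<subseteq> H - Mon (subgroup_of A H) (subtopology T H)"
  shows "\<exists>U. congruence_subgroup H c U \<and> P \<inter> U = {}"
  using assms(7,8)
proof (induction P)
  case empty
  then show ?case using congruence_subgroup_self[OF H(1)] by auto
next
  case (insert p P)
  then obtain U where U: "congruence_subgroup H c U" "P \<inter> U = {}" by auto
  have p: "p \<in> H" "p \<notin> Mon (subgroup_of A H) (subtopology T H)" using insert.prems by auto
  obtain V where V: "congruence_subgroup H c V" "p \<notin> V"
    by (rule not_Mon_imp_congruence_subgroup[OF assms(1-4) H p])
  show ?case
    using congruence_subgroup_Int[OF H(1) U(1) V(1)] U(2) V(2) by (intro exI[of _ "U \<inter> V"]) auto
qed

text \<open>Among representatives of \<open>r\<close> cosets of Mon, the quotients of distinct ones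
  lie outside Mon. A congruence subgroup avoiding these finitely many elements still separates the
  cosets.\<close>

lemma ex_congruence_subgroup_index:
  assumes "locally_finite_building S Ch \<delta>" "thick_building W S Ch \<delta>"
    and "coxeter_irreducible W S" "c \<in> Ch"
    and H: "subgroup H A" "weyl_transitive W Ch \<delta> H"
    and r: "enat r \<le> group_index (subgroup_of A H) (Mon (subgroup_of A H) (subtopology T H))"
  obtains U where "congruence_subgroup H c U" "enat r \<le> ecard (rcosets\<^bsub>subgroup_of A H\<^esub> U)"
proof -
  let ?K = "subgroup_of A H"
  let ?M = "Mon ?K (subtopology T H)"
  interpret K: group ?K by (rule group_subgroup_of[OF H(1)])
  have M_sub: "subgroup ?M ?K" by (rule subgroup_Mon[OF H(1)])
  obtain D where D: "D \<subseteq> rcosets\<^bsub>?K\<^esub> ?M" "finite D" "card D = r"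
  proof (cases "finite (rcosets\<^bsub>?K\<^esub> ?M)")
    case True
    then have "r \<le> card (rcosets\<^bsub>?K\<^esub> ?M)" using r by (simp add: group_index_def ecard_def)
    then show ?thesis using obtain_subset_with_card_n that by metis
  next
    case False
    then show ?thesis using infinite_arbitrarily_large that by metis
  qed
  have "\<forall>C\<in>D. \<exists>x\<in>H. C = ?M #>\<^bsub>?K\<^esub> x" using D(1) by (auto simp: RCOSETS_def)
  then obtain \<rho> where \<rho>: "\<And>C. C \<in> D \<Longrightarrow> \<rho> C \<in> H" "\<And>C. C \<in> D \<Longrightarrow> C = ?M #>\<^bsub>?K\<^esub> \<rho> C" by metis
  let ?d = "\<lambda>(C, C'). \<rho> C \<otimes>\<^bsub>?K\<^esub> inv\<^bsub>?K\<^esub> \<rho> C'"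
  let ?X = "{(C, C'). C \<in> D \<and> C' \<in> D \<and> C \<noteq> C'}"
  have "?X \<subseteq> D \<times> D" by auto
  then have "finite (?d ` ?X)" using D(2) by (meson finite_SigmaI finite_imageI finite_subset)
  moreover have "?d ` ?X \<subseteq> H - ?M"
  proof
    fix p assume "p \<in> ?d ` ?X"
    then obtain C C' where C: "C \<in> D" "C' \<in> D" "C \<noteq> C'" "p = \<rho> C \<otimes>\<^bsub>?K\<^esub> inv\<^bsub>?K\<^esub> \<rho> C'" by auto
    have car: "\<rho> C \<in> carrier ?K" "\<rho> C' \<in> carrier ?K" using \<rho>(1) C(1,2) by simp_all
    have "p \<in> carrier ?K" unfolding C(4) by (intro K.m_closed K.inv_closed car)
    moreover have "p \<notin> ?M"
      using K.rcos_eq_iff[OF M_sub car] \<rho>(2)[OF C(1)] \<rho>(2)[OF C(2)] C(3,4) by simp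
    ultimately show "p \<in> H - ?M" by simp
  qed
  ultimately obtain U where U: "congruence_subgroup H c U" "?d ` ?X \<inter> U = {}"
    using ex_congruence_subgroup_avoiding[OF assms(1-4) H] by blast
  have U_sub: "subgroup U ?K"
    using U(1) normal_imp_subgroup unfolding congruence_subgroup_def by blast
  have "inj_on (\<lambda>C. U #>\<^bsub>?K\<^esub> \<rho> C) D"
  proof (rule inj_onI, rule ccontr)
    fix C C' assume C: "C \<in> D" "C' \<in> D" "U #>\<^bsub>?K\<^esub> \<rho> C = U #>\<^bsub>?K\<^esub> \<rho> C'" "C \<noteq> C'"
    have car: "\<rho> C \<in> carrier ?K" "\<rho> C' \<in> carrier ?K" using \<rho>(1) C(1,2) by simp_all
    have "?d (C, C') \<in> U" using K.rcos_eq_iff[OF U_sub car] C(3) by simp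
    moreover have "?d (C, C') \<in> ?d ` ?X" using C by (intro imageI) simp
    ultimately show False using U(2) by blast
  qed
  moreover have "(\<lambda>C. U #>\<^bsub>?K\<^esub> \<rho> C) ` D \<subseteq> rcosets\<^bsub>?K\<^esub> U"
    using \<rho>(1) by (auto simp: RCOSETS_def)
  ultimately have "ecard D \<le> ecard (rcosets\<^bsub>?K\<^esub> U)" by (rule ecard_le_inj)
  then show ?thesis using that[OF U(1)] D(2,3) by (simp add: ecard_def)
qed

text \<open>Each finite \<open>r\<close> below the index needs a single finite quotient, hence a
  single ball, which serves all large \<open>n\<close>. Letting \<open>r\<close> grow covers
  infinite index.\<close>

lemma Mon_index_le_limsup:
  assumes "finite S" and irr: "coxeter_irreducible W S"
    and lf: "locally_finite_building S Ch \<delta>" and thick: "thick_building W S Ch \<delta>"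
    and Hseq: "\<And>n. n \<ge> 1 \<Longrightarrow> Hseq n \<in> closed_subgroups A T"
    and lim: "limitin (chabauty A T) Hseq H sequentially"
    and weyl: "weyl_transitive W Ch \<delta> H"
  shows "group_index (subgroup_of A H) (Mon (subgroup_of A H) (subtopology T H))
    \<le> limsup (\<lambda>n. group_index (subgroup_of A (Hseq n))
        (fin_residual (subgroup_of A (Hseq n)) (subtopology T (Hseq n))))" (is "?a \<le> limsup ?i")
proof -
  obtain c where c: "c \<in> Ch" using chambers_nonempty by blast
  obtain k where k: "dihedral_bound k" using ex_dihedral_bound[OF assms(1)] by blast
  have "H \<in> closed_subgroups A T" using limitin_topspace[OF lim] by simp
  then have H: "subgroup H A" by (simp add: closed_subgroups_def)
  note trans = weyl_transitive_imp_chamber_transitive[OF weyl]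
  have bound: "enat r \<le> limsup ?i" if r: "enat r \<le> ?a" for r
  proof -
    obtain U where U: "congruence_subgroup H c U" "enat r \<le> ecard (rcosets\<^bsub>subgroup_of A H\<^esub> U)"
      by (rule ex_congruence_subgroup_index[OF lf thick irr c H weyl r])
    obtain R where R: "U \<lhd> subgroup_of A H" "fixator H c R \<subseteq> U" "finite (rcosets\<^bsub>subgroup_of A H\<^esub> U)"
      using U(1) unfolding congruence_subgroup_def by blast
    have "\<forall>\<^sub>F n in sequentially. enat r \<le> ?i n"
      \<comment> \<open>\<open>Hseq 0\<close> is arbitrary, so only indices from 1 on are
        used.\<close>
      using eventually_approximates[OF lf c lim, of k "R + k"] eventually_ge_at_top[of 1]
    proof eventually_elim
      case (elim n)
      have "subgroup (Hseq n) A" using Hseq[OF elim(2)] by (simp add: closed_subgroups_def)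
      from index_le_fin_residual_index[OF c k lf H trans R this elim(1)] U(2)
      show ?case by (rule order_trans[rotated])
    qed
    then have "enat r \<le> liminf ?i" by (rule Liminf_bounded)
    also have "\<dots> \<le> limsup ?i" by (rule Liminf_le_Limsup) simp
    finally show ?thesis .
  qed
  show ?thesis
  proof (cases ?a)
    case (enat r)
    then show ?thesis using bound[of r] by simp
  next
    case infinity
    show ?thesis
    proof (cases "limsup ?i")
      case (enat m)
      then show ?thesis using bound[of "Suc m"] infinity by simp
    qed simp
  qed
qed

text \<open>Index at most 1 makes Mon all of \<open>H\<close>, so a non-trivial closed normal
  subgroup contains \<open>H\<close>. Transitivity on infinitely many chambers makes
  \<open>H\<close> non-trivial.\<close>

lemma topologically_simple_if_Mon_index:
  assumes c: "c \<in> Ch" and "infinite Ch" and H: "subgroup H A" "chamber_transitive H"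
    and le: "group_index (subgroup_of A H) (Mon (subgroup_of A H) T') \<le> 1"
  shows "topologically_simple (subgroup_of A H) T'"
proof -
  let ?K = "subgroup_of A H" and ?M = "Mon (subgroup_of A H) T'"
  interpret K: group ?K by (rule group_subgroup_of[OF H(1)])
  have M_sub: "subgroup ?M ?K" by (rule subgroup_Mon[OF H(1)])
  have fin: "finite (rcosets\<^bsub>?K\<^esub> ?M)" and card: "card (rcosets\<^bsub>?K\<^esub> ?M) \<le> 1"
    using le by (auto simp: group_index_def ecard_def one_enat_def split: if_splits)
  have "H \<subseteq> ?M"
  proof
    fix h assume h: "h \<in> H"
    have one: "\<one>\<^bsub>?K\<^esub> \<in> carrier ?K" by (rule K.one_closed)
    have "?M #>\<^bsub>?K\<^esub> h \<in> rcosets\<^bsub>?K\<^esub> ?M" "?M #>\<^bsub>?K\<^esub> \<one>\<^bsub>?K\<^esub> \<in> rcosets\<^bsub>?K\<^esub> ?M"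
      using K.rcosetsI[OF subgroup.subset[OF M_sub]] h one by simp_all
    then have "?M #>\<^bsub>?K\<^esub> h = ?M #>\<^bsub>?K\<^esub> \<one>\<^bsub>?K\<^esub>"
      using card fin by (metis card_le_Suc0_iff_eq One_nat_def)
    then have "h \<otimes>\<^bsub>?K\<^esub> inv\<^bsub>?K\<^esub> \<one>\<^bsub>?K\<^esub> \<in> ?M" using K.rcos_eq_iff[OF M_sub _ one] h by simp
    moreover have "h \<otimes>\<^bsub>?K\<^esub> inv\<^bsub>?K\<^esub> \<one>\<^bsub>?K\<^esub> = h" using h K.inv_one K.r_one[of h] by simp
    ultimately show "h \<in> ?M" by simp
  qed
  then have "N = {\<one>\<^bsub>?K\<^esub>} \<or> N = carrier ?K" if N: "N \<in> closed_normal_subgroups ?K T'" for N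
  proof -
    have "N \<subseteq> carrier ?K"
      using N subgroup.subset normal_imp_subgroup unfolding closed_normal_subgroups_def by blast
    moreover have "N = {\<one>\<^bsub>?K\<^esub>} \<or> ?M \<subseteq> N" using N by (auto simp: Mon_def)
    ultimately show ?thesis using \<open>H \<subseteq> ?M\<close> by auto
  qed
  moreover have "carrier ?K \<noteq> {\<one>\<^bsub>?K\<^esub>}"
  proof
    assume K1: "carrier ?K = {\<one>\<^bsub>?K\<^esub>}"
    have "Ch \<noteq> {c}" using assms(2) by auto
    then obtain y where y: "y \<in> Ch" "y \<noteq> c" using c by blast
    then obtain h where h: "h \<in> H" "h c = y" using H(2) c unfolding chamber_transitive_def by blast
    then have "h = \<one>\<^bsub>A\<^esub>" using K1 by simp
    then show False using h(2) y(2) aut_one[OF c] by simp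
  qed
  ultimately show ?thesis unfolding topologically_simple_def by blast
qed

end

theorem corollary6p8:
  fixes W :: "('w, 'b) monoid_scheme"
    and S :: "'w set"
    and Ch :: "'c set"
    and \<delta> :: "'c \<Rightarrow> 'c \<Rightarrow> 'w"
    and Hseq :: "nat \<Rightarrow> ('c \<Rightarrow> 'c) set"
    and H :: "('c \<Rightarrow> 'c) set"
  defines "A \<equiv> building_aut Ch \<delta>"
    and "T \<equiv> building_aut_topology Ch \<delta>"
  assumes "building W S Ch \<delta>"
    and "finite S"
    and "coxeter_irreducible W S"
    and "virtually_free W"
    and "infinite Ch"
    and "locally_finite_building S Ch \<delta>"
    and "thick_building W S Ch \<delta>"
    and "\<And>n. n \<ge> 1 \<Longrightarrow> Hseq n \<in> closed_subgroups A T"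
    and "limitin (chabauty A T) Hseq H sequentially"
    and "weyl_transitive W Ch \<delta> H"
  shows "group_index (subgroup_of A H) (Mon (subgroup_of A H) (subtopology T H))
           \<le> limsup (\<lambda>n. group_index (subgroup_of A (Hseq n))
                (fin_residual (subgroup_of A (Hseq n)) (subtopology T (Hseq n))))
      \<and> ((\<forall>n\<ge>1. \<forall>U \<in> open_fin_index_subgroups (subgroup_of A (Hseq n)) (subtopology T (Hseq n)).
              U = Hseq n)
           \<longrightarrow> topologically_simple (subgroup_of A H) (subtopology T H))"
proof (intro conjI impI)
  interpret building W S Ch \<delta> by fact
  let ?i = "\<lambda>n. group_index (subgroup_of A (Hseq n))
    (fin_residual (subgroup_of A (Hseq n)) (subtopology T (Hseq n)))"
  show le: "group_index (subgroup_of A H) (Mon (subgroup_of A H) (subtopology T H)) \<le> limsup ?i"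
    using Mon_index_le_limsup[of Hseq H] assms(4,5,8-12) unfolding A_def T_def by blast
  assume triv: "\<forall>n\<ge>1. \<forall>U \<in> open_fin_index_subgroups (subgroup_of A (Hseq n)) (subtopology T (Hseq n)).
    U = Hseq n"
  \<comment> \<open>Here the residual is the whole group, so it has a single coset.\<close>
  have "?i n \<le> 1" if n: "n \<ge> 1" for n
  proof -
    let ?L = "subgroup_of A (Hseq n)"
    have G: "subgroup (Hseq n) (building_aut Ch \<delta>)"
      using assms(10)[OF n] by (simp add: closed_subgroups_def A_def)
    interpret L: group ?L unfolding A_def by (rule group_subgroup_of[OF G])
    have "fin_residual ?L (subtopology T (Hseq n)) = Hseq n"
      using triv n by (auto simp: fin_residual_def)
    moreover have "rcosets\<^bsub>?L\<^esub> (Hseq n) \<subseteq> {Hseq n}"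
      using L.coset_join2[of _ "Hseq n"] L.subgroup_self by (auto simp: RCOSETS_def)
    then have "ecard (rcosets\<^bsub>?L\<^esub> (Hseq n)) \<le> ecard {Hseq n}"
      using ecard_le_inj[of id] by simp
    ultimately show ?thesis by (simp add: group_index_def ecard_def one_enat_def)
  qed
  then have "\<forall>\<^sub>F n in sequentially. ?i n \<le> 1"
    using eventually_ge_at_top[of 1] by (rule eventually_mono[rotated])
  then have "limsup ?i \<le> 1" by (rule Limsup_bounded)
  with le have "group_index (subgroup_of A H) (Mon (subgroup_of A H) (subtopology T H)) \<le> 1"
    by (rule order_trans)
  moreover obtain c where "c \<in> Ch" using chambers_nonempty by blast
  moreover have "H \<in> closed_subgroups A T" using limitin_topspace[OF assms(11)] by simp
  then have "subgroup H A" by (simp add: closed_subgroups_def)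
  ultimately show "topologically_simple (subgroup_of A H) (subtopology T H)"
    using topologically_simple_if_Mon_index[of c H "subtopology T H"] assms(7)
      weyl_transitive_imp_chamber_transitive[OF assms(12)]
    unfolding A_def by blast
qed

end
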